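(* Let $(\Omega,\mathcal{F},\mathbb{P})$ be an atomless probability space, $p\in[1,\infty]$, and let $\rho$ be a law-invariant coherent risk measure on $\mathcal{L}^p(\Omega,\mathcal{F},\mathbb{P})$ with associated functional $\mathcal{R}:\mathbb{F}^p\to\mathbb{R}$. Let $\mathcal{K}_{\mathcal{R}}$ be a set of continuous convex distribution functions on the unit interval such that $$\mathcal{R}(H)=\sup_{K\in\mathcal{K}_{\mathcal{R}}}\mathcal{L}_K(H)\qquad\text{for all }H\in\mathbb{F}^p .$$ Let $0\le\beta'<\gamma\le1$, $C'>0$ and $L:(0,1)\to(0,\infty)$ be such that $L(x)\le C'x^{-\beta'}(1-x)^{-\beta'}$ for all $x\in(0,1)$ and such that every $K\in\mathcal{K}_{\mathcal{R}}$ is locally Lipschitz continuous at every $x\in(0,1)$ with local Lipschitz constant $L(x)$ (that is, $|K(y)-K(x)|\le L(x)|y-x|$ for all $y\in[0,1]$). Let $F\in\mathbb{F}^p$ with $F(x)\in(0,1)$ for all $x\in\mathbb{R}$, put $\overline F:=1-F$, and assume $$\int_{-\infty}^0F(x)^{\gamma-\beta'}\,dx+\int_0^\infty\overline F(x)^{\gamma-\beta'}\,dx<\infty.$$ Put $\phi_{\gamma,F}(x):=F(x)^{-\gamma}\mathbf{1}_{(-\infty,0)}(x)+\overline F(x)^{-\gamma}\mathbf{1}_{[0,\infty)}(x)$. Let $(X_i)_{i\in\mathbb{N}}$ be identically distributed random variables on $(\Omega,\mathcal{F},\mathbb{P})$ with distribution function $F$, $\widehat F_n=\frac1n\sum_{i=1}^n\mathbf{1}_{[X_i,\infty)}$,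 and $\widehat{\mathbb{F}}:=\bigcup_{n\in\mathbb{N}}\{\widehat F_n(\omega):\omega\in\Omega\}$. Then: (1) $\mathcal{R}$ is H\"older-$1$ continuous at $F$ with respect to $(\|\cdot\|_{\phi_{\gamma,F}},|\cdot|)$ and $\widehat{\mathbb{F}}$, i.e. for every sequence $(F_n)\subset\widehat{\mathbb{F}}$ with $\|F_n-F\|_{\phi_{\gamma,F}}\to0$ one has $|\mathcal{R}(F_n)-\mathcal{R}(F)|=\mathcal{O}(\|F_n-F\|_{\phi_{\gamma,F}})$. (2) If the $X_i$ are independent and $\int_{-\infty}^\infty\phi_{\gamma,F}(x)^{1/(1-r)}\,dF(x)<\infty$ for some $r\in[0,\frac12)$, then $n^r|\mathcal{R}(\widehat F_n)-\mathcal{R}(F)|\to0$ $\mathbb{P}$-a.s. (for this $r$). (3) If $(X_i)$ is $\alpha$-mixing with mixing coefficients $(\alpha(n))$, $\int_{-\infty}^\infty\phi_{\gamma,F}\,dF<\infty$, and $\int_0^1\log(1+\alpha^{\rightarrow}(s/2))\,\overline G^{\rightarrow}(s)\,ds<\infty$, where $\alpha(t):=\alpha(\lfloor t\rfloor)$ for $t\in\mathbb{R}_+$, $\overline G:=1-G$ and $G$ is the distribution function of $\phi_{\gamma,F}(X_1)$, then $|\mathcal{R}(\widehat F_n)-\mathcal{R}(F)|\to0$ $\mathbb{P}$-a.s.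
   Context: A law-invariant coherent risk measure on $\mathcal{X}=\mathcal{L}^p(\Omega,\mathcal{F},\mathbb{P})$ is a map $\rho:\mathcal{X}\to\mathbb{R}$ that depends on $X$ only through its distribution and is monotone ($\rho(X)\le\rho(Y)$ if $X\le Y$ a.s.), translation-equivariant ($\rho(X+m)=\rho(X)+m$ for $m\in\mathbb{R}$), subadditive ($\rho(X+Y)\le\rho(X)+\rho(Y)$) and positively homogeneous ($\rho(\lambda X)=\lambda\rho(X)$ for $\lambda\ge0$). $\mathbb{F}^p$ is the set of distribution functions of random variables in $\mathcal{L}^p(\Omega,\mathcal{F},\mathbb{P})$, and the associated functional is $\mathcal{R}(F_X):=\rho(X)$, where $F_X$ is the distribution function of $X$. Atomless means that the space supports a random variable with continuous distribution. For a distribution function $K$ of a probability measure on $[0,1]$, $\mathcal{L}_K(H):=\int_{-\infty}^\infty x\,dK(H(x))$ for all distribution functions $H$ on $\mathbb{R}$ with $\int_{-\infty}^\infty|x|\,dK(H(x))<\infty$; this integrability is part of the assumed representation of $\mathcal{R}$ for every $H\in\mathbb{F}^p$, $K\in\mathcal{K}_{\mathcal{R}}$. (A set $\mathcal{K}_{\mathcal{R}}$ with the representation property always exists in this situation, by known results.) For functions $\psi,\phi$ on $\mathbb{R}$ with $\phi\ge0$, $\|\psi\|_\phi:=\sup_{x\in\mathbb{R}}|\psi(x)|\phi(x)$. The mixing coefficients are $\alpha(n):=\sup_{k\ge1}\sup_{A,B}|\mathbb{P}[A\cap B]-\mathbb{P}[A]\mathbb{P}[B]|$, where the second supremum ranges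 over all $A\in\sigma(X_1,\dots,X_k)$ and $B\in\sigma(X_{k+n},X_{k+n+1},\dots)$; $\alpha(0)$ is given by the same formula with $n=0$. The sequence is $\alpha$-mixing if $\alpha(n)\to0$. For a nonincreasing $h:\mathbb{R}_+\to[0,1]$, $h^{\rightarrow}(y):=\sup\{x\in\mathbb{R}_+:h(x)>y\}$, $y\in[0,1]$, with $\sup\emptyset:=0$. *)

theory Defs
  imports "HOL-Probability.Probability" "HOL-Library.Landau_Symbols"
begin

definition atomless :: "'a measure \<Rightarrow> bool" where
  "atomless M \<longleftrightarrow>
     (\<exists>U \<in> borel_measurable M. continuous_on UNIV (cdf (distr M borel U)))"

text \<open>Elements of \<open>L^p\<close> are random variables, not classes modulo a.s. equality; the
  law-invariant maps considered below do not distinguish a.s. equal random variables.\<close>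

definition Lp_space :: "'a measure \<Rightarrow> ennreal \<Rightarrow> ('a \<Rightarrow> real) set" where
  "Lp_space M p = {X \<in> borel_measurable M.
     if p = \<infinity> then \<exists>C. AE \<omega> in M. \<bar>X \<omega>\<bar> \<le> C
     else integrable M (\<lambda>\<omega>. \<bar>X \<omega>\<bar> powr enn2real p)}"

definition law_invariant :: "'a measure \<Rightarrow> ennreal \<Rightarrow> (('a \<Rightarrow> real) \<Rightarrow> real) \<Rightarrow> bool" where
  "law_invariant M p \<rho> \<longleftrightarrow>
     (\<forall>X \<in> Lp_space M p. \<forall>Y \<in> Lp_space M p.
        distr M borel X = distr M borel Y \<longrightarrow> \<rho> X = \<rho> Y)"

definition coherent_risk_measure :: "'a measure \<Rightarrow> ennreal \<Rightarrow> (('a \<Rightarrow> real) \<Rightarrow> real) \<Rightarrow> bool" where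
  "coherent_risk_measure M p \<rho> \<longleftrightarrow>
     (\<forall>X \<in> Lp_space M p. \<forall>Y \<in> Lp_space M p. (AE \<omega> in M. X \<omega> \<le> Y \<omega>) \<longrightarrow> \<rho> X \<le> \<rho> Y) \<and>
     (\<forall>X \<in> Lp_space M p. \<forall>m. \<rho> (\<lambda>\<omega>. X \<omega> + m) = \<rho> X + m) \<and>
     (\<forall>X \<in> Lp_space M p. \<forall>Y \<in> Lp_space M p. \<rho> (\<lambda>\<omega>. X \<omega> + Y \<omega>) \<le> \<rho> X + \<rho> Y) \<and>
     (\<forall>X \<in> Lp_space M p. \<forall>c \<ge> 0. \<rho> (\<lambda>\<omega>. c * X \<omega>) = c * \<rho> X)"

definition dist_funs :: "'a measure \<Rightarrow> ennreal \<Rightarrow> (real \<Rightarrow> real) set" where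
  "dist_funs M p = (\<lambda>X. cdf (distr M borel X)) ` Lp_space M p"

text \<open>Independent of the chosen representative when \<open>\<rho>\<close> is law-invariant
  (lemma \<open>risk_functional_cdf\<close>), and only meaningful on \<open>dist_funs M p\<close>.\<close>

definition risk_functional ::
    "'a measure \<Rightarrow> ennreal \<Rightarrow> (('a \<Rightarrow> real) \<Rightarrow> real) \<Rightarrow> (real \<Rightarrow> real) \<Rightarrow> real" where
  "risk_functional M p \<rho> H = \<rho> (SOME X. X \<in> Lp_space M p \<and> cdf (distr M borel X) = H)"

lemma risk_functional_cdf:
  assumes "prob_space M" "law_invariant M p \<rho>" "X \<in> Lp_space M p"
  shows "risk_functional M p \<rho> (cdf (distr M borel X)) = \<rho> X"
proof -
  interpret prob_space M by fact
  define Y where "Y = (SOME Y. Y \<in> Lp_space M p \<and> cdf (distr M borel Y) = cdf (distr M borel X))"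
  have Y: "Y \<in> Lp_space M p \<and> cdf (distr M borel Y) = cdf (distr M borel X)"
    unfolding Y_def by (rule someI[of _ X]) (use assms(3) in simp)
  have "real_distribution (distr M borel Z)" if "Z \<in> Lp_space M p" for Z
    using that by (intro real_distribution_distr) (auto simp: Lp_space_def)
  with Y assms(3) have "distr M borel Y = distr M borel X"
    by (intro cdf_unique) auto
  with Y assms(2,3) have "\<rho> Y = \<rho> X"
    unfolding law_invariant_def by blast
  then show ?thesis
    by (simp add: risk_functional_def Y_def)
qed

text \<open>Distribution functions of probability measures on the unit interval, regarded as functions
  on the whole real line (\<open>0\<close> to the left and \<open>1\<close> to the right of the interval).  Thus continuity
  of such a function on \<open>UNIV\<close> includes that the measure has no atom at \<open>0\<close>.\<close>

definition unit_interval_df :: "(real \<Rightarrow> real) \<Rightarrow> bool" where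
  "unit_interval_df K \<longleftrightarrow>
     (\<exists>\<mu>. real_distribution \<mu> \<and> measure \<mu> {0..1} = 1 \<and> K = cdf \<mu>)"

definition L_integrable :: "(real \<Rightarrow> real) \<Rightarrow> (real \<Rightarrow> real) \<Rightarrow> bool" where
  "L_integrable K H \<longleftrightarrow> integrable (interval_measure (\<lambda>x. K (H x))) (\<lambda>x. x)"

definition L_functional :: "(real \<Rightarrow> real) \<Rightarrow> (real \<Rightarrow> real) \<Rightarrow> real" where
  "L_functional K H = (\<integral>x. x \<partial>interval_measure (\<lambda>x. K (H x)))"

text \<open>The supremum is taken in the extended reals, so the equation itself says that
  the set is nonempty and the supremum finite.\<close>

definition L_representation ::
    "(real \<Rightarrow> real) set \<Rightarrow> (real \<Rightarrow> real) set \<Rightarrow> ((real \<Rightarrow> real) \<Rightarrow> real) \<Rightarrow> bool" where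
  "L_representation KK \<F> R \<longleftrightarrow>
     (\<forall>H \<in> \<F>. (\<forall>K \<in> KK. L_integrable K H) \<and>
              ereal (R H) = (SUP K \<in> KK. ereal (L_functional K H)))"

definition weighted_sup_norm :: "(real \<Rightarrow> real) \<Rightarrow> (real \<Rightarrow> real) \<Rightarrow> ennreal" where
  "weighted_sup_norm \<phi> \<psi> = (SUP x. ennreal (\<bar>\<psi> x\<bar> * \<phi> x))"

definition phi_weight :: "real \<Rightarrow> (real \<Rightarrow> real) \<Rightarrow> real \<Rightarrow> real" where
  "phi_weight \<gamma> F x = (if x < 0 then F x powr (-\<gamma>) else (1 - F x) powr (-\<gamma>))"

text \<open>Sequences of random variables are indexed from \<open>1\<close>; the value at index \<open>0\<close> is never used.\<close>

definition empirical_df :: "(nat \<Rightarrow> 'a \<Rightarrow> real) \<Rightarrow> nat \<Rightarrow> 'a \<Rightarrow> real \<Rightarrow> real" where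
  "empirical_df X n \<omega> x = (\<Sum>i=1..n. indicator {X i \<omega>..} x) / real n"

definition empirical_dfs :: "'a measure \<Rightarrow> (nat \<Rightarrow> 'a \<Rightarrow> real) \<Rightarrow> (real \<Rightarrow> real) set" where
  "empirical_dfs M X = (\<Union>n \<in> {1..}. empirical_df X n ` space M)"

definition sigma_gen_by :: "'a measure \<Rightarrow> (nat \<Rightarrow> 'a \<Rightarrow> real) \<Rightarrow> nat set \<Rightarrow> 'a set set" where
  "sigma_gen_by M X I =
     sigma_sets (space M) {X i -` S \<inter> space M | i S. i \<in> I \<and> S \<in> sets borel}"

definition mixing_coeff :: "'a measure \<Rightarrow> (nat \<Rightarrow> 'a \<Rightarrow> real) \<Rightarrow> nat \<Rightarrow> real" where
  "mixing_coeff M X n =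
     (SUP k \<in> {1..}. SUP (A, B) \<in> sigma_gen_by M X {1..k} \<times> sigma_gen_by M X {k + n..}.
        \<bar>measure M (A \<inter> B) - measure M A * measure M B\<bar>)"

definition alpha_mixing :: "'a measure \<Rightarrow> (nat \<Rightarrow> 'a \<Rightarrow> real) \<Rightarrow> bool" where
  "alpha_mixing M X \<longleftrightarrow> mixing_coeff M X \<longlonglongrightarrow> 0"

text \<open>If \<open>h\<close> tends to \<open>0\<close> at infinity, the set is bounded above for every \<open>y > 0\<close>, so the
  real supremum is then the genuine one.\<close>

definition right_inverse :: "(real \<Rightarrow> real) \<Rightarrow> real \<Rightarrow> real" where
  "right_inverse h y =
     (if {x. 0 \<le> x \<and> h x > y} = {} then 0 else Sup {x. 0 \<le> x \<and> h x > y})"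

end

theory Submission
  imports Defs
begin

text \<open>
  Everything is reduced to one weighted $L^1$ distance between $\widehat F_n$ and $F$.  The means of
  two probability measures differ by at most the $L^1$ distance of their distribution functions, so
  the Lipschitz condition on the functions in \<open>KK\<close> bounds the differences of all the
  \<open>L_functional\<close> values, and with them the difference of the suprema, by
  $\int l\,|H - F|\,dx$ with $l = C' F^{-\beta'}(1-F)^{-\beta'}$ (\<open>risk_diff_le\<close>).  Empirical
  distribution functions lie in the domain because an atomless space carries variables with these laws
  (\<open>empirical_df_in_dist_funs\<close>).  Write $l\,dx = \phi\,d\nu$ with $\phi$ the weight of the theorem.
  The tail condition on $F$ makes $\nu$ finite (\<open>finite_measure_weight\<close>).  Hence
  $|R(\widehat F_n) - R(F)| \le \int \phi\,|\widehat F_n - F|\,d\nu$, which is at most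
  $\nu(\mathbb R)$ times the weighted supremum norm: this is claim (1).

  For claims (2) and (3) this integral is estimated directly.  Up to sign, $\widehat F_n(x) - F(x)$ is the centred mean of the indicators $W_x(X_i)$, where $W_x$ is the
  indicator of $(-\infty,x]$ for $x<0$ and of $(x,\infty)$ for $x\ge 0$.  As $\phi$ grows away from the
  origin on either side, $\phi(x) W_x(y) \le \phi(y)$, so $\phi(X_i)$ dominates all the weighted indicators at once.

  For independent variables put $s = 1/(1-r)$ and work on dyadic blocks $n \le N = 2^k$
  (\<open>iid_weighted_empirical_rate\<close>).  Where $\phi(x) \le N^{1/s}$, an $L^2$ maximal inequality for
  fixed $x$ together with Markov's inequality $\phi(x)^s\,P(W_x(X_1)=1) \le E\,\phi(X_1)^s$ gives bounds
  whose sum over $k$ is finite uniformly in $x$, because $s<2$.  Where $\phi(x) > N^{1/s}$, almost surely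
  no $W_x(X_i)$ with $i \le N$ is nonzero once $k$ is large, and the remaining deterministic part is
  at most $E\,\phi(X_1)^s\,\nu\{\phi > N^{1/s}\} \to 0$.

  For mixing variables dominated convergence with respect to $\nu$ suffices
  (\<open>mixing_weighted_empirical_limit\<close>): it needs the means of the $W_x(X_i)$ to converge for each $x$
  and the means of the $\phi(X_i)$ to stay bounded.  Both follow from a one-sided strong law for
  nonnegative functions of the $X_i$ that are dominated by $\phi$ (\<open>mixing_strong_law_upper\<close>), which is
  where the logarithmic condition is used.  Its core is Rio's method: apply a Huber function to the
  partial sums and expand it telescopically (\<open>mixing_deviation_bounded\<close>).  The far past then enters
  only through a bounded derivative, hence linearly in the quantile function, whereas a variance
  computation would make it enter quadratically.
\<close>

section \<open>Means and distribution functions\<close>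

text \<open>Fubini's theorem for $x = \int (1_{t \ge 0} - 1_{t \ge x})\,dt$; the positive and the negative
  part are treated in one formula.\<close>
lemma expectation_eq_integral_cdf:
  assumes "real_distribution \<mu>" and int: "integrable \<mu> (\<lambda>x. x)"
  shows "integrable lborel (\<lambda>t. indicator {0..} t - cdf \<mu> t)"
    and "(\<integral>x. x \<partial>\<mu>) = (\<integral>t. indicator {0..} t - cdf \<mu> t \<partial>lborel)"
proof -
  interpret real_distribution \<mu> by fact
  interpret pair_sigma_finite \<mu> lborel ..
  define g :: "real \<times> real \<Rightarrow> real"
    where "g = (\<lambda>(x, t). indicator {0..} t - indicator {p. fst p \<le> snd p} (x, t))"
  have g_eq: "(\<lambda>t. g (x, t)) = (if 0 \<le> x then indicator {0..<x} else (\<lambda>t. - indicator {x..<0} t))" for x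
    by (auto simp: g_def fun_eq_iff indicator_def)
  have [measurable]: "g \<in> borel_measurable (\<mu> \<Otimes>\<^sub>M lborel)"
    unfolding g_def by measurable
  have g_int: "integrable lborel (\<lambda>t. g (x, t))" for x
    unfolding g_eq by auto
  have g_integral: "(\<integral>t. g (x, t) \<partial>lborel) = x" for x
    unfolding g_eq by auto
  have "(\<integral>t. norm (g (x, t)) \<partial>lborel) = \<bar>x\<bar>" for x
  proof -
    have "(\<lambda>t. norm (g (x, t))) = (if 0 \<le> x then indicator {0..<x} else indicator {x..<0})"
      using g_eq[of x] by (auto simp: fun_eq_iff indicator_def split: if_splits)
    then show ?thesis by auto
  qed
  then have pair: "integrable (\<mu> \<Otimes>\<^sub>M lborel) g"
  proof (intro Fubini_integrable)
    assume *: "\<And>x. (\<integral>t. norm (g (x, t)) \<partial>lborel) = \<bar>x\<bar>"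
    show "integrable \<mu> (\<lambda>x. \<integral>t. norm (g (x, t)) \<partial>lborel)"
      unfolding * by (rule integrable_abs[OF int])
  qed (use g_int in simp_all)
  have cdf: "(\<integral>x. g (x, t) \<partial>\<mu>) = indicator {0..} t - cdf \<mu> t" for t
  proof -
    have *: "g (x, t) = indicator {0..} t - indicator {..t} x" for x
      by (auto simp: g_def indicator_def)
    show ?thesis
      unfolding * using prob_space
      by (subst Bochner_Integration.integral_diff) (auto intro!: integrable_real_indicator simp: cdf_def less_top[symmetric])
  qed
  show "integrable lborel (\<lambda>t. indicator {0..} t - cdf \<mu> t)"
    using integrable_snd[of "\<lambda>x t. g (x, t)"] pair by (simp add: cdf)
  show "(\<integral>x. x \<partial>\<mu>) = (\<integral>t. indicator {0..} t - cdf \<mu> t \<partial>lborel)"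
    using Fubini_integral[of "\<lambda>x t. g (x, t)"] pair by (simp add: cdf g_integral)
qed

lemma expectation_diff_le_cdf_diff:
  assumes "real_distribution \<mu>" "integrable \<mu> (\<lambda>x. x)"
    and "real_distribution \<nu>" "integrable \<nu> (\<lambda>x. x)"
  shows "ennreal \<bar>(\<integral>x. x \<partial>\<mu>) - (\<integral>x. x \<partial>\<nu>)\<bar>
    \<le> (\<integral>\<^sup>+t. ennreal \<bar>cdf \<mu> t - cdf \<nu> t\<bar> \<partial>lborel)"
proof -
  let ?f = "\<lambda>\<mu> t. indicator {0..} t - cdf \<mu> t :: real"
  note \<mu> = expectation_eq_integral_cdf[OF assms(1,2)]
  note \<nu> = expectation_eq_integral_cdf[OF assms(3,4)]
  have "(\<integral>x. x \<partial>\<mu>) - (\<integral>x. x \<partial>\<nu>) = (\<integral>t. ?f \<mu> t - ?f \<nu> t \<partial>lborel)"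
    by (simp only: \<mu>(2) \<nu>(2) Bochner_Integration.integral_diff[OF \<mu>(1) \<nu>(1)])
  also have "ennreal (norm \<dots>) \<le> (\<integral>\<^sup>+t. ennreal (norm (?f \<mu> t - ?f \<nu> t)) \<partial>lborel)"
    by (intro integral_norm_bound_ennreal Bochner_Integration.integrable_diff \<mu> \<nu>)
  finally show ?thesis
    by (simp add: abs_minus_commute)
qed

text \<open>Continuity of \<open>K\<close> on the whole line forces \<open>K 0 = 0\<close>, so \<open>K\<close> composed with a distribution
  function has the correct limits at both ends.\<close>
lemma interval_measure_compose:
  assumes K: "unit_interval_df K" "continuous_on UNIV K" and H: "real_distribution \<mu>"
  shows "real_distribution (interval_measure (\<lambda>x. K (cdf \<mu> x)))"
    and "cdf (interval_measure (\<lambda>x. K (cdf \<mu> x))) = (\<lambda>x. K (cdf \<mu> x))"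
proof -
  obtain \<kappa> where \<kappa>: "real_distribution \<kappa>" "measure \<kappa> {0..1} = 1" "K = cdf \<kappa>"
    using K(1) by (auto simp: unit_interval_df_def)
  interpret \<kappa>: real_distribution \<kappa> by fact
  interpret real_distribution \<mu> by fact
  have cont: "isCont K x" for x
    using K(2) by (simp add: continuous_on_eq_continuous_at)
  have neg: "K x = 0" if "x < 0" for x
  proof -
    have "measure \<kappa> ({..x} \<union> {0..1}) = measure \<kappa> {..x} + measure \<kappa> {0..1}"
      using that by (intro \<kappa>.finite_measure_Union) auto
    then show ?thesis
      using \<kappa>(2,3) \<kappa>.prob_le_1[of "{..x} \<union> {0..1}"] by (simp add: cdf_def measure_le_0_iff)
  qed
  have "K 0 = 0"
  proof -
    have "(K \<longlongrightarrow> K 0) (at_left 0)"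
      using cont[of 0] by (simp add: isCont_def filterlim_at_split)
    moreover have "(K \<longlongrightarrow> 0) (at_left 0)"
      by (rule tendsto_eventually) (auto simp: eventually_at_filter neg)
    ultimately show ?thesis
      using tendsto_unique trivial_limit_at_left_real by blast
  qed
  have "measure \<kappa> {0..1} \<le> measure \<kappa> {..1}"
    by (intro \<kappa>.finite_measure_mono) auto
  then have "K 1 = 1"
    using \<kappa>(2,3) \<kappa>.prob_le_1[of "{..1}"] by (simp add: cdf_def)
  have mono: "K (cdf \<mu> x) \<le> K (cdf \<mu> y)" if "x \<le> y" for x y
    unfolding \<kappa>(3) by (intro \<kappa>.cdf_nondecreasing cdf_nondecreasing that)
  have right: "continuous (at_right a) (\<lambda>x. K (cdf \<mu> x))" for a
    unfolding continuous_within
    by (intro isCont_tendsto_compose[OF cont] cdf_is_right_cont[unfolded continuous_within])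
  have bot: "((\<lambda>x. K (cdf \<mu> x)) \<longlongrightarrow> 0) at_bot"
    using isCont_tendsto_compose[OF cont cdf_lim_at_bot] \<open>K 0 = 0\<close> by simp
  have top: "((\<lambda>x. K (cdf \<mu> x)) \<longlongrightarrow> 1) at_top"
    using isCont_tendsto_compose[OF cont cdf_lim_at_top_prob] \<open>K 1 = 1\<close> by simp
  show "real_distribution (interval_measure (\<lambda>x. K (cdf \<mu> x)))"
    by (rule real_distribution_interval_measure[OF mono right bot top])
  show "cdf (interval_measure (\<lambda>x. K (cdf \<mu> x))) = (\<lambda>x. K (cdf \<mu> x))"
    by (rule cdf_interval_measure[OF mono right bot])
qed

lemma abs_SUP_diff_le:
  fixes a b :: "'a \<Rightarrow> real"
  assumes "ereal x = (SUP k\<in>K. ereal (a k))" "ereal y = (SUP k\<in>K. ereal (b k))"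
    and "\<And>k. k \<in> K \<Longrightarrow> \<bar>a k - b k\<bar> \<le> c"
  shows "\<bar>x - y\<bar> \<le> c"
proof -
  have *: "x \<le> y + c" if x: "ereal x = (SUP k\<in>K. ereal (a k))" and y: "ereal y = (SUP k\<in>K. ereal (b k))"
    and c: "\<And>k. k \<in> K \<Longrightarrow> \<bar>a k - b k\<bar> \<le> c" for x y and a b :: "'a \<Rightarrow> real"
  proof -
    have "ereal (a k) \<le> ereal (y + c)" if "k \<in> K" for k
    proof -
      have "ereal (b k) \<le> ereal y"
        unfolding y using that by (rule SUP_upper)
      then show ?thesis using c[OF that] by simp
    qed
    then have "ereal x \<le> ereal (y + c)"
      unfolding x by (rule SUP_least)
    then show ?thesis by simp
  qed
  show ?thesis
    using *[OF assms(1,2)] *[OF assms(2,1)] assms(3) by (force simp: abs_le_iff abs_minus_commute)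
qed

text \<open>The bound is uniform over \<open>KK\<close>, hence it survives the passage to the supremum.\<close>
lemma risk_diff_le:
  assumes rep: "L_representation KK \<F> R" and KK: "\<forall>K \<in> KK. unit_interval_df K \<and> continuous_on UNIV K"
    and \<F>: "\<And>H. H \<in> \<F> \<Longrightarrow> \<exists>\<mu>. real_distribution \<mu> \<and> cdf \<mu> = H"
    and HF: "H \<in> \<F>" "F \<in> \<F>" and [measurable]: "l \<in> borel_measurable borel"
    and lip: "\<And>K x. K \<in> KK \<Longrightarrow> \<bar>K (H x) - K (F x)\<bar> \<le> l x * \<bar>H x - F x\<bar>"
  shows "ennreal \<bar>R H - R F\<bar> \<le> (\<integral>\<^sup>+x. ennreal (l x * \<bar>H x - F x\<bar>) \<partial>lborel)" (is "_ \<le> ?I")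
proof (cases "?I = \<top>")
  case False
  define c where "c = enn2real ?I"
  have c: "ennreal c = ?I"
    unfolding c_def using False by (simp add: less_top)
  obtain \<mu> \<nu> where mn: "real_distribution \<mu>" "cdf \<mu> = H" "real_distribution \<nu>" "cdf \<nu> = F"
    using \<F> HF by blast
  have "\<bar>L_functional K H - L_functional K F\<bar> \<le> c" if K: "K \<in> KK" for K
  proof -
    have "ennreal \<bar>L_functional K H - L_functional K F\<bar> \<le> (\<integral>\<^sup>+x. ennreal \<bar>K (H x) - K (F x)\<bar> \<partial>lborel)"
      using expectation_diff_le_cdf_diff[of "interval_measure (\<lambda>x. K (H x))" "interval_measure (\<lambda>x. K (F x))"]
        interval_measure_compose[of K \<mu>] interval_measure_compose[of K \<nu>] mn K KK rep HF
      unfolding L_functional_def L_representation_def L_integrable_def by simp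
    also have "\<dots> \<le> ?I"
      using lip[OF K] by (intro nn_integral_mono ennreal_leI)
    finally show ?thesis
      unfolding c[symmetric] by (subst (asm) ennreal_le_iff) (auto simp: c_def)
  qed
  then have "\<bar>R H - R F\<bar> \<le> c"
    using rep HF unfolding L_representation_def
    by (blast intro: abs_SUP_diff_le[of _ "\<lambda>K. L_functional K H" KK _ "\<lambda>K. L_functional K F"])
  then show ?thesis
    unfolding c[symmetric] by (rule ennreal_leI)
qed simp

section \<open>Empirical distribution functions on an atomless space\<close>

text \<open>The probability integral transform \<open>V = G(U)\<close>.  Since \<open>G\<close> need not be injective, only
  \<open>P(V < y) \<le> y \<le> P(V \<le> y)\<close> is immediate; equality follows by letting the level decrease.\<close>
lemma atomless_imp_uniform:
  assumes "prob_space M" "atomless M"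
  obtains V where "V \<in> borel_measurable M" "\<And>y. y \<in> {0..1} \<Longrightarrow> measure M {\<omega> \<in> space M. V \<omega> \<le> y} = y"
proof -
  interpret prob_space M by fact
  obtain U where [measurable]: "U \<in> borel_measurable M" and cont: "continuous_on UNIV (cdf (distr M borel U))"
    using assms(2) by (auto simp: atomless_def)
  interpret D: real_distribution "distr M borel U" by (rule real_distribution_distr) simp
  define G where "G = cdf (distr M borel U)"
  have [measurable]: "G \<in> borel_measurable borel"
    unfolding G_def by (intro borel_measurable_mono monoI D.cdf_nondecreasing)
  have G: "G c = prob {\<omega> \<in> space M. U \<omega> \<le> c}" for c
    unfolding G_def cdf_def by (subst measure_distr) (auto intro!: arg_cong[where f=prob])
  have mono: "G x \<le> G y" if "x \<le> y" for x y
    unfolding G_def by (rule D.cdf_nondecreasing[OF that])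
  define V where "V = (\<lambda>\<omega>. G (U \<omega>))"
  have [measurable]: "V \<in> borel_measurable M" unfolding V_def by measurable
  have range: "0 \<le> V \<omega>" "V \<omega> \<le> 1" for \<omega>
    unfolding V_def G_def by (auto intro: D.cdf_nonneg D.cdf_bounded_prob)
  have ivt: "\<exists>c. G c = y" if y: "0 < y" "y < 1" for y
  proof -
    have "\<forall>\<^sub>F x in at_bot. G x < y" "\<forall>\<^sub>F x in at_top. y < G x"
      using order_tendstoD(2)[OF D.cdf_lim_at_bot y(1)] order_tendstoD(1)[OF D.cdf_lim_at_top_prob y(2)]
      unfolding G_def by auto
    then obtain a b where ab: "G a < y" "y < G b"
      by (metis eventually_at_bot_linorder eventually_at_top_linorder order_refl)
    then have "a \<le> b" using mono[of b a] by fastforce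
    then show ?thesis
      using IVT'[of G a y b] ab cont unfolding G_def by (meson continuous_on_subset order_less_imp_le subset_UNIV)
  qed
  have lt: "prob {\<omega> \<in> space M. V \<omega> < y} \<le> y" and le: "y \<le> prob {\<omega> \<in> space M. V \<omega> \<le> y}"
    if y: "0 < y" "y < 1" for y
  proof -
    obtain c where c: "G c = y" using ivt[OF y] by blast
    have "prob {\<omega> \<in> space M. V \<omega> < y} \<le> prob {\<omega> \<in> space M. U \<omega> \<le> c}"
      by (intro finite_measure_mono) (auto simp: V_def c[symmetric] intro: leI dest: mono[OF less_imp_le] leD)
    then show "prob {\<omega> \<in> space M. V \<omega> < y} \<le> y" using c by (simp add: G)
    have "prob {\<omega> \<in> space M. U \<omega> \<le> c} \<le> prob {\<omega> \<in> space M. V \<omega> \<le> y}"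
      by (intro finite_measure_mono) (auto simp: V_def c[symmetric] intro: mono)
    then show "y \<le> prob {\<omega> \<in> space M. V \<omega> \<le> y}" using c by (simp add: G)
  qed
  have upper: "prob {\<omega> \<in> space M. V \<omega> \<le> y} \<le> y" if "0 \<le> y" "y < 1" for y
  proof (rule dense_ge)
    fix z assume "y < z"
    define z' where "z' = min z ((1 + y) / 2)"
    have z': "y < z'" "z' < 1" "z' \<le> z" using \<open>y < z\<close> that by (auto simp: z'_def min_def)
    have "prob {\<omega> \<in> space M. V \<omega> \<le> y} \<le> prob {\<omega> \<in> space M. V \<omega> < z'}"
      using z' by (intro finite_measure_mono) auto
    also have "\<dots> \<le> z'" using z' that by (intro lt) auto
    finally show "prob {\<omega> \<in> space M. V \<omega> \<le> y} \<le> z" using z' by simp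
  qed
  have "prob {\<omega> \<in> space M. V \<omega> \<le> y} = y" if y: "y \<in> {0..1}" for y
  proof -
    consider "y = 0" | "0 < y" "y < 1" | "y = 1" using y by fastforce
    then show ?thesis
    proof cases
      case 1 then show ?thesis using upper[of 0] measure_nonneg[of M] by (simp add: antisym)
    next
      case 2 then show ?thesis using upper[of y] le[of y] by simp
    next
      case 3 then show ?thesis using range by (simp add: prob_space)
    qed
  qed
  then show ?thesis using that \<open>V \<in> borel_measurable M\<close> by blast
qed

text \<open>Split the uniform variable into \<open>n\<close> slices of probability \<open>1/n\<close> and take the value of the
  \<open>i\<close>-th observation on the \<open>i\<close>-th slice.\<close>
lemma empirical_df_in_dist_funs:
  assumes "prob_space M" "atomless M" "n \<ge> 1"
  shows "empirical_df X n \<omega> \<in> dist_funs M p"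
proof -
  interpret prob_space M by fact
  obtain V where V[measurable]: "V \<in> borel_measurable M"
    and unif: "\<And>y. y \<in> {0..1} \<Longrightarrow> prob {\<omega> \<in> space M. V \<omega> \<le> y} = y"
    using atomless_imp_uniform[OF assms(1,2)] by blast
  define J where "J = (\<lambda>i. {\<omega>' \<in> space M. real (i - 1) / n < V \<omega>' \<and> V \<omega>' \<le> real i / n})"
  define Y where "Y = (\<lambda>\<omega>'. \<Sum>i=1..n. X i \<omega> * indicator (J i) \<omega>')"
  have [measurable]: "J i \<in> sets M" for i
    unfolding J_def by measurable
  have [measurable]: "Y \<in> borel_measurable M"
    unfolding Y_def by measurable
  have J: "prob (J i) = 1 / n" if i: "i \<in> {1..n}" for i
  proof -
    have "J i = {\<omega> \<in> space M. V \<omega> \<le> real i / n} - {\<omega> \<in> space M. V \<omega> \<le> real (i - 1) / n}"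
      by (auto simp: J_def)
    moreover have "{\<omega> \<in> space M. V \<omega> \<le> real (i - 1) / n} \<subseteq> {\<omega> \<in> space M. V \<omega> \<le> real i / n}"
      by (auto intro: order_trans[OF _ divide_right_mono])
    ultimately have "prob (J i) = real i / n - real (i - 1) / n"
      using i by (simp add: finite_measure_Diff unif)
    also have "\<dots> = 1 / n"
      using i by (simp add: of_nat_diff diff_divide_distrib)
    finally show ?thesis .
  qed
  have disj: "disjoint_family_on J {1..n}"
  proof -
    have "J i \<inter> J j = {}" if "i < j" for i j
    proof -
      have "real i / n \<le> real (j - 1) / n"
        using that by (intro divide_right_mono) auto
      then show ?thesis by (auto simp: J_def)
    qed
    then show ?thesis
      unfolding disjoint_family_on_def by (metis Int_commute nat_neq_iff)
  qed
  then have J_unique: "j = i" if "i \<in> {1..n}" "\<omega>' \<in> J i" "\<omega>' \<in> J j" "j \<in> {1..n}" for i j \<omega>'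
    using that unfolding disjoint_family_on_def by (metis IntI empty_iff)
  have total: "AE \<omega>' in M. \<omega>' \<in> (\<Union>i\<in>{1..n}. J i)"
  proof (rule AE_prob_1)
    have "prob (\<Union>i\<in>{1..n}. J i) = (\<Sum>i=1..n. prob (J i))"
      by (rule finite_measure_finite_Union) (use disj in auto)
    then show "prob (\<Union>i\<in>{1..n}. J i) = 1"
      using J assms(3) by simp
  qed
  have Y_eq: "Y \<omega>' = X i \<omega>" if i: "i \<in> {1..n}" "\<omega>' \<in> J i" for i \<omega>'
  proof -
    have "\<omega>' \<in> J j \<longleftrightarrow> j = i" if "j \<in> {1..n}" for j
      using J_unique[OF i] i that by blast
    then have "(\<Sum>j=1..n. X j \<omega> * indicator (J j) \<omega>') = (\<Sum>j=1..n. if j = i then X i \<omega> else 0)"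
      by (intro sum.cong refl) (simp add: indicator_def)
    then show ?thesis using i by (simp add: Y_def)
  qed
  have cdf: "cdf (distr M borel Y) = empirical_df X n \<omega>"
  proof
    fix t
    define I where "I = {i\<in>{1..n}. X i \<omega> \<le> t}"
    have "cdf (distr M borel Y) t = prob {\<omega>' \<in> space M. Y \<omega>' \<le> t}"
      unfolding cdf_def by (subst measure_distr) (auto intro!: arg_cong[where f=prob])
    also have "\<dots> = prob (\<Union>i\<in>I. J i)"
    proof (rule finite_measure_eq_AE)
      show "AE \<omega>' in M. (\<omega>' \<in> {\<omega>' \<in> space M. Y \<omega>' \<le> t}) = (\<omega>' \<in> (\<Union>i\<in>I. J i))"
        using total
      proof eventually_elim
        case (elim \<omega>')
        then obtain i where i: "i \<in> {1..n}" "\<omega>' \<in> J i" by blast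
        have "\<omega>' \<in> space M" using i by (simp add: J_def)
        moreover have "\<omega>' \<in> (\<Union>i\<in>I. J i) \<longleftrightarrow> i \<in> I"
          using i J_unique[OF i] unfolding I_def by blast
        ultimately show ?case using i Y_eq[OF i] by (auto simp: I_def)
      qed
    qed (auto simp: I_def)
    also have "\<dots> = (\<Sum>i\<in>I. prob (J i))"
      by (rule finite_measure_finite_Union)
        (auto simp: I_def intro: disjoint_family_on_mono[OF _ disj])
    also have "\<dots> = real (card I) / n"
      using J by (simp add: I_def)
    also have "real (card I) = (\<Sum>i=1..n. indicator {X i \<omega>..} t)"
    proof -
      have "I = {1..n} \<inter> {i. X i \<omega> \<le> t}" by (auto simp: I_def)
      then show ?thesis by (simp add: indicator_def sum.If_cases)
    qed
    finally show "cdf (distr M borel Y) t = empirical_df X n \<omega> t"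
      by (simp add: empirical_df_def)
  qed
  define C where "C = (\<Sum>i=1..n. \<bar>X i \<omega>\<bar>)"
  have bound: "\<bar>Y \<omega>'\<bar> \<le> C" for \<omega>'
    unfolding Y_def C_def by (rule order_trans[OF sum_abs]) (auto intro!: sum_mono simp: indicator_def)
  have "integrable M (\<lambda>\<omega>. \<bar>Y \<omega>\<bar> powr enn2real p)"
    by (rule integrable_const_bound[where B="C powr enn2real p"])
      (auto intro!: AE_I2 powr_mono2 bound)
  then have "Y \<in> Lp_space M p"
    using bound by (auto simp: Lp_space_def)
  then show ?thesis
    unfolding dist_funs_def cdf[symmetric] by blast
qed

lemma dist_funs_imp_cdf:
  assumes "prob_space M" "H \<in> dist_funs M p"
  shows "\<exists>\<mu>. real_distribution \<mu> \<and> cdf \<mu> = H"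
proof -
  interpret prob_space M by fact
  obtain Y where "Y \<in> borel_measurable M" "H = cdf (distr M borel Y)"
    using assms(2) by (auto simp: dist_funs_def Lp_space_def)
  then show ?thesis
    using real_distribution_distr by blast
qed

section \<open>Geometric sums and summable integrals\<close>

lemma sum_powers_below:
  fixes b y :: real
  assumes "b > 1" "y \<ge> 0"
  shows "(\<Sum>k<K. if b ^ k < y then b ^ k else 0) \<le> b / (b - 1) * y"
proof (induction K)
  case 0 then show ?case using assms by simp
next
  case (Suc K)
  have le: "(\<Sum>k<n. if b ^ k < y then b ^ k else 0) \<le> (b ^ n - 1) / (b - 1)" for n
  proof -
    have "(\<Sum>k<n. if b ^ k < y then b ^ k else 0) \<le> (\<Sum>k<n. b ^ k)"
      using assms by (intro sum_mono) auto
    then show ?thesis using assms by (simp add: geometric_sum)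
  qed
  show ?case
  proof (cases "b ^ K < y")
    case True
    have "b * b ^ K \<le> b * y"
      using True assms by (intro mult_left_mono) auto
    then have "b ^ Suc K - 1 \<le> b * y"
      unfolding power_Suc by linarith
    then have "(b ^ Suc K - 1) / (b - 1) \<le> b * y / (b - 1)"
      using assms by (intro divide_right_mono) simp_all
    then show ?thesis using le[of "Suc K"] by simp
  next
    case False then show ?thesis using Suc by simp
  qed
qed

lemma sum_powers_above:
  fixes b y :: real
  assumes "b > 1" "y > 0"
  shows "(\<Sum>k<K. if y \<le> b ^ k then 1 / b ^ k else 0) \<le> b / (b - 1) / y"
  using assms(2)
proof (induction K arbitrary: y)
  case 0 then show ?case using assms(1) by simp
next
  case (Suc K)
  show ?case
  proof (cases "y \<le> 1")
    case True
    have "(\<Sum>k<n. (1 / b) ^ k) \<le> b / (b - 1)" for n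
    proof -
      have "(\<Sum>k<n. (1 / b) ^ k) = (1 - (1 / b) ^ n) / (1 - 1 / b)"
        using assms(1) by (simp add: sum_gp_strict)
      also have "\<dots> \<le> 1 / (1 - 1 / b)"
        using assms(1) by (intro divide_right_mono) auto
      also have "\<dots> = b / (b - 1)"
        using assms(1) by (simp add: field_simps)
      finally show ?thesis .
    qed
    moreover have "(\<Sum>k<Suc K. if y \<le> b ^ k then 1 / b ^ k else 0) \<le> (\<Sum>k<Suc K. (1 / b) ^ k)"
      using assms(1) by (intro sum_mono) (auto simp: power_one_over)
    moreover have "b / (b - 1) \<le> b / (b - 1) / y"
      using True Suc.prems assms(1) by (simp add: le_divide_eq mult_left_le)
    ultimately show ?thesis by (meson order_trans)
  next
    case False
    have "(\<Sum>k<Suc K. if y \<le> b ^ k then 1 / b ^ k else 0)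
        = (\<Sum>k<K. (if y / b \<le> b ^ k then 1 / b ^ k else 0) / b)"
      using False assms(1) by (subst sum.lessThan_Suc_shift) (auto intro!: sum.cong simp: field_simps)
    also have "\<dots> \<le> (b / (b - 1) / (y / b)) / b"
      unfolding sum_divide_distrib[symmetric] using Suc.prems assms(1)
      by (intro divide_right_mono Suc.IH) auto
    also have "\<dots> = b / (b - 1) / y"
      using assms(1) Suc.prems by (simp add: field_simps)
    finally show ?thesis .
  qed
qed

lemma count_powers_between:
  fixes a y :: real
  assumes "a \<ge> 1" "y > 0"
  shows "(\<Sum>k<K. if y \<le> 2 ^ k \<and> 2 ^ k < a * y then 1 else 0) \<le> 1 + log 2 a"
  using assms(2)
proof (induction K arbitrary: y)
  case 0 then show ?case using assms(1) by simp
next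
  case (Suc K)
  show ?case
  proof (cases "y \<le> 1")
    case True
    have "(\<Sum>k<n. if (2::real) ^ k < a then 1 else 0) \<le> 1 + log 2 a" for n
    proof (induction n)
      case 0 then show ?case using assms(1) by simp
    next
      case (Suc n)
      show ?case
      proof (cases "2 ^ n < a")
        case True
        have "(\<Sum>k<Suc n. if (2::real) ^ k < a then 1 else 0) \<le> (\<Sum>k<Suc n. 1::real)"
          by (intro sum_mono) auto
        moreover have "real n < log 2 a"
          using True assms(1) by (simp add: less_log_iff powr_realpow)
        ultimately show ?thesis by simp
      qed (use Suc in simp)
    qed
    moreover have "(\<Sum>k<Suc K. if y \<le> 2 ^ k \<and> 2 ^ k < a * y then 1 else 0::real) \<le> (\<Sum>k<Suc K. if (2::real) ^ k < a then 1 else 0)"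
      using True assms(1) Suc.prems
      by (intro sum_mono) (auto intro: less_le_trans mult_left_le)
    ultimately show ?thesis by (meson order_trans)
  next
    case False
    have "(\<Sum>k<Suc K. if y \<le> 2 ^ k \<and> 2 ^ k < a * y then 1 else 0)
        = (\<Sum>k<K. if y / 2 \<le> 2 ^ k \<and> 2 ^ k < a * (y / 2) then 1 else (0::real))"
      using False by (subst sum.lessThan_Suc_shift) (auto intro!: sum.cong simp: field_simps)
    also have "\<dots> \<le> 1 + log 2 a"
      using Suc.prems by (intro Suc.IH) auto
    finally show ?thesis .
  qed
qed

lemma suminf_ennreal_le:
  assumes "\<And>K. (\<Sum>k<K. f k) \<le> c" "\<And>k. 0 \<le> f k"
  shows "(\<Sum>k. ennreal (f k)) \<le> ennreal c"
proof (rule suminf_le_const)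
  show "(\<Sum>k<n. ennreal (f k)) \<le> ennreal c" for n
    using assms by (simp add: sum_ennreal ennreal_leI)
qed simp

text \<open>The form in which the Borel--Cantelli argument is used, for events (through indicators) and for
  expectations alike.\<close>
lemma AE_tendsto_0_if_summable_integrals:
  fixes f :: "nat \<Rightarrow> 'a \<Rightarrow> ennreal"
  assumes [measurable]: "\<And>k. f k \<in> borel_measurable M" and fin: "(\<Sum>k. \<integral>\<^sup>+\<omega>. f k \<omega> \<partial>M) < \<infinity>"
  shows "AE \<omega> in M. (\<lambda>k. f k \<omega>) \<longlonglongrightarrow> 0"
proof -
  have "(\<integral>\<^sup>+\<omega>. (\<Sum>k. f k \<omega>) \<partial>M) \<noteq> \<infinity>"
    using fin by (subst nn_integral_suminf) auto
  then have "AE \<omega> in M. (\<Sum>k. f k \<omega>) \<noteq> \<infinity>"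
    by (rule nn_integral_PInf_AE[rotated]) simp
  then show ?thesis
  proof eventually_elim
    case (elim \<omega>)
    then have "\<exists>g. (\<lambda>k. f k \<omega>) = (\<lambda>k. ennreal (g k)) \<and> (\<forall>k. 0 \<le> g k)"
    proof -
      have "f k \<omega> \<noteq> \<infinity>" for k
        using ennreal_suminf_lessD elim by (metis infinity_ennreal_def less_top)
      then show ?thesis
        by (intro exI[of _ "\<lambda>k. enn2real (f k \<omega>)"]) (auto simp: fun_eq_iff less_top)
    qed
    then obtain g where g: "\<And>k. f k \<omega> = ennreal (g k)" "\<And>k. 0 \<le> g k" by metis
    have "summable g"
      using elim g by (intro summable_suminf_not_top) auto
    then have "(\<lambda>k. ennreal (g k)) \<longlonglongrightarrow> ennreal 0"
      by (intro tendsto_ennrealI summable_LIMSEQ_zero)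
    then show ?case using g by simp
  qed
qed

section \<open>A maximal inequality for independent variables\<close>

primrec running_max :: "(nat \<Rightarrow> real) \<Rightarrow> nat \<Rightarrow> real" where
  "running_max s 0 = s 0"
| "running_max s (Suc n) = max (running_max s n) (s (Suc n))"

lemma le_running_max: "n \<le> N \<Longrightarrow> s n \<le> running_max s N"
  by (induction N) (auto simp: le_Suc_eq max_def intro: order_trans)

lemma abs_running_max_le: "(\<And>n. n \<le> N \<Longrightarrow> \<bar>s n\<bar> \<le> c) \<Longrightarrow> \<bar>running_max s N\<bar> \<le> c"
  by (induction N) (auto simp: max_def le_Suc_eq)

lemma running_max_cong: "(\<And>n. n \<le> N \<Longrightarrow> s n = t n) \<Longrightarrow> running_max s N = running_max t N"
  by (induction N) auto

lemma running_max_measurable [measurable (raw)]: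
  "(\<And>n. (\<lambda>w. s w n) \<in> borel_measurable M) \<Longrightarrow> (\<lambda>w. running_max (s w) N) \<in> borel_measurable M"
  by (induction N) auto

text \<open>The pathwise form of Doob's $L^2$ inequality: whenever the running maximum increases, it equals
  the current value.  Taking expectations replaces the conditional expectations of the usual proof by
  the single fact that the increments are centred and independent of the past.\<close>
lemma running_max_square_le:
  assumes "s 0 = 0"
  shows "(running_max s N)\<^sup>2 / 2
    \<le> running_max s N * s N - (\<Sum>k<N. running_max s k * (s (Suc k) - s k))"
proof (induction N)
  case 0 then show ?case using assms by simp
next
  case (Suc N)
  show ?case
  proof (cases "s (Suc N) \<le> running_max s N")
    case True
    then show ?thesis using Suc by (simp add: max_def algebra_simps)
  next
    case False
    have "0 \<le> (s (Suc N) - running_max s N)\<^sup>2 / 2" by simp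
    then show ?thesis using False Suc by (simp add: max_def power2_eq_square field_simps)
  qed
qed

context prob_space
begin

lemma expectation_past_times_next:
  fixes Y :: "nat \<Rightarrow> 'a \<Rightarrow> real"
  assumes indep: "indep_vars (\<lambda>_. borel) Y {1..}"
    and G[measurable]: "G \<in> borel_measurable (PiM {1..k} (\<lambda>_. borel))" and "\<And>x. \<bar>G x\<bar> \<le> C"
    and "\<And>w. \<bar>Y (Suc k) w\<bar> \<le> B" and "expectation (Y (Suc k)) = 0"
  shows "expectation (\<lambda>w. G (\<lambda>i\<in>{1..k}. Y i w) * Y (Suc k) w) = 0"
proof -
  have Y[measurable]: "Y i \<in> borel_measurable M" if "i \<ge> 1" for i
    using indep that by (auto simp: indep_vars_def)
  have past[measurable]: "(\<lambda>w. \<lambda>i\<in>{1..k}. Y i w) \<in> measurable M (PiM {1..k} (\<lambda>_. borel))"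
    by (intro measurable_restrict) auto
  have "indep_var borel (G \<circ> (\<lambda>w. \<lambda>i\<in>{1..k}. Y i w)) borel ((\<lambda>x. x (Suc k)) \<circ> (\<lambda>w. \<lambda>i\<in>{Suc k}. Y i w))"
    by (intro indep_var_compose[OF indep_var_restrict[OF indep]] G measurable_component_singleton) auto
  then have ind: "indep_var borel (\<lambda>w. G (\<lambda>i\<in>{1..k}. Y i w)) borel (Y (Suc k))"
    by (simp add: comp_def)
  have "integrable M (\<lambda>w. G (\<lambda>i\<in>{1..k}. Y i w))"
    by (rule integrable_const_bound[of _ C]) (use assms in auto)
  moreover have "integrable M (Y (Suc k))"
    by (rule integrable_const_bound[of _ B]) (use assms in auto)
  ultimately show ?thesis
    using indep_var_lebesgue_integral[OF ind] assms(5) by simp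
qed

text \<open>In expectation the sum in \<open>running_max_square_le\<close> vanishes, which leaves
  \<open>E M\<^sup>2 \<le> 4 E S\<^sup>2\<close> for the running maximum \<open>M\<close> of the partial sums \<open>S\<close>.\<close>
lemma indep_maximal_inequality:
  fixes Y :: "nat \<Rightarrow> 'a \<Rightarrow> real"
  assumes indep: "indep_vars (\<lambda>_. borel) Y {1..}" and bnd: "\<And>i w. \<bar>Y i w\<bar> \<le> B"
    and mean: "\<And>i. i \<ge> 1 \<Longrightarrow> expectation (Y i) = 0"
    and var: "\<And>i. i \<ge> 1 \<Longrightarrow> expectation (\<lambda>w. (Y i w)\<^sup>2) \<le> v"
  shows "expectation (\<lambda>w. running_max (\<lambda>n. \<Sum>i=1..n. Y i w) N) \<le> 2 * sqrt (N * v)"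
proof -
  define S where "S = (\<lambda>(x :: nat \<Rightarrow> real) n. \<Sum>i=1..n. x i)"
  have Y[measurable]: "Y i \<in> borel_measurable M" if "i \<ge> 1" for i
    using indep that by (auto simp: indep_vars_def)
  have SY[measurable]: "(\<lambda>w. S (\<lambda>i. Y i w) n) \<in> borel_measurable M" for n
    unfolding S_def by auto
  have "B \<ge> 0" using bnd[of 0 undefined] abs_ge_zero order_trans by blast
  have S_bnd: "\<bar>S (\<lambda>i. Y i w) n\<bar> \<le> real n * B" for n w
    unfolding S_def using sum_mono[of "{1..n}" "\<lambda>i. \<bar>Y i w\<bar>" "\<lambda>_. B"] bnd
    by (intro order_trans[OF sum_abs]) simp
  \<comment> \<open>Makes the functionals of the past bounded on the whole product space, not only on the range of
    the bounded variables.\<close>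
  define clamp where "clamp = (\<lambda>k y. max (- (real k * B)) (min (real k * B) y))"
  have orth: "expectation (\<lambda>w. G (S (\<lambda>i. Y i w)) * Y (Suc k) w) = 0"
    if G: "(\<lambda>x. G (S x)) \<in> borel_measurable (PiM {1..k} (\<lambda>_. borel))"
      and loc: "\<And>s t. (\<And>n. n \<le> k \<Longrightarrow> s n = t n) \<Longrightarrow> G s = G t"
      and Gb: "\<And>w. \<bar>G (S (\<lambda>i. Y i w))\<bar> \<le> real k * B" for G k
  proof -
    have clamp_meas: "(\<lambda>x. clamp k (G (S x))) \<in> borel_measurable (PiM {1..k} (\<lambda>_. borel))"
      unfolding clamp_def using G by measurable
    have "expectation (\<lambda>w. clamp k (G (S (\<lambda>i\<in>{1..k}. Y i w))) * Y (Suc k) w) = 0"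
    proof (rule expectation_past_times_next[OF indep clamp_meas])
      show "\<bar>clamp k (G (S x))\<bar> \<le> real k * B" for x
        using \<open>B \<ge> 0\<close> by (simp add: clamp_def abs_le_iff)
    qed (use bnd mean in simp_all)
    moreover have "clamp k (G (S (\<lambda>i\<in>{1..k}. Y i w))) = G (S (\<lambda>i. Y i w))" for w
    proof -
      have "G (S (\<lambda>i\<in>{1..k}. Y i w)) = G (S (\<lambda>i. Y i w))"
        by (rule loc) (auto simp: S_def intro: sum.cong)
      then show ?thesis
        using Gb[of w] by (auto simp: clamp_def)
    qed
    ultimately show ?thesis by simp
  qed
  have S_meas: "(\<lambda>x. S x n) \<in> borel_measurable (PiM {1..k} (\<lambda>_. borel))" if "n \<le> k" for n k
    unfolding S_def using that by (intro borel_measurable_sum measurable_component_singleton) auto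
  have R_meas: "(\<lambda>x. running_max (S x) n) \<in> borel_measurable (PiM {1..k} (\<lambda>_. borel))" if "n \<le> k" for n k
    using that
  proof (induction n)
    case (Suc n)
    then show ?case using S_meas[of "Suc n" k] by (auto intro: borel_measurable_max)
  qed (use S_meas[of 0 k] in simp)
  let ?S = "\<lambda>w. S (\<lambda>i. Y i w)"
  have R_bnd: "\<bar>running_max (?S w) n\<bar> \<le> real n * B" for n w
    by (rule abs_running_max_le) (use S_bnd \<open>B \<ge> 0\<close> in \<open>meson mult_right_mono of_nat_le_iff order_trans\<close>)
  have bounded: "integrable M f" if "f \<in> borel_measurable M" "\<And>w. \<bar>f w\<bar> \<le> c" for f :: "'a \<Rightarrow> real" and c
    using that by (intro integrable_const_bound[of _ c]) auto
  have int_Y: "integrable M (\<lambda>w. (Y i w)\<^sup>2)" if "i \<ge> 1" for i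
    using that bnd[of i] \<open>B \<ge> 0\<close> by (intro bounded[of _ "B\<^sup>2"]) (auto simp: abs_le_square_iff[symmetric])
  have int_RY: "integrable M (\<lambda>w. running_max (?S w) k * Y (Suc k) w)" for k
    by (rule bounded[of _ "real k * B * B"]) (use R_bnd bnd \<open>B \<ge> 0\<close> in \<open>auto simp: abs_mult intro!: mult_mono\<close>)
  have int_SY: "integrable M (\<lambda>w. ?S w k * Y (Suc k) w)" for k
    by (rule bounded[of _ "real k * B * B"]) (use S_bnd bnd \<open>B \<ge> 0\<close> in \<open>auto simp: abs_mult intro!: mult_mono\<close>)
  have int_SS: "integrable M (\<lambda>w. (?S w k)\<^sup>2)" for k
    by (rule bounded[of _ "(real k * B)\<^sup>2"]) (use S_bnd \<open>B \<ge> 0\<close> in \<open>auto simp: abs_le_square_iff[symmetric] abs_mult\<close>)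
  have int_RR: "integrable M (\<lambda>w. (running_max (?S w) k)\<^sup>2)" for k
    by (rule bounded[of _ "(real k * B)\<^sup>2"]) (use R_bnd \<open>B \<ge> 0\<close> in \<open>auto simp: abs_le_square_iff[symmetric] abs_mult\<close>)
  have int_R: "integrable M (\<lambda>w. running_max (?S w) k)" for k
    by (rule bounded[of _ "real k * B"]) (use R_bnd in auto)
  have SS: "expectation (\<lambda>w. (?S w n)\<^sup>2) \<le> n * v" for n
  proof (induction n)
    case (Suc n)
    have "(?S w (Suc n))\<^sup>2 = (?S w n)\<^sup>2 + 2 * (?S w n * Y (Suc n) w) + (Y (Suc n) w)\<^sup>2" for w
      by (simp add: S_def power2_eq_square algebra_simps)
    moreover have "expectation (\<lambda>w. ?S w n * Y (Suc n) w) = 0"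
      by (rule orth[of "\<lambda>s. s n"]) (use S_meas S_bnd in auto)
    ultimately have "expectation (\<lambda>w. (?S w (Suc n))\<^sup>2) = expectation (\<lambda>w. (?S w n)\<^sup>2) + expectation (\<lambda>w. (Y (Suc n) w)\<^sup>2)"
      using int_SS int_SY int_Y[of "Suc n"] by simp
    then show ?case using Suc var[of "Suc n"] by (simp add: algebra_simps)
  qed (simp add: S_def)
  have RdS: "expectation (\<lambda>w. running_max (?S w) k * Y (Suc k) w) = 0" for k
    by (rule orth[of "\<lambda>s. running_max s k"]) (use R_meas R_bnd in \<open>auto intro: running_max_cong\<close>)
  let ?P = "\<lambda>w. \<Sum>k<N. running_max (?S w) k * Y (Suc k) w"
  have pt: "(running_max (?S w) N)\<^sup>2 \<le> 4 * (?S w N)\<^sup>2 - 4 * ?P w" for w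
  proof -
    have "?S w (Suc k) - ?S w k = Y (Suc k) w" for k
      by (simp add: S_def)
    then have "(running_max (?S w) N)\<^sup>2 / 2 \<le> running_max (?S w) N * ?S w N - ?P w"
      using running_max_square_le[of "?S w" N] by (simp add: S_def)
    moreover have "running_max (?S w) N * ?S w N \<le> (running_max (?S w) N)\<^sup>2 / 4 + (?S w N)\<^sup>2"
      using zero_le_power2[of "running_max (?S w) N / 2 - ?S w N"] by (simp add: power2_eq_square algebra_simps)
    ultimately show ?thesis by simp
  qed
  have "expectation (\<lambda>w. (running_max (?S w) N)\<^sup>2) \<le> expectation (\<lambda>w. 4 * (?S w N)\<^sup>2 - 4 * ?P w)"
    by (intro integral_mono pt int_RR Bochner_Integration.integrable_diff integrable_mult_right int_SS Bochner_Integration.integrable_sum int_RY)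
  also have "\<dots> = 4 * expectation (\<lambda>w. (?S w N)\<^sup>2)"
    using int_SS int_RY RdS by simp
  also have "\<dots> \<le> 4 * (N * v)" using SS by simp
  finally have RR: "expectation (\<lambda>w. (running_max (?S w) N)\<^sup>2) \<le> 4 * (N * v)" .
  have "(expectation (\<lambda>w. running_max (?S w) N))\<^sup>2 \<le> expectation (\<lambda>w. (running_max (?S w) N)\<^sup>2)"
    using variance_positive[of "\<lambda>w. running_max (?S w) N"] variance_eq[OF int_R int_RR] by simp
  then have "expectation (\<lambda>w. running_max (?S w) N) \<le> sqrt (4 * (N * v))"
    using RR by (intro real_le_rsqrt) simp
  then show ?thesis by (simp add: S_def real_sqrt_mult)
qed

end

section \<open>The weighted empirical process of an independent sequence\<close>

context prob_space
begin

text \<open>A Marcinkiewicz--Zygmund law for the empirical process in the space $L^1(\phi\,d\nu)$.  Truncating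
  in \<open>x\<close> at the level of \<open>\<phi>\<close> replaces the usual truncation of the variables.\<close>
lemma iid_weighted_empirical_rate:
  fixes X :: "nat \<Rightarrow> 'a \<Rightarrow> real" and W :: "real \<Rightarrow> real \<Rightarrow> real" and \<phi> :: "real \<Rightarrow> real"
    and D \<nu> :: "real measure" and r :: real
  assumes indep: "indep_vars (\<lambda>_. borel) X {1..}"
    and D: "\<And>i. i \<ge> 1 \<Longrightarrow> distr M borel (X i) = D"
    and \<nu>: "finite_measure \<nu>" and sets_\<nu>[measurable_cong]: "sets \<nu> = sets borel"
    and W[measurable]: "case_prod W \<in> borel_measurable (borel \<Otimes>\<^sub>M borel)"
    and W01: "\<And>x y. W x y \<in> {0, 1}"
    and \<phi>[measurable]: "\<phi> \<in> borel_measurable borel" and pos: "\<And>x. 0 < \<phi> x"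
    and dom: "\<And>x y. W x y * \<phi> x \<le> \<phi> y"
    and r: "0 \<le> r" "r < 1 / 2"
    and mom: "(\<integral>\<^sup>+x. ennreal (\<phi> x powr (1 / (1 - r))) \<partial>D) < \<infinity>"
  shows "AE w in M. (\<lambda>n. ennreal (n powr r) *
    (\<integral>\<^sup>+x. ennreal (\<phi> x * \<bar>(\<Sum>i=1..n. W x (X i w)) / n - (\<integral>y. W x y \<partial>D)\<bar>) \<partial>\<nu>)) \<longlonglongrightarrow> 0"
proof -
  interpret \<nu>: finite_measure \<nu> by fact
  have X[measurable]: "X i \<in> borel_measurable M" if "i \<ge> 1" for i
    using indep that by (auto simp: indep_vars_def)
  interpret D: prob_space D
    using prob_space_distr[of "X 1" borel] D[of 1] by simp
  have sets_D[measurable_cong]: "sets D = sets borel"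
    using D[of 1, symmetric] by simp
  interpret pair_sigma_finite \<nu> M ..
  let ?avg = "\<lambda>n x w. (\<Sum>i=1..n. W x (X i w)) / real n"
  define p where "p = (\<lambda>x. \<integral>y. W x y \<partial>D)"
  have p_meas[measurable]: "p \<in> borel_measurable borel"
    unfolding p_def by measurable
  have W_nonneg: "0 \<le> W x y" and W_le: "W x y \<le> 1" and W_sq: "W x y * W x y = W x y" for x y
    using W01[of x y] by auto
  have W_int: "integrable D (W x)" for x
    by (rule D.integrable_const_bound[of _ 1]) (auto simp: W_nonneg W_le)
  have p01: "0 \<le> p x" "p x \<le> 1" for x
    unfolding p_def using D.integral_le_const[OF W_int, of x 1] W_le by (auto simp: W_nonneg)
  define s where "s = 1 / (1 - r)"
  have s: "s \<ge> 1" "s < 2" "s * (1 - r) = 1" using r by (auto simp: s_def field_simps)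
  define E where "E = enn2real (\<integral>\<^sup>+x. ennreal (\<phi> x powr s) \<partial>D)"
  have E: "ennreal E = (\<integral>\<^sup>+x. ennreal (\<phi> x powr s) \<partial>D)" "E \<ge> 0"
    using mom unfolding E_def s_def by (auto simp: less_top)
  have markov: "\<phi> x powr s * p x \<le> E" for x
  proof -
    have "ennreal (\<phi> x powr s * p x) = (\<integral>\<^sup>+y. ennreal (\<phi> x powr s * W x y) \<partial>D)"
      unfolding p_def using W_int W_nonneg
      by (subst nn_integral_eq_integral) auto
    also have "\<dots> \<le> ennreal E"
      unfolding E
    proof (intro nn_integral_mono ennreal_leI)
      fix y show "\<phi> x powr s * W x y \<le> \<phi> y powr s"
        using W01[of x y] dom[of x y] pos[of x] s by (auto intro!: powr_mono2)
    qed
    finally show ?thesis using E(2) by simp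
  qed

  \<comment> \<open>The sum of the running maxima of \<open>S\<close> and of \<open>-S\<close> dominates \<open>\<bar>S\<bar>\<close>, as both start at \<open>0\<close>.\<close>
  define S where "S = (\<lambda>x w n. \<Sum>i=1..n. W x (X i w) - p x)"
  define A where "A = (\<lambda>n x w. running_max (S x w) n + running_max (\<lambda>n. - S x w n) n)"
  have S_meas[measurable]: "(\<lambda>(x, w). S x w n) \<in> borel_measurable (\<nu> \<Otimes>\<^sub>M M)" for n
    unfolding S_def by measurable
  have A_meas[measurable]: "(\<lambda>(x, w). A n x w) \<in> borel_measurable (\<nu> \<Otimes>\<^sub>M M)" for n
    unfolding A_def by measurable
  have A_meas1[measurable]: "A n x \<in> borel_measurable M" for n x
    unfolding A_def S_def by measurable
  have A_meas2[measurable]: "(\<lambda>x. A n x w) \<in> borel_measurable borel" for n w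
    unfolding A_def S_def by measurable
  have A_ge: "\<bar>S x w n\<bar> \<le> A N x w" if "n \<le> N" for x w n N
    using le_running_max[OF that, of "S x w"] le_running_max[OF that, of "\<lambda>n. - S x w n"]
      le_running_max[of 0 N "S x w"] le_running_max[of 0 N "\<lambda>n. - S x w n"]
    by (simp add: A_def S_def)
  have A_nonneg: "0 \<le> A N x w" for N x w
    using A_ge[of 0 N x w] by simp
  have A_int: "(\<integral>\<^sup>+w. ennreal (A N x w) \<partial>M) \<le> ennreal (4 * sqrt (N * p x))" for N x
  proof -
    have Wp_bnd: "\<bar>\<sigma> * (W x y - p x)\<bar> \<le> 1" if "\<sigma> \<in> {1, -1 :: real}" for \<sigma> y
      using that W_nonneg[of x y] W_le[of x y] p01[of x] by (auto simp: abs_le_iff)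
    have *: "expectation (\<lambda>w. running_max (\<lambda>n. \<Sum>i=1..n. \<sigma> * (W x (X i w) - p x)) N) \<le> 2 * sqrt (N * p x)"
      if \<sigma>: "\<sigma> \<in> {1, -1 :: real}" for \<sigma>
    proof (rule indep_maximal_inequality)
      show "indep_vars (\<lambda>_. borel) (\<lambda>i w. \<sigma> * (W x (X i w) - p x)) {1..}"
        by (rule indep_vars_compose2[OF indep, of "\<lambda>i y. \<sigma> * (W x y - p x)"]) auto
      show "\<bar>\<sigma> * (W x (X i w) - p x)\<bar> \<le> 1" for i w
        using \<sigma> by (rule Wp_bnd)
      fix i :: nat assume i: "i \<ge> 1"
      have EW: "expectation (\<lambda>w. W x (X i w)) = p x"
        unfolding p_def D[OF i, symmetric] using i by (subst integral_distr) auto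
      have intW: "integrable M (\<lambda>w. W x (X i w))"
        using i by (intro integrable_const_bound[of _ 1]) (auto simp: W_nonneg W_le)
      have sq: "(\<sigma> * (W x (X i w) - p x))\<^sup>2 = (1 - 2 * p x) * W x (X i w) + (p x)\<^sup>2" for w
        using \<sigma> W_sq[of x "X i w"] by (auto simp: power2_eq_square algebra_simps)
      show "expectation (\<lambda>w. \<sigma> * (W x (X i w) - p x)) = 0"
        using EW intW by (simp add: prob_space)
      have "expectation (\<lambda>w. (\<sigma> * (W x (X i w) - p x))\<^sup>2) = (1 - 2 * p x) * p x + (p x)\<^sup>2"
        unfolding sq using EW intW by (simp add: prob_space)
      also have "\<dots> \<le> p x"
        by (simp add: algebra_simps power2_eq_square)
      finally show "expectation (\<lambda>w. (\<sigma> * (W x (X i w) - p x))\<^sup>2) \<le> p x" .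
    qed
    have R_int: "integrable M (\<lambda>w. running_max (\<lambda>n. \<Sum>i=1..n. \<sigma> * (W x (X i w) - p x)) N)"
      if \<sigma>: "\<sigma> \<in> {1, -1 :: real}" for \<sigma>
    proof (rule integrable_const_bound[of _ "real N"])
      have "\<bar>\<Sum>i=1..n. \<sigma> * (W x (X i w) - p x)\<bar> \<le> (\<Sum>i=1..n. 1)" for n w
        using Wp_bnd[OF \<sigma>] by (intro order_trans[OF sum_abs] sum_mono) blast
      then have "\<bar>\<Sum>i=1..n. \<sigma> * (W x (X i w) - p x)\<bar> \<le> real N" if "n \<le> N" for n w
        by (rule order_trans) (use that in simp)
      then show "AE w in M. norm (running_max (\<lambda>n. \<Sum>i=1..n. \<sigma> * (W x (X i w) - p x)) N) \<le> real N"
        by (auto intro!: AE_I2 abs_running_max_le)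
    qed measurable
    have A_eq: "A N x w = running_max (\<lambda>n. \<Sum>i=1..n. 1 * (W x (X i w) - p x)) N
        + running_max (\<lambda>n. \<Sum>i=1..n. -1 * (W x (X i w) - p x)) N" for w
      by (simp add: A_def S_def sum_negf[symmetric])
    have "expectation (A N x) \<le> 4 * sqrt (N * p x)"
      unfolding A_eq using *[of 1] *[of "-1"] R_int[of 1] R_int[of "-1"] by simp
    moreover have "integrable M (A N x)"
      unfolding A_eq using R_int[of 1] R_int[of "-1"] by (intro Bochner_Integration.integrable_add) auto
    ultimately show ?thesis
      using A_nonneg by (subst nn_integral_eq_integral) (auto intro: ennreal_leI)
  qed

  define N where "N = (\<lambda>k. (2::real) ^ k)"
  have N: "N k > 0" "N k = 2 powr k" for k by (auto simp: N_def powr_realpow)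
  define b where "b = (\<lambda>k. N k powr (1 - r))"
  define V where "V = (\<lambda>k w. \<integral>\<^sup>+x. ennreal (of_bool (\<phi> x \<le> b k) * N k powr (r - 1) * \<phi> x * A (2 ^ k) x w) \<partial>\<nu>)"
  have V_meas[measurable]: "V k \<in> borel_measurable M" for k
    unfolding V_def by measurable
  \<comment> \<open>With these constants the bound for block \<open>k\<close> at \<open>x\<close> is a multiple of \<open>y / c ^ k\<close>, restricted to
    \<open>y \<le> c ^ k\<close>, where \<open>y = \<phi> x powr \<kappa>\<close>; so its sum over \<open>k\<close> does not depend on \<open>x\<close>.\<close>
  define c where "c = 2 powr (1 / 2 - r)"
  define \<kappa> where "\<kappa> = 1 - s / 2"
  have c: "c > 1" using r by (simp add: c_def)
  have \<kappa>: "\<kappa> > 0" "(1 - r) * \<kappa> = 1 / 2 - r" using s by (auto simp: \<kappa>_def algebra_simps)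
  define wt where "wt = (\<lambda>k x. 4 * sqrt E * \<phi> x powr \<kappa> * (if \<phi> x powr \<kappa> \<le> c ^ k then 1 / c ^ k else 0))"
  have wt_meas[measurable]: "wt k \<in> borel_measurable borel" for k
    unfolding wt_def by measurable
  have wt_nonneg: "0 \<le> wt k x" for k x using c E(2) by (simp add: wt_def)
  have "(\<integral>\<^sup>+w. V k w \<partial>M) \<le> (\<integral>\<^sup>+x. ennreal (wt k x) \<partial>\<nu>)" for k
  proof -
    have "(\<integral>\<^sup>+w. V k w \<partial>M) = (\<integral>\<^sup>+x. (\<integral>\<^sup>+w. ennreal (of_bool (\<phi> x \<le> b k) * N k powr (r - 1) * \<phi> x * A (2 ^ k) x w) \<partial>M) \<partial>\<nu>)"
      unfolding V_def by (intro Fubini') measurable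
    also have "\<dots> \<le> (\<integral>\<^sup>+x. ennreal (wt k x) \<partial>\<nu>)"
    proof (intro nn_integral_mono)
      fix x
      let ?d = "of_bool (\<phi> x \<le> b k) * N k powr (r - 1) * \<phi> x"
      have d: "?d \<ge> 0" using pos[of x] by (auto simp: less_imp_le)
      have "(\<integral>\<^sup>+w. ennreal (?d * A (2 ^ k) x w) \<partial>M) = ennreal ?d * (\<integral>\<^sup>+w. ennreal (A (2 ^ k) x w) \<partial>M)"
        using d A_nonneg by (subst nn_integral_cmult[symmetric]) (auto simp: ennreal_mult)
      also have "\<dots> \<le> ennreal ?d * ennreal (4 * sqrt (real (2 ^ k) * p x))"
        by (intro mult_left_mono A_int) simp
      also have "\<dots> = ennreal (?d * (4 * sqrt (N k * p x)))"
        using d by (simp add: ennreal_mult p01 N_def)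
      also have "\<dots> \<le> ennreal (wt k x)"
      proof (intro ennreal_leI, cases "\<phi> x \<le> b k")
        case True
        have "\<phi> x powr \<kappa> \<le> b k powr \<kappa>"
          using True pos[of x] \<kappa> by (intro powr_mono2) auto
        also have "b k powr \<kappa> = 2 powr (k * ((1 - r) * \<kappa>))"
          unfolding b_def N(2) by (simp add: powr_powr mult.assoc)
        also have "\<dots> = c ^ k"
          unfolding \<kappa>(2) c_def by (simp add: powr_powr powr_realpow[symmetric] mult.commute)
        finally have le: "\<phi> x powr \<kappa> \<le> c ^ k" .
        have "p x \<le> E * \<phi> x powr (- s)"
          using markov[of x] pos[of x] by (simp add: powr_minus field_simps)
        then have "sqrt (N k * p x) \<le> sqrt (N k * (E * \<phi> x powr (- s)))"
          using N(1)[of k] by (intro real_sqrt_le_mono mult_left_mono) auto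
        also have "\<dots> = N k powr (1/2) * sqrt E * \<phi> x powr (- s / 2)"
          by (simp add: real_sqrt_mult powr_half_sqrt[symmetric] powr_powr N)
        finally have "N k powr (r - 1) * \<phi> x * (4 * sqrt (N k * p x))
            \<le> N k powr (r - 1) * \<phi> x * (4 * (N k powr (1/2) * sqrt E * \<phi> x powr (- s / 2)))"
          using N(1)[of k] pos[of x] by (intro mult_left_mono) (auto simp: less_imp_le)
        also have "\<dots> = 4 * sqrt E * (N k powr (r - 1) * N k powr (1/2)) * (\<phi> x powr 1 * \<phi> x powr (- s / 2))"
          using pos[of x] by simp
        also have "N k powr (r - 1) * N k powr (1/2) = 1 / c ^ k"
        proof -
          have "N k powr (r - 1) * N k powr (1/2) = N k powr (- (1/2 - r))"
            unfolding powr_add[symmetric] by (rule arg_cong[where f="(powr) (N k)"]) simp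
          also have "\<dots> = 1 / (N k powr (1/2 - r))" by (rule powr_minus_divide)
          also have "N k powr (1/2 - r) = c ^ k"
            unfolding N(2) c_def by (simp add: powr_powr powr_realpow[symmetric] mult.commute)
          finally show ?thesis .
        qed
        also have "\<phi> x powr 1 * \<phi> x powr (- s / 2) = \<phi> x powr \<kappa>"
          unfolding powr_add[symmetric] by (simp add: \<kappa>_def)
        finally show "?d * (4 * sqrt (N k * p x)) \<le> wt k x"
          using True le by (simp add: wt_def mult_ac)
      qed (use wt_nonneg in simp)
      finally show "(\<integral>\<^sup>+w. ennreal (?d * A (2 ^ k) x w) \<partial>M) \<le> ennreal (wt k x)" .
    qed
    finally show ?thesis .
  qed
  then have "(\<Sum>k. \<integral>\<^sup>+w. V k w \<partial>M) \<le> (\<Sum>k. \<integral>\<^sup>+x. ennreal (wt k x) \<partial>\<nu>)"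
    by (intro suminf_le) auto
  also have "\<dots> = (\<integral>\<^sup>+x. (\<Sum>k. ennreal (wt k x)) \<partial>\<nu>)"
    by (intro nn_integral_suminf[symmetric]) measurable
  also have "\<dots> \<le> (\<integral>\<^sup>+x. ennreal (4 * sqrt E * (c / (c - 1))) \<partial>\<nu>)"
  proof (intro nn_integral_mono suminf_ennreal_le wt_nonneg)
    fix x K
    have "(\<Sum>k<K. wt k x) = 4 * sqrt E * \<phi> x powr \<kappa> * (\<Sum>k<K. if \<phi> x powr \<kappa> \<le> c ^ k then 1 / c ^ k else 0)"
      by (simp add: wt_def sum_distrib_left)
    also have "\<dots> \<le> 4 * sqrt E * \<phi> x powr \<kappa> * (c / (c - 1) / \<phi> x powr \<kappa>)"
      using E(2) c pos[of x] by (intro mult_left_mono sum_powers_above) auto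
    also have "\<dots> = 4 * sqrt E * (c / (c - 1))" using pos[of x] by simp
    finally show "(\<Sum>k<K. wt k x) \<le> 4 * sqrt E * (c / (c - 1))" .
  qed
  also have "\<dots> < \<infinity>"
    using \<nu>.emeasure_finite by (simp add: ennreal_mult_eq_top_iff less_top[symmetric])
  finally have V_lim: "AE w in M. (\<lambda>k. V k w) \<longlonglongrightarrow> 0"
    by (intro AE_tendsto_0_if_summable_integrals) auto

  \<comment> \<open>The number of observations in block \<open>k\<close> that exceed the truncation level.\<close>
  define U where "U = (\<lambda>k w. \<Sum>i\<in>{1..2^k}. ennreal (of_bool (N k < \<phi> (X i w) powr s)))"
  have U_meas[measurable]: "U k \<in> borel_measurable M" for k
    unfolding U_def by measurable
  have U_int: "(\<integral>\<^sup>+w. U k w \<partial>M) = (\<integral>\<^sup>+y. ennreal (if 2 ^ k < \<phi> y powr s then 2 ^ k else 0) \<partial>D)" for k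
  proof -
    have "(\<integral>\<^sup>+w. U k w \<partial>M) = (\<Sum>i\<in>{1..2^k}. \<integral>\<^sup>+w. ennreal (of_bool (N k < \<phi> (X i w) powr s)) \<partial>M)"
      unfolding U_def by (intro nn_integral_sum) auto
    also have "\<dots> = (\<Sum>i\<in>{1..2^k::nat}. \<integral>\<^sup>+y. ennreal (of_bool (N k < \<phi> y powr s)) \<partial>D)"
      by (intro sum.cong refl, subst D[symmetric]) (auto simp: nn_integral_distr)
    also have "\<dots> = ennreal (N k) * (\<integral>\<^sup>+y. ennreal (of_bool (N k < \<phi> y powr s)) \<partial>D)"
      by (simp add: N_def ennreal_of_nat_eq_real_of_nat ennreal_power[symmetric])
    also have "\<dots> = (\<integral>\<^sup>+y. ennreal (N k * of_bool (N k < \<phi> y powr s)) \<partial>D)"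
      using N(1)[of k] by (subst nn_integral_cmult[symmetric]) (auto simp: ennreal_mult less_imp_le)
    also have "\<dots> = (\<integral>\<^sup>+y. ennreal (if 2 ^ k < \<phi> y powr s then 2 ^ k else 0) \<partial>D)"
      by (intro nn_integral_cong) (simp add: N_def)
    finally show ?thesis .
  qed
  have "(\<Sum>k. \<integral>\<^sup>+w. U k w \<partial>M) = (\<integral>\<^sup>+y. (\<Sum>k. ennreal (if 2 ^ k < \<phi> y powr s then 2 ^ k else 0)) \<partial>D)"
    unfolding U_int by (intro nn_integral_suminf[symmetric]) measurable
  also have "\<dots> \<le> (\<integral>\<^sup>+y. ennreal (2 * \<phi> y powr s) \<partial>D)"
    by (intro nn_integral_mono suminf_ennreal_le order_trans[OF sum_powers_below]) auto
  also have "\<dots> = ennreal 2 * ennreal E"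
    unfolding E by (subst nn_integral_cmult[symmetric]) (auto simp: ennreal_mult)
  also have "\<dots> < \<infinity>" by (simp add: ennreal_mult_less_top)
  finally have U_lim: "AE w in M. (\<lambda>k. U k w) \<longlonglongrightarrow> 0"
    by (intro AE_tendsto_0_if_summable_integrals) auto

  have tail: "(\<lambda>k. emeasure \<nu> {x \<in> space \<nu>. b k < \<phi> x}) \<longlonglongrightarrow> 0"
  proof -
    have b_mono: "b k \<le> b l" if "k \<le> l" for k l
      using that r N(1) by (auto simp: b_def N_def intro!: powr_mono2)
    have b_pow: "b = (\<lambda>k. (2 powr (1 - r)) ^ k)"
      by (simp add: b_def N(2) fun_eq_iff powr_powr powr_realpow[symmetric] mult.commute)
    have "\<exists>k. \<phi> x < b k" for x
      unfolding b_pow using r by (intro real_arch_pow) simp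
    then have "(\<Inter>k. {x \<in> space \<nu>. b k < \<phi> x}) = {}"
      by (fastforce dest: less_imp_not_less)
    moreover have "range (\<lambda>k. {x \<in> space \<nu>. b k < \<phi> x}) \<subseteq> sets \<nu>"
    proof (intro image_subsetI)
      show "{x \<in> space \<nu>. b k < \<phi> x} \<in> sets \<nu>" for k by measurable
    qed
    moreover have "decseq (\<lambda>k. {x \<in> space \<nu>. b k < \<phi> x})"
      using b_mono by (auto simp: decseq_def intro: le_less_trans)
    ultimately show ?thesis
      using Lim_emeasure_decseq[of "\<lambda>k. {x \<in> space \<nu>. b k < \<phi> x}" \<nu>] by simp
  qed

  show ?thesis
    using V_lim U_lim
  proof eventually_elim
    case (elim w)
    define Dn where "Dn = (\<lambda>n. ennreal (real n powr r) *
      (\<integral>\<^sup>+x. ennreal (\<phi> x * \<bar>?avg n x w - p x\<bar>) \<partial>\<nu>))"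
    define Bk where "Bk = (\<lambda>k. 2 * V k w + ennreal E * emeasure \<nu> {x \<in> space \<nu>. b k < \<phi> x})"
    have "Bk \<longlonglongrightarrow> 2 * 0 + ennreal E * 0"
      unfolding Bk_def by (intro tendsto_add ennreal_tendsto_cmult elim tail) auto
    then have Bk: "Bk \<longlonglongrightarrow> 0" by simp
    have Dn_le: "Dn n \<le> Bk k" if n: "2 ^ k \<le> 2 * n" "n \<le> 2 ^ k" and U: "U k w < 1" for n k
    proof -
      have "n > 0" using n by (metis gr0I mult_0_right not_less zero_less_numeral zero_less_power)
      have n': "N k \<le> 2 * real n" "real n \<le> N k"
        unfolding N_def using n by (metis of_nat_le_iff of_nat_mult of_nat_numeral of_nat_power)+
      have small: "\<phi> (X i w) \<le> b k" if i: "1 \<le> i" "i \<le> n" for i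
      proof (rule ccontr)
        assume "\<not> ?thesis"
        then have "b k powr s < \<phi> (X i w) powr s"
          using s by (intro powr_less_mono2) (auto simp: b_def)
        moreover have "b k powr s = N k"
          using s N(1)[of k] by (simp add: b_def powr_powr mult.commute)
        ultimately have "ennreal (of_bool (N k < \<phi> (X i w) powr s)) = 1" by simp
        moreover have "ennreal (of_bool (N k < \<phi> (X i w) powr s)) \<le> U k w"
          unfolding U_def using i n by (intro member_le_sum) auto
        ultimately show False using U by simp
      qed
      have pt: "real n powr r * (\<phi> x * \<bar>?avg n x w - p x\<bar>)
        \<le> 2 * (of_bool (\<phi> x \<le> b k) * N k powr (r - 1) * \<phi> x * A (2 ^ k) x w) + E * indicator {x \<in> space \<nu>. b k < \<phi> x} x"
        for x
      proof (cases "\<phi> x \<le> b k")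
        case True
        have S: "?avg n x w - p x = S x w n / n"
          using \<open>n > 0\<close> by (simp add: S_def sum_subtractf field_simps)
        have "real n powr r * (\<phi> x * \<bar>S x w n / n\<bar>) = real n powr (r - 1) * (\<phi> x * \<bar>S x w n\<bar>)"
          using \<open>n > 0\<close> by (simp add: powr_diff abs_mult)
        also have "\<dots> \<le> 2 * N k powr (r - 1) * (\<phi> x * A (2 ^ k) x w)"
        proof (intro mult_mono A_ge n)
          have "real n powr (r - 1) \<le> (N k / 2) powr (r - 1)"
            using n' r N(1)[of k] by (intro powr_mono2') auto
          also have "\<dots> = N k powr (r - 1) * 2 powr (1 - r)"
            using N(1)[of k] by (simp add: powr_divide powr_diff field_simps)
          also have "\<dots> \<le> N k powr (r - 1) * 2 powr 1"
            using r by (intro mult_left_mono powr_mono) auto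
          finally show "real n powr (r - 1) \<le> 2 * N k powr (r - 1)" by simp
        qed (use pos[of x] A_nonneg in \<open>auto simp: less_imp_le\<close>)
        finally show ?thesis using True E(2) S by (simp add: mult_ac)
      next
        case False
        have "W x (X i w) = 0" if "1 \<le> i" "i \<le> n" for i
          using W01[of x "X i w"] dom[of x "X i w"] small[OF that] False by auto
        then have W0: "(\<Sum>i=1..n. W x (X i w)) = 0" by simp
        have "real n powr r * (\<phi> x * p x) \<le> N k powr r * (\<phi> x * p x)"
          using n' r p01[of x] pos[of x] by (intro mult_right_mono powr_mono2) auto
        also have "\<dots> = N k powr r * (\<phi> x powr (1 - s) * (\<phi> x powr s * p x))"
          using pos[of x] by (simp add: mult.assoc[symmetric] powr_add[symmetric])
        also have "\<dots> \<le> N k powr r * (b k powr (1 - s) * E)"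
          using False markov[of x] s p01[of x] N(1)[of k]
          by (intro mult_left_mono mult_mono powr_mono2') (auto simp: b_def)
        also have "N k powr r * (b k powr (1 - s) * E) = N k powr (r + (1 - r) * (1 - s)) * E"
          by (simp add: b_def powr_powr powr_add)
        also have "r + (1 - r) * (1 - s) = 0" using s(3) by (simp add: algebra_simps)
        finally show ?thesis
          using False W0 N(1)[of k] p01[of x] sets_eq_imp_space_eq[OF sets_\<nu>] by (simp add: not_le)
      qed
      have "Dn n = (\<integral>\<^sup>+x. ennreal (real n powr r * (\<phi> x * \<bar>?avg n x w - p x\<bar>)) \<partial>\<nu>)"
        unfolding Dn_def using pos
        by (subst nn_integral_cmult[symmetric]) (auto simp: ennreal_mult less_imp_le)
      also have "\<dots> \<le> (\<integral>\<^sup>+x. 2 * ennreal (of_bool (\<phi> x \<le> b k) * N k powr (r - 1) * \<phi> x * A (2 ^ k) x w)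
          + ennreal E * indicator {x \<in> space \<nu>. b k < \<phi> x} x \<partial>\<nu>)"
      proof (intro nn_integral_mono, goal_cases)
        case (1 x)
        show ?case
          using ennreal_leI[OF pt[of x]] pos[of x] A_nonneg[of "2 ^ k" x w] E(2)
          by (simp add: ennreal_plus ennreal_mult less_imp_le ennreal_indicator)
      qed
      also have "\<dots> = Bk k"
        unfolding Bk_def V_def
        by (simp add: nn_integral_add nn_integral_cmult)
      finally show ?thesis .
    qed
    have "\<forall>\<^sub>F n in sequentially. Dn n < e" if e: "e > 0" for e
    proof -
      have "\<forall>\<^sub>F k in sequentially. Bk k < e \<and> U k w < 1"
        using order_tendstoD(2)[OF Bk e] order_tendstoD(2)[OF elim(2), of 1] by (auto intro: eventually_conj)
      then obtain k0 where k0: "\<And>k. k \<ge> k0 \<Longrightarrow> Bk k < e \<and> U k w < 1"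
        by (auto simp: eventually_sequentially)
      have "Dn n < e" if n: "n \<ge> 2 ^ k0" for n
      proof -
        have "n \<ge> 1" using n by (meson le_trans one_le_numeral one_le_power)
        then obtain j where j: "2 ^ j \<le> n" "n < 2 ^ (j + 1)"
          using ex_power_ivl1[of 2 n] by auto
        have "(2::nat) ^ k0 < 2 ^ (j + 1)" using n j by linarith
        then have "k0 < j + 1" by (rule power_less_imp_less_exp[rotated]) simp
        then show ?thesis
          using Dn_le[of "j + 1" n] k0[of "j + 1"] j by (auto intro: le_less_trans)
      qed
      then show ?thesis by (auto simp: eventually_sequentially)
    qed
    then have "Dn \<longlonglongrightarrow> 0" by (intro order_tendstoI) auto
    then show ?case unfolding Dn_def p_def .
  qed
qed

end

section \<open>Covariances, quantiles and the Huber function\<close>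

lemma nn_integral_layer: "(\<integral>\<^sup>+s. ennreal (of_bool (0 \<le> s \<and> s < y)) \<partial>lborel) = ennreal y" for y :: real
proof -
  have "(\<integral>\<^sup>+s. ennreal (of_bool (0 \<le> s \<and> s < y)) \<partial>lborel) = (\<integral>\<^sup>+s. indicator {0..<y} s \<partial>lborel)"
    by (intro nn_integral_cong) (auto simp: indicator_def)
  also have "\<dots> = ennreal y"
    by (cases "0 \<le> y") (auto simp: ennreal_neg)
  finally show ?thesis .
qed

context prob_space
begin

text \<open>Rio's covariance inequality in its one-sided form: write both variables as integrals of the
  indicators of their level sets and bound the dependence at each pair of levels by the least of
  \<open>a\<close>, \<open>P(Y > s)\<close> and \<open>P(Z > t)\<close>.  The functions \<open>QY\<close> and \<open>QZ\<close> are upper bounds for the quantile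
  functions.  The factor \<open>\<kappa>\<close> allows two uses: \<open>\<kappa> = 1\<close> gives the covariance bound, \<open>\<kappa> = 0\<close> with
  \<open>a = 1\<close> bounds the plain product moment.\<close>
lemma nn_integral_mult_le_quantile:
  fixes Y Z :: "'a \<Rightarrow> real" and QY QZ :: "real \<Rightarrow> real"
  assumes Y[measurable]: "Y \<in> borel_measurable M" and Z[measurable]: "Z \<in> borel_measurable M"
    and nonneg: "\<And>w. 0 \<le> Y w" "\<And>w. 0 \<le> Z w"
    and [measurable]: "QY \<in> borel_measurable borel" "QZ \<in> borel_measurable borel"
    and QY: "\<And>s u. 0 \<le> s \<Longrightarrow> 0 < u \<Longrightarrow> u < 1 \<Longrightarrow> u < \<P>(w in M. s < Y w) \<Longrightarrow> s < QY u"
    and QZ: "\<And>s u. 0 \<le> s \<Longrightarrow> 0 < u \<Longrightarrow> u < 1 \<Longrightarrow> u < \<P>(w in M. s < Z w) \<Longrightarrow> s < QZ u"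
    and "0 \<le> \<kappa>"
    and dep: "\<And>s t. 0 \<le> s \<Longrightarrow> 0 \<le> t \<Longrightarrow> \<P>(w in M. s < Y w \<and> t < Z w)
      \<le> \<kappa> * \<P>(w in M. s < Y w) * \<P>(w in M. t < Z w) + a"
  shows "(\<integral>\<^sup>+w. ennreal (Y w * Z w) \<partial>M)
    \<le> ennreal \<kappa> * (\<integral>\<^sup>+w. ennreal (Y w) \<partial>M) * (\<integral>\<^sup>+w. ennreal (Z w) \<partial>M)
      + (\<integral>\<^sup>+u \<in> {0<..<1}. ennreal (of_bool (u < a)) * ennreal (QY u) * ennreal (QZ u) \<partial>lborel)"
proof -
  define h where "h = (\<lambda>y s. ennreal (of_bool (0 \<le> s \<and> s < (y :: real))))"
  have [measurable]: "case_prod h \<in> borel_measurable (borel \<Otimes>\<^sub>M borel)"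
    unfolding h_def by measurable
  have layer: "(\<integral>\<^sup>+s. h y s \<partial>lborel) = ennreal y" for y
    unfolding h_def by (rule nn_integral_layer)
  interpret pair_sigma_finite M lborel ..
  have prod: "(\<integral>\<^sup>+s. (\<integral>\<^sup>+t. c * h y s * h z t \<partial>lborel) \<partial>lborel) = c * ennreal y * ennreal z" for y z c
    by (simp add: nn_integral_cmult nn_integral_multc layer mult.assoc)
  have tail: "(\<integral>\<^sup>+w. h (f w) s \<partial>M) = of_bool (0 \<le> s) * ennreal (\<P>(w in M. s < f w))"
    if [measurable]: "f \<in> borel_measurable M" for f s
  proof -
    have "(\<integral>\<^sup>+w. h (f w) s \<partial>M) = (\<integral>\<^sup>+w. of_bool (0 \<le> s) * indicator {w \<in> space M. s < f w} w \<partial>M)"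
      by (intro nn_integral_cong) (auto simp: h_def indicator_def)
    then show ?thesis by (simp add: nn_integral_cmult emeasure_eq_measure)
  qed
  have tail2: "(\<integral>\<^sup>+w. h (Y w) s * h (Z w) t \<partial>M)
      = of_bool (0 \<le> s \<and> 0 \<le> t) * ennreal (\<P>(w in M. s < Y w \<and> t < Z w))" for s t
  proof -
    have "(\<integral>\<^sup>+w. h (Y w) s * h (Z w) t \<partial>M)
      = (\<integral>\<^sup>+w. of_bool (0 \<le> s \<and> 0 \<le> t) * indicator {w \<in> space M. s < Y w \<and> t < Z w} w \<partial>M)"
      by (intro nn_integral_cong) (auto simp: h_def indicator_def)
    then show ?thesis by (simp add: nn_integral_cmult emeasure_eq_measure)
  qed
  define g where "g = (\<lambda>u. ennreal (of_bool (u < a)) * indicator {0<..<1::real} u)"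
  have [measurable]: "g \<in> borel_measurable borel" unfolding g_def by measurable
  have pt: "(\<integral>\<^sup>+w. h (Y w) s * h (Z w) t \<partial>M)
      \<le> ennreal \<kappa> * (\<integral>\<^sup>+w. h (Y w) s \<partial>M) * (\<integral>\<^sup>+w. h (Z w) t \<partial>M)
        + (\<integral>\<^sup>+u. g u * h (QY u) s * h (QZ u) t \<partial>lborel)" for s t
  proof (cases "0 \<le> s \<and> 0 \<le> t")
    case True
    define py where "py = \<P>(w in M. s < Y w)"
    define pz where "pz = \<P>(w in M. t < Z w)"
    define pyz where "pyz = \<P>(w in M. s < Y w \<and> t < Z w)"
    define m where "m = min a (min py pz)"
    have "pyz \<le> py" "pyz \<le> pz"
      unfolding pyz_def py_def pz_def by (auto intro!: finite_measure_mono)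
    moreover have "0 \<le> \<kappa> * py * pz" using \<open>0 \<le> \<kappa>\<close> by (simp add: py_def pz_def)
    moreover have "pyz \<le> \<kappa> * py * pz + a" using dep[of s t] True by (simp add: pyz_def py_def pz_def)
    ultimately have "pyz \<le> \<kappa> * py * pz + m" by (auto simp: m_def)
    then have "ennreal pyz \<le> ennreal (\<kappa> * py * pz) + ennreal m"
      using \<open>0 \<le> \<kappa> * py * pz\<close>
      by (cases "0 \<le> m") (auto simp: ennreal_plus[symmetric] ennreal_neg simp del: ennreal_plus intro!: ennreal_leI)
    also have "ennreal m = emeasure lborel {0<..<m}"
      by (cases "0 \<le> m") (auto simp: ennreal_neg)
    also have "\<dots> = (\<integral>\<^sup>+u. indicator {0<..<m} u \<partial>lborel)" by simp
    also have "\<dots> \<le> (\<integral>\<^sup>+u. g u * h (QY u) s * h (QZ u) t \<partial>lborel)"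
    proof (intro nn_integral_mono)
      fix u
      have "py \<le> 1" by (simp add: py_def)
      show "indicator {0<..<m} u \<le> g u * h (QY u) s * h (QZ u) t"
      proof (cases "0 < u \<and> u < m")
        case u: True
        then have "0 < u" "u < 1" "u < a" "u < py" "u < pz"
          using \<open>py \<le> 1\<close> by (auto simp: m_def)
        then show ?thesis
          using QY[of s u] QZ[of t u] True u
          by (simp add: g_def h_def py_def[symmetric] pz_def[symmetric])
      qed simp
    qed
    also have "ennreal (\<kappa> * py * pz) = ennreal \<kappa> * ennreal py * ennreal pz"
      using \<open>0 \<le> \<kappa>\<close> by (simp add: ennreal_mult py_def pz_def)
    finally show ?thesis
      using True by (simp add: tail tail2 pyz_def py_def pz_def add_mono)
  next
    case False then show ?thesis by (auto simp: tail2)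
  qed
  have "(\<integral>\<^sup>+w. ennreal (Y w * Z w) \<partial>M) = (\<integral>\<^sup>+w. (\<integral>\<^sup>+s. (\<integral>\<^sup>+t. h (Y w) s * h (Z w) t \<partial>lborel) \<partial>lborel) \<partial>M)"
    using prod[of 1] nonneg by (simp add: ennreal_mult)
  also have "\<dots> = (\<integral>\<^sup>+s. (\<integral>\<^sup>+w. (\<integral>\<^sup>+t. h (Y w) s * h (Z w) t \<partial>lborel) \<partial>M) \<partial>lborel)"
    by (intro Fubini'[symmetric]) measurable
  also have "\<dots> = (\<integral>\<^sup>+s. (\<integral>\<^sup>+t. (\<integral>\<^sup>+w. h (Y w) s * h (Z w) t \<partial>M) \<partial>lborel) \<partial>lborel)"
    by (intro nn_integral_cong Fubini'[symmetric]) measurable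
  also have "\<dots> \<le> (\<integral>\<^sup>+s. (\<integral>\<^sup>+t. ennreal \<kappa> * (\<integral>\<^sup>+w. h (Y w) s \<partial>M) * (\<integral>\<^sup>+w. h (Z w) t \<partial>M)
        + (\<integral>\<^sup>+u. g u * h (QY u) s * h (QZ u) t \<partial>lborel) \<partial>lborel) \<partial>lborel)"
    by (intro nn_integral_mono pt)
  also have "\<dots> = (\<integral>\<^sup>+s. (\<integral>\<^sup>+t. ennreal \<kappa> * (\<integral>\<^sup>+w. h (Y w) s \<partial>M) * (\<integral>\<^sup>+w. h (Z w) t \<partial>M) \<partial>lborel) \<partial>lborel)
        + (\<integral>\<^sup>+s. (\<integral>\<^sup>+t. (\<integral>\<^sup>+u. g u * h (QY u) s * h (QZ u) t \<partial>lborel) \<partial>lborel) \<partial>lborel)"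
    by (simp add: nn_integral_add)
  also have "(\<integral>\<^sup>+s. (\<integral>\<^sup>+t. ennreal \<kappa> * (\<integral>\<^sup>+w. h (Y w) s \<partial>M) * (\<integral>\<^sup>+w. h (Z w) t \<partial>M) \<partial>lborel) \<partial>lborel)
      = ennreal \<kappa> * (\<integral>\<^sup>+s. (\<integral>\<^sup>+w. h (Y w) s \<partial>M) \<partial>lborel) * (\<integral>\<^sup>+t. (\<integral>\<^sup>+w. h (Z w) t \<partial>M) \<partial>lborel)"
    by (simp add: nn_integral_cmult nn_integral_multc mult.assoc)
  also have "(\<integral>\<^sup>+s. (\<integral>\<^sup>+w. h (Y w) s \<partial>M) \<partial>lborel) = (\<integral>\<^sup>+w. ennreal (Y w) \<partial>M)"
    unfolding layer[symmetric] by (intro Fubini') measurable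
  also have "(\<integral>\<^sup>+s. (\<integral>\<^sup>+w. h (Z w) s \<partial>M) \<partial>lborel) = (\<integral>\<^sup>+w. ennreal (Z w) \<partial>M)"
    unfolding layer[symmetric] by (intro Fubini') measurable
  also have "(\<integral>\<^sup>+s. (\<integral>\<^sup>+t. (\<integral>\<^sup>+u. g u * h (QY u) s * h (QZ u) t \<partial>lborel) \<partial>lborel) \<partial>lborel)
      = (\<integral>\<^sup>+s. (\<integral>\<^sup>+u. (\<integral>\<^sup>+t. g u * h (QY u) s * h (QZ u) t \<partial>lborel) \<partial>lborel) \<partial>lborel)"
    by (intro nn_integral_cong lborel_pair.Fubini') measurable
  also have "\<dots> = (\<integral>\<^sup>+u. (\<integral>\<^sup>+s. (\<integral>\<^sup>+t. g u * h (QY u) s * h (QZ u) t \<partial>lborel) \<partial>lborel) \<partial>lborel)"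
    by (intro lborel_pair.Fubini') measurable
  also have "\<dots> = (\<integral>\<^sup>+u \<in> {0<..<1}. ennreal (of_bool (u < a)) * ennreal (QY u) * ennreal (QZ u) \<partial>lborel)"
    unfolding prod by (intro nn_integral_cong) (simp add: g_def mult_ac)
  finally show ?thesis .
qed

end

definition ramp :: "real \<Rightarrow> real \<Rightarrow> real" where
  "ramp l x = max 0 (min 1 (x / l))"

text \<open>This is the maximum of \<open>x * c - l * c\<^sup>2 / 2\<close> over \<open>c\<close> in the unit interval, attained at
  \<open>ramp l x\<close>: zero on the negative axis, quadratic up to \<open>l\<close>, linear beyond.  The dual form makes the
  second-order expansion a consequence of optimality, without distinguishing cases.\<close>
definition huber :: "real \<Rightarrow> real \<Rightarrow> real" where
  "huber l x = x * ramp l x - l * (ramp l x)\<^sup>2 / 2"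

lemma ramp_measurable [measurable]: "ramp l \<in> borel_measurable borel"
  unfolding ramp_def[abs_def] by measurable

lemma huber_measurable [measurable]: "huber l \<in> borel_measurable borel"
  unfolding huber_def[abs_def] by measurable

lemma ramp_bounds: "0 \<le> ramp l x" "ramp l x \<le> 1"
  by (auto simp: ramp_def)

lemma ramp_increment:
  assumes "l > 0" "h \<ge> 0"
  shows "ramp l x \<le> ramp l (x + h)" "ramp l (x + h) - ramp l x \<le> h / l"
proof -
  have "0 \<le> h / l" using assms by simp
  then show "ramp l x \<le> ramp l (x + h)" "ramp l (x + h) - ramp l x \<le> h / l"
    unfolding ramp_def add_divide_distrib by linarith+
qed

text \<open>The variational inequality that characterises the maximiser in the definition of \<open>huber\<close>.\<close>
lemma ramp_optimal:
  assumes "l > 0" "0 \<le> c" "c \<le> 1"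
  shows "(x - l * ramp l x) * (c - ramp l x) \<le> 0"
proof -
  consider "x < 0" | "0 \<le> x" "x \<le> l" | "x > l" by linarith
  then show ?thesis
  proof cases
    case 1
    then have "ramp l x = 0" using assms by (simp add: ramp_def min_def max_def divide_le_0_iff field_simps)
    then show ?thesis using 1 assms by (simp add: mult_le_0_iff)
  next
    case 2
    then have "ramp l x = x / l" using assms by (simp add: ramp_def)
    then show ?thesis using assms by simp
  next
    case 3
    then have "ramp l x = 1" using assms by (simp add: ramp_def)
    then show ?thesis using 3 assms by (simp add: mult_le_0_iff)
  qed
qed

lemma huber_increment:
  assumes l: "l > 0"
  shows "huber l (x + h) \<le> huber l x + ramp l x * h + h\<^sup>2 / (2 * l)"
proof -
  define c c' where "c = ramp l x" and "c' = ramp l (x + h)"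
  define k where "k = h\<^sup>2 / (2 * l)"
  have "0 \<le> (h - l * (c' - c))\<^sup>2 / (2 * l)" using l by simp
  also have "(h - l * (c' - c))\<^sup>2 / (2 * l) = k - h * (c' - c) + l * (c' - c)\<^sup>2 / 2"
    using l by (simp add: k_def power2_eq_square field_simps)
  finally have "0 \<le> k - h * (c' - c) + l * (c' - c)\<^sup>2 / 2" .
  moreover have "(x - l * c) * (c' - c) \<le> 0"
    unfolding c_def c'_def using l ramp_bounds by (rule ramp_optimal)
  ultimately show ?thesis
    unfolding huber_def c_def[symmetric] c'_def[symmetric] k_def[symmetric]
    by (simp add: power2_eq_square algebra_simps add_divide_distrib diff_divide_distrib)
qed

lemma huber_lower:
  assumes l: "l > 0"
  shows "0 \<le> huber l x" "x \<ge> l \<Longrightarrow> l / 2 \<le> huber l x"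
proof -
  have "0 \<le> l * (ramp l x)\<^sup>2" using l by simp
  then show "0 \<le> huber l x"
    using ramp_optimal[OF l, of 0 x] by (simp add: huber_def power2_eq_square algebra_simps)
  assume "x \<ge> l"
  then have "ramp l x = 1" using l by (simp add: ramp_def)
  then show "l / 2 \<le> huber l x" using \<open>x \<ge> l\<close> by (simp add: huber_def)
qed

section \<open>Deviations of bounded mixing sums\<close>

lemma measurable_subalgebra_imp:
  fixes f :: "'a \<Rightarrow> real"
  assumes "f \<in> borel_measurable N" "space N = space M" "sets N \<subseteq> sets M"
  shows "f \<in> borel_measurable M"
proof (rule measurableI)
  show "f -` A \<inter> space M \<in> sets M" if "A \<in> sets borel" for A
    using measurable_sets[OF assms(1) that] assms(2,3) by auto
qed simp

context prob_space
begin

text \<open>Expand \<open>huber l (T k - k * \<mu>)\<close> step by step.  The first-order term pairs the new variable with the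
  derivative \<open>ramp\<close> at the old sum.  Removing the summands of the old sum one at a time, up to lag \<open>q\<close>,
  leaves increments that are at most \<open>Z / l\<close>, so they contribute covariances quadratic in \<open>Q\<close>; what
  remains depends on the past beyond lag \<open>q\<close> and lies between \<open>0\<close> and \<open>1\<close>, so it contributes only
  linearly.\<close>
lemma mixing_deviation_bounded:
  fixes Z :: "nat \<Rightarrow> 'a \<Rightarrow> real" and \<F> :: "nat \<Rightarrow> 'a measure" and Q :: "real \<Rightarrow> real"
    and \<alpha> :: "nat \<Rightarrow> real" and q N :: nat and \<mu> B l :: real
  assumes l: "l > 0" and q: "q \<ge> 1"
    and \<F>: "\<And>m. space (\<F> m) = space M" "\<And>m. sets (\<F> m) \<subseteq> events"
    and adapted: "\<And>i m. 1 \<le> i \<Longrightarrow> i \<le> m \<Longrightarrow> Z i \<in> borel_measurable (\<F> m)"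
    and Z_bnd: "\<And>i w. 0 \<le> Z i w" "\<And>i w. Z i w \<le> B"
    and mean: "\<And>i. 1 \<le> i \<Longrightarrow> expectation (Z i) = \<mu>"
    and mix: "\<And>m j A t. 1 \<le> m \<Longrightarrow> 1 \<le> j \<Longrightarrow> A \<in> sets (\<F> m) \<Longrightarrow>
      prob (A \<inter> {w \<in> space M. t < Z (m + j) w}) \<le> prob A * \<P>(w in M. t < Z (m + j) w) + \<alpha> j"
    and Q[measurable]: "Q \<in> borel_measurable borel" and Q_bnd: "\<And>u. 0 \<le> Q u" "\<And>u. Q u \<le> B"
    and tail: "\<And>i t u. 1 \<le> i \<Longrightarrow> 0 \<le> t \<Longrightarrow> 0 < u \<Longrightarrow> u < 1 \<Longrightarrow> u < \<P>(w in M. t < Z i w) \<Longrightarrow> t < Q u"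
  shows "ennreal (\<P>(w in M. N * \<mu> + l \<le> (\<Sum>i=1..N. Z i w)))
    \<le> ennreal (2 * N / l) * (\<integral>\<^sup>+u \<in> {0<..<1}. ennreal ((1 + (\<Sum>j=1..<q. of_bool (u < \<alpha> j))) * (Q u)\<^sup>2 / l
          + of_bool (u < \<alpha> q) * Q u) \<partial>lborel)"
proof -
  have subalg: "f \<in> borel_measurable M" if "f \<in> borel_measurable (\<F> m)" for f :: "'a \<Rightarrow> real" and m
    using measurable_subalgebra_imp[OF that] \<F> by simp
  have Z_meas[measurable]: "Z i \<in> borel_measurable M" if "1 \<le> i" for i
    using subalg[OF adapted[OF that order_refl]] .
  have B: "0 \<le> B" using Q_bnd[of 0] by simp
  have bounded: "integrable M f" if "f \<in> borel_measurable M" "\<And>w. \<bar>f w\<bar> \<le> c" for f :: "'a \<Rightarrow> real" and c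
    using that by (intro integrable_const_bound[of _ c]) auto
  have Z_int: "integrable M (Z i)" if "1 \<le> i" for i
    using that Z_bnd[of i] by (intro bounded[of _ B]) auto
  define J where "J = (\<lambda>f. \<integral>\<^sup>+u \<in> {0<..<1::real}. ennreal (f u) \<partial>lborel)"
  define c where "c = (\<lambda>a. enn2real (J (\<lambda>u. of_bool (u < a) * (Q u)\<^sup>2 / l)))"
  define d where "d = enn2real (J (\<lambda>u. of_bool (u < \<alpha> q) * Q u))"
  have J_fin: "J f < \<top>" if "\<And>u. f u \<le> C" for f C
  proof -
    have "J f \<le> (\<integral>\<^sup>+u. ennreal C * indicator {0<..<1::real} u \<partial>lborel)"
      unfolding J_def using that by (intro nn_integral_mono mult_right_mono ennreal_leI) auto
    also have "\<dots> < \<top>" by (simp add: nn_integral_cmult_indicator ennreal_mult_less_top)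
    finally show ?thesis .
  qed
  have Q_sq: "(Q u)\<^sup>2 \<le> B\<^sup>2" for u
    using Q_bnd by (intro power_mono) auto
  have c: "ennreal (c a) = J (\<lambda>u. of_bool (u < a) * (Q u)\<^sup>2 / l)" for a
  proof -
    have "of_bool (u < a) * (Q u)\<^sup>2 / l \<le> B\<^sup>2 / l" for u
      using Q_sq[of u] l by (auto intro: divide_right_mono)
    then show ?thesis unfolding c_def by (intro ennreal_enn2real J_fin)
  qed
  have d: "ennreal d = J (\<lambda>u. of_bool (u < \<alpha> q) * Q u)"
  proof -
    have "of_bool (u < \<alpha> q) * Q u \<le> B" for u using Q_bnd[of u] B by auto
    then show ?thesis unfolding d_def by (intro ennreal_enn2real J_fin)
  qed

  have mu0: "0 \<le> \<mu>"
  proof -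
    have "0 \<le> expectation (Z 1)" using Z_bnd by (intro Bochner_Integration.integral_nonneg) auto
    then show ?thesis using mean[of 1] by simp
  qed
  have cov: "expectation (\<lambda>w. Y w * (Z k w - \<mu>)) \<le> x"
    if Y: "Y \<in> borel_measurable (\<F> m)" and k: "k = m + j" "1 \<le> m" "1 \<le> j"
      and Yb: "\<And>w. 0 \<le> Y w" "\<And>w. Y w \<le> C" and QY[measurable]: "QY \<in> borel_measurable borel" "\<And>u. 0 \<le> QY u"
      and tailY: "\<And>s u. 0 \<le> s \<Longrightarrow> 0 < u \<Longrightarrow> u < 1 \<Longrightarrow> u < \<P>(w in M. s < Y w) \<Longrightarrow> s < QY u"
      and x: "ennreal x = J (\<lambda>u. of_bool (u < \<alpha> j) * QY u * Q u)" "0 \<le> x" for Y m j k C QY x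
  proof -
    have Ym[measurable]: "Y \<in> borel_measurable M" using subalg[OF Y] .
    have k1: "1 \<le> k" using k by simp
    have "(\<integral>\<^sup>+w. ennreal (Y w * Z k w) \<partial>M)
      \<le> ennreal 1 * (\<integral>\<^sup>+w. ennreal (Y w) \<partial>M) * (\<integral>\<^sup>+w. ennreal (Z k w) \<partial>M)
        + (\<integral>\<^sup>+u \<in> {0<..<1}. ennreal (of_bool (u < \<alpha> j)) * ennreal (QY u) * ennreal (Q u) \<partial>lborel)"
    proof (rule nn_integral_mult_le_quantile)
      fix s t :: real
      have "{w \<in> space M. s < Y w} \<in> sets (\<F> m)"
        using Y by (simp add: \<F>(1)[of m, symmetric])
      then show "\<P>(w in M. s < Y w \<and> t < Z k w)
        \<le> 1 * \<P>(w in M. s < Y w) * \<P>(w in M. t < Z k w) + \<alpha> j"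
        using mix[OF k(2,3), of "{w \<in> space M. s < Y w}" t] by (simp add: k(1) Collect_conj_eq Int_assoc Int_left_commute)
    qed (use Yb Z_bnd tailY tail[OF k1] k1 QY in auto)
    also have "(\<integral>\<^sup>+u \<in> {0<..<1}. ennreal (of_bool (u < \<alpha> j)) * ennreal (QY u) * ennreal (Q u) \<partial>lborel) = ennreal x"
      unfolding x J_def using QY(2) Q_bnd by (intro nn_integral_cong) (simp add: ennreal_mult)
    also have "(\<integral>\<^sup>+w. ennreal (Z k w) \<partial>M) = ennreal \<mu>"
      using Z_int[OF k1] Z_bnd mean[OF k1] by (subst nn_integral_eq_integral) auto
    also have "(\<integral>\<^sup>+w. ennreal (Y w) \<partial>M) = ennreal (expectation Y)"
      using Yb by (intro nn_integral_eq_integral bounded[of _ C]) auto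
    also have "(\<integral>\<^sup>+w. ennreal (Y w * Z k w) \<partial>M) = ennreal (expectation (\<lambda>w. Y w * Z k w))"
      using Yb Z_bnd k1 B by (intro nn_integral_eq_integral bounded[of _ "C * B"]) (auto simp: abs_mult intro!: mult_mono intro: order_trans)
    also have "ennreal 1 * ennreal (expectation Y) * ennreal \<mu> + ennreal x = ennreal (expectation Y * \<mu> + x)"
      using x(2) Yb mu0
      by (simp add: ennreal_mult ennreal_plus)
    finally have "expectation (\<lambda>w. Y w * Z k w) \<le> expectation Y * \<mu> + x"
      using x(2) Yb mu0 by (subst (asm) ennreal_le_iff) auto
    moreover have "expectation (\<lambda>w. Y w * (Z k w - \<mu>)) = expectation (\<lambda>w. Y w * Z k w) - expectation Y * \<mu>"
    proof -
      have "integrable M (\<lambda>w. Y w * Z k w)"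
        using Yb Z_bnd k1 B by (intro bounded[of _ "C * B"]) (auto simp: abs_mult intro!: mult_mono intro: order_trans)
      moreover have "integrable M Y" using Yb by (intro bounded[of _ C]) auto
      ultimately show ?thesis by (simp add: right_diff_distrib)
    qed
    ultimately show ?thesis by simp
  qed

  have sq: "expectation (\<lambda>w. (Z k w - \<mu>)\<^sup>2) / (2 * l) \<le> c 1" if k: "1 \<le> k" for k
  proof -
    have "(\<integral>\<^sup>+w. ennreal (Z k w * Z k w) \<partial>M)
      \<le> ennreal 0 * (\<integral>\<^sup>+w. ennreal (Z k w) \<partial>M) * (\<integral>\<^sup>+w. ennreal (Z k w) \<partial>M)
        + (\<integral>\<^sup>+u \<in> {0<..<1}. ennreal (of_bool (u < 1)) * ennreal (Q u) * ennreal (Q u) \<partial>lborel)"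
      by (rule nn_integral_mult_le_quantile) (use Z_bnd tail[OF k] k in auto)
    also have "\<dots> = (\<integral>\<^sup>+u. ennreal l * (ennreal (of_bool (u < 1) * (Q u)\<^sup>2 / l) * indicator {0<..<1} u) \<partial>lborel)"
      using Q_bnd l by (simp, intro nn_integral_cong) (auto simp: indicator_def power2_eq_square ennreal_mult[symmetric])
    also have "\<dots> = ennreal l * ennreal (c 1)"
      unfolding c J_def by (intro nn_integral_cmult) measurable
    also have "\<dots> = ennreal (l * c 1)" using l by (simp add: c_def ennreal_mult)
    also have "(\<integral>\<^sup>+w. ennreal (Z k w * Z k w) \<partial>M) = ennreal (expectation (\<lambda>w. (Z k w)\<^sup>2))"
      unfolding power2_eq_square using Z_bnd k B
      by (intro nn_integral_eq_integral bounded[of _ "B * B"]) (auto simp: abs_mult intro!: mult_mono)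
    finally have "expectation (\<lambda>w. (Z k w)\<^sup>2) \<le> l * c 1"
      using l by (subst (asm) ennreal_le_iff) (auto simp: c_def)
    moreover have "integrable M (\<lambda>w. (Z k w)\<^sup>2)"
      using Z_bnd k B by (intro bounded[of _ "B\<^sup>2"]) (auto intro!: power_mono)
    then have "expectation (\<lambda>w. (Z k w - \<mu>)\<^sup>2) \<le> expectation (\<lambda>w. (Z k w)\<^sup>2)"
      using variance_eq[OF Z_int[OF k]] mean[OF k] by simp
    ultimately have "expectation (\<lambda>w. (Z k w - \<mu>)\<^sup>2) \<le> l * c 1" by simp
    also have "\<dots> \<le> c 1 * (2 * l)" using l by (simp add: c_def)
    finally show ?thesis using l by (simp add: divide_le_eq)
  qed

  define T where "T = (\<lambda>k w. \<Sum>i=1..k. Z i w)"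
  have T_adapted: "T k \<in> borel_measurable (\<F> k)" for k
    unfolding T_def using adapted by (intro borel_measurable_sum) auto
  have T_meas[measurable]: "T k \<in> borel_measurable M" for k
    using subalg[OF T_adapted] .
  have T_Suc: "T (Suc k) w = T k w + Z (Suc k) w" for k w by (simp add: T_def)
  have T_bnd: "\<bar>T k w\<bar> \<le> k * B" for k w
    unfolding T_def using Z_bnd sum_mono[of "{1..k}" "\<lambda>i. Z i w" "\<lambda>_. B"] by (simp add: sum_nonneg)
  define H where "H = (\<lambda>k w. huber l (T k w - k * \<mu>))"
  have H_int: "integrable M (H k)" for k
  proof (rule bounded)
    fix w
    have "\<bar>T k w - k * \<mu>\<bar> * ramp l (T k w - k * \<mu>) \<le> (k * B + k * \<bar>\<mu>\<bar>) * 1"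
      using ramp_bounds T_bnd[of k w] B by (intro mult_mono order_trans[OF abs_triangle_ineq4]) (auto simp: abs_mult)
    moreover have "l * (ramp l (T k w - k * \<mu>))\<^sup>2 / 2 \<le> l * 1 / 2"
      using l ramp_bounds by (intro divide_right_mono mult_left_mono power_le_one) auto
    moreover have "0 \<le> l * (ramp l (T k w - k * \<mu>))\<^sup>2 / 2" using l by simp
    ultimately show "\<bar>H k w\<bar> \<le> (k * B + k * \<bar>\<mu>\<bar>) + l / 2"
      unfolding H_def huber_def using ramp_bounds(1)[of l "T k w - k * \<mu>"]
      by (intro order_trans[OF abs_triangle_ineq4]) (simp add: abs_mult)
  qed (simp add: H_def)
  define K where "K = c 1 + (\<Sum>j=1..<q. c (\<alpha> j)) + d"
  have step: "expectation (H (Suc k)) \<le> expectation (H k) + K" for k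
  proof -
    \<comment> \<open>All increments are taken with the same centring \<open>k * \<mu>\<close>; since the variables are nonnegative,
      this makes them nonnegative.\<close>
    define a where "a = (\<lambda>i w. ramp l (T i w - k * \<mu>))"
    have a_adapted: "a i \<in> borel_measurable (\<F> i)" for i
      unfolding a_def using T_adapted by (intro measurable_compose[OF _ ramp_measurable]) auto
    have a_meas[measurable]: "a i \<in> borel_measurable M" for i
      using subalg[OF a_adapted] .
    have a01: "0 \<le> a i w" "a i w \<le> 1" for i w
      unfolding a_def using ramp_bounds by auto
    have a_diff: "0 \<le> a (Suc i) w - a i w" "a (Suc i) w - a i w \<le> Z (Suc i) w / l" for i w
      using ramp_increment[OF l, of "Z (Suc i) w" "T i w - k * \<mu>"] Z_bnd
      by (simp_all add: a_def T_Suc algebra_simps)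
    let ?Z = "\<lambda>w. Z (Suc k) w - \<mu>"
    have Zk: "integrable M ?Z" "expectation ?Z = 0"
      using Z_int[of "Suc k"] mean[of "Suc k"] by (auto simp: prob_space)
    have aZ_int: "integrable M (\<lambda>w. a i w * ?Z w)" for i
      using a01 Z_bnd[of "Suc k"] by (intro Bochner_Integration.integrable_bound[OF Zk(1)]) (auto simp: abs_mult mult_le_cancel_right2)
    have telescope: "a k w * ?Z w
        = (\<Sum>j=1..<q. (a (Suc k - j) w - a (Suc k - Suc j) w) * ?Z w) + a (Suc k - q) w * ?Z w" for w
      using q
    proof (induction q rule: nat_induct_at_least)
      case (Suc n)
      then show ?case by (simp add: sum.atLeastLessThan_Suc algebra_simps)
    qed simp
    \<comment> \<open>If the lag exceeds the available past, the subtractions truncate at \<open>0\<close> and the increment is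
      zero.\<close>
    have near: "expectation (\<lambda>w. (a (Suc k - j) w - a (Suc k - Suc j) w) * ?Z w) \<le> c (\<alpha> j)"
      if j: "j \<in> {1..<q}" for j
    proof (cases "j \<le> k")
      case False
      then have "Suc k - j = Suc k - Suc j" by simp
      then show ?thesis by (simp add: c_def)
    next
      case True
      define i where "i = k - j"
      have i: "Suc k - j = Suc i" "Suc k - Suc j = i" using True by (auto simp: i_def)
      show ?thesis
        unfolding i
      proof (rule cov[of _ "Suc i" _ j "B / l" "\<lambda>u. Q u / l"])
        show "(\<lambda>w. a (Suc i) w - a i w) \<in> borel_measurable (\<F> (Suc i))"
          unfolding a_def T_def using adapted
          by (intro borel_measurable_diff measurable_compose[OF _ ramp_measurable] borel_measurable_sum) auto
        show "a (Suc i) w - a i w \<le> B / l" for w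
          using a_diff(2)[of i w] Z_bnd(2)[of "Suc i" w] l by (meson divide_right_mono less_imp_le order_trans)
        show "s < Q u / l" if su: "0 \<le> s" "0 < u" "u < 1" "u < \<P>(w in M. s < a (Suc i) w - a i w)" for s u
        proof -
          have "\<P>(w in M. s < a (Suc i) w - a i w) \<le> \<P>(w in M. s * l < Z (Suc i) w)"
            using a_diff(2)[of i] l by (intro finite_measure_mono) (auto simp: pos_less_divide_eq[symmetric] intro: less_le_trans)
          then show ?thesis
            using tail[of "Suc i" "s * l" u] su l by (simp add: pos_less_divide_eq)
        qed
        show "ennreal (c (\<alpha> j)) = J (\<lambda>u. of_bool (u < \<alpha> j) * (Q u / l) * Q u)"
          unfolding c by (simp add: power2_eq_square mult.assoc)
      qed (use True j a_diff Q_bnd l in \<open>auto simp: i_def c_def\<close>)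
    qed
    have far: "expectation (\<lambda>w. a (Suc k - q) w * ?Z w) \<le> d"
    proof (cases "q \<le> k")
      case False
      then have "a (Suc k - q) w = ramp l (- (k * \<mu>))" for w
        by (cases "Suc k - q") (auto simp: a_def T_def)
      then show ?thesis using Zk by (simp add: d_def)
    next
      case True
      show ?thesis
      proof (rule cov[of _ "Suc k - q" _ q 1 "\<lambda>_. 1"])
        show "s < 1" if "0 \<le> s" "0 < u" "u < \<P>(w in M. s < a (Suc k - q) w)" for s u
        proof (rule ccontr)
          assume "\<not> s < 1"
          then have "{w \<in> space M. s < a (Suc k - q) w} = {}"
            using a01(2)[of "Suc k - q"] by (auto simp: not_less intro: order_trans)
          then show False using that by (metis measure_empty order_less_asym)
        qed
        show "ennreal d = J (\<lambda>u. of_bool (u < \<alpha> q) * 1 * Q u)" unfolding d by simp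
      qed (use True q a01 a_adapted in \<open>auto simp: d_def\<close>)
    qed
    have "expectation (\<lambda>w. a k w * ?Z w) \<le> (\<Sum>j=1..<q. c (\<alpha> j)) + d"
    proof -
      have "integrable M (\<lambda>w. (a i w - a i' w) * ?Z w)" for i i'
        unfolding left_diff_distrib by (intro Bochner_Integration.integrable_diff aZ_int)
      then have "expectation (\<lambda>w. a k w * ?Z w)
          = (\<Sum>j=1..<q. expectation (\<lambda>w. (a (Suc k - j) w - a (Suc k - Suc j) w) * ?Z w))
            + expectation (\<lambda>w. a (Suc k - q) w * ?Z w)"
        unfolding telescope by (subst Bochner_Integration.integral_add) (auto intro!: aZ_int)
      also have "\<dots> \<le> (\<Sum>j=1..<q. c (\<alpha> j)) + d"
        by (intro add_mono sum_mono near far)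
      finally show ?thesis .
    qed
    moreover have "expectation (H (Suc k)) \<le> expectation (\<lambda>w. H k w + a k w * ?Z w + (?Z w)\<^sup>2 / (2 * l))"
    proof (intro integral_mono H_int Bochner_Integration.integrable_add aZ_int)
      show "integrable M (\<lambda>w. (?Z w)\<^sup>2 / (2 * l))"
      proof (intro integrable_divide bounded)
        show "\<bar>(?Z w)\<^sup>2\<bar> \<le> (B + \<bar>\<mu>\<bar>)\<^sup>2" for w
          using Z_bnd[of "Suc k" w] B by (simp add: abs_le_square_iff[symmetric])
      qed simp
      show "H (Suc k) w \<le> H k w + a k w * ?Z w + (?Z w)\<^sup>2 / (2 * l)" for w
        using huber_increment[OF l, of "T k w - k * \<mu>" "?Z w"]
        by (simp add: H_def a_def T_Suc algebra_simps)
    qed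
    moreover have "integrable M (\<lambda>w. (?Z w)\<^sup>2)"
    proof (rule bounded)
      show "\<bar>(?Z w)\<^sup>2\<bar> \<le> (B + \<bar>\<mu>\<bar>)\<^sup>2" for w
        using Z_bnd[of "Suc k" w] B by (simp add: abs_le_square_iff[symmetric])
    qed simp
    ultimately show ?thesis
      using sq[of "Suc k"] H_int aZ_int by (simp add: K_def)
  qed
  have "expectation (H k) \<le> k * K" for k
  proof (induction k)
    case 0 then show ?case by (simp add: H_def T_def huber_def ramp_def)
  next
    case (Suc k) then show ?case using step[of k] by (simp add: algebra_simps)
  qed
  then have HN: "expectation (H N) \<le> N * K" .
  have "l / 2 * \<P>(w in M. N * \<mu> + l \<le> T N w) = expectation (\<lambda>w. l / 2 * indicator {w \<in> space M. N * \<mu> + l \<le> T N w} w)"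
    by simp
  also have "\<dots> \<le> expectation (H N)"
  proof (intro integral_mono H_int)
    show "integrable M (\<lambda>w. l / 2 * indicator {w \<in> space M. N * \<mu> + l \<le> T N w} w)"
      by (intro integrable_mult_right integrable_real_indicator) (auto simp: less_top[symmetric])
    show "l / 2 * indicator {w \<in> space M. N * \<mu> + l \<le> T N w} w \<le> H N w" for w
      using huber_lower[OF l, of "T N w - N * \<mu>"] by (auto simp: H_def indicator_def)
  qed
  also note HN
  finally have "\<P>(w in M. N * \<mu> + l \<le> T N w) \<le> 2 * N / l * K"
    using l by (simp add: field_simps)
  then have "ennreal (\<P>(w in M. N * \<mu> + l \<le> T N w)) \<le> ennreal (2 * N / l * K)"
    by (rule ennreal_leI)
  also have "\<dots> = ennreal (2 * N / l) * ennreal K"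
    using l by (intro ennreal_mult) (auto simp: K_def c_def d_def intro!: sum_nonneg add_nonneg_nonneg)
  also have "ennreal K = J (\<lambda>u. of_bool (u < 1) * (Q u)\<^sup>2 / l) + (\<Sum>j=1..<q. J (\<lambda>u. of_bool (u < \<alpha> j) * (Q u)\<^sup>2 / l))
      + J (\<lambda>u. of_bool (u < \<alpha> q) * Q u)"
    unfolding c[symmetric] d[symmetric] K_def
    by (simp add: c_def d_def ennreal_plus sum_nonneg sum_ennreal)
  also have "\<dots> = (\<integral>\<^sup>+u. ennreal (of_bool (u < 1) * (Q u)\<^sup>2 / l) * indicator {0<..<1} u
      + (\<Sum>j=1..<q. ennreal (of_bool (u < \<alpha> j) * (Q u)\<^sup>2 / l) * indicator {0<..<1} u)
      + ennreal (of_bool (u < \<alpha> q) * Q u) * indicator {0<..<1} u \<partial>lborel)"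
  proof -
    have add: "(\<integral>\<^sup>+u. f u \<partial>lborel) + (\<Sum>j=1..<q. \<integral>\<^sup>+u. g j u \<partial>lborel) + (\<integral>\<^sup>+u. h u \<partial>lborel)
        = (\<integral>\<^sup>+u. f u + (\<Sum>j=1..<q. g j u) + h u \<partial>lborel)"
      if "f \<in> borel_measurable lborel" "\<And>j. g j \<in> borel_measurable lborel" "h \<in> borel_measurable lborel"
      for f h :: "real \<Rightarrow> ennreal" and g :: "nat \<Rightarrow> real \<Rightarrow> ennreal"
      using that by (simp add: nn_integral_add nn_integral_sum)
    show ?thesis unfolding J_def by (rule add) measurable
  qed
  also have "\<dots> = J (\<lambda>u. (1 + (\<Sum>j=1..<q. of_bool (u < \<alpha> j))) * (Q u)\<^sup>2 / l + of_bool (u < \<alpha> q) * Q u)"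
    unfolding J_def
  proof (intro nn_integral_cong, goal_cases)
    case (1 u)
    show ?case
    proof (cases "u \<in> {0<..<1}")
      case True
      define c where "c = (\<Sum>j=1..<q. of_bool (u < \<alpha> j) :: real)"
      have "0 \<le> c" by (auto simp: c_def intro!: sum_nonneg)
      have "(\<Sum>j=1..<q. ennreal (of_bool (u < \<alpha> j) * (Q u)\<^sup>2 / l)) = ennreal (\<Sum>j=1..<q. of_bool (u < \<alpha> j) * (Q u)\<^sup>2 / l)"
        using l by (intro sum_ennreal) auto
      also have "(\<Sum>j=1..<q. of_bool (u < \<alpha> j) * (Q u)\<^sup>2 / l) = c * (Q u)\<^sup>2 / l"
        by (simp only: c_def sum_distrib_right sum_divide_distrib)
      finally have sum: "(\<Sum>j=1..<q. ennreal (of_bool (u < \<alpha> j) * (Q u)\<^sup>2 / l)) = ennreal (c * (Q u)\<^sup>2 / l)" .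
      have inside: "indicator {0<..<1} u = (1::ennreal)" "of_bool (u < 1) = (1::real)"
        using True by auto
      show ?thesis
        unfolding inside mult_1_right mult_1_left sum c_def[symmetric]
        using l Q_bnd \<open>0 \<le> c\<close> by (simp add: ennreal_plus[symmetric] distrib_right add_divide_distrib del: ennreal_plus)
    qed simp
  qed
  finally show ?thesis unfolding J_def T_def .
qed

end

section \<open>Deviations of unbounded mixing sums\<close>

text \<open>Here \<open>Q\<close> is a value of the quantile function and \<open>a\<close> the corresponding value of the inverse mixing
  rate.  Where \<open>a * Q\<close> exceeds the block length \<open>n\<close>, truncated first moments are used, elsewhere second
  moments.\<close>
definition rio_kernel :: "real \<Rightarrow> real \<Rightarrow> real \<Rightarrow> real" where
  "rio_kernel n a Q = (if n < a * Q then min Q n else a * Q\<^sup>2 / n)"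

text \<open>The logarithm arises as the number of dyadic scales between \<open>Q\<close> and \<open>a * Q\<close>; the scales below
  \<open>Q\<close> and above \<open>a * Q\<close> form geometric sums.\<close>
lemma sum_rio_kernel_le:
  assumes Q: "Q > 0" and a: "a \<ge> 1" and m: "m \<ge> 1"
  shows "(\<Sum>k<K. rio_kernel (m * 2 ^ k) a Q) \<le> m * (Q * (5 + log 2 a))"
proof -
  define y where "y = a * Q / m"
  have y: "y > 0" using assms by (simp add: y_def)
  have each: "rio_kernel (m * 2 ^ k) a Q \<le> m * (if 2 ^ k < Q then 2 ^ k else 0)
      + m * Q * (if Q \<le> 2 ^ k \<and> 2 ^ k < a * Q then 1 else 0) + Q * y * (if y \<le> 2 ^ k then 1 / 2 ^ k else 0)" for k
  proof (cases "m * 2 ^ k < a * Q")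
    case True
    have le: "(2::real) ^ k < a * Q"
    proof -
      have "1 * (2::real) ^ k \<le> m * 2 ^ k" using m by (intro mult_right_mono) auto
      then show ?thesis using True by linarith
    qed
    have "min Q (m * 2 ^ k) \<le> m * (if 2 ^ k < Q then 2 ^ k else 0) + m * Q * (if Q \<le> 2 ^ k \<and> 2 ^ k < a * Q then 1 else 0)"
      using m Q le by (auto simp: min_le_iff_disj mult_le_cancel_right1)
    moreover have "0 \<le> Q * y * (if y \<le> 2 ^ k then 1 / 2 ^ k else 0)" using Q y by simp
    ultimately show ?thesis using True by (simp add: rio_kernel_def)
  next
    case False
    then have "y \<le> 2 ^ k" using m by (simp add: y_def divide_le_eq mult.commute)
    then have "a * Q\<^sup>2 / (m * 2 ^ k) = Q * y * (if y \<le> 2 ^ k then 1 / 2 ^ k else 0)"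
      by (simp add: y_def power2_eq_square)
    then show ?thesis using False m Q by (simp add: rio_kernel_def)
  qed
  have "(\<Sum>k<K. rio_kernel (m * 2 ^ k) a Q) \<le> m * (\<Sum>k<K. if 2 ^ k < Q then 2 ^ k else 0)
      + m * Q * (\<Sum>k<K. if Q \<le> 2 ^ k \<and> 2 ^ k < a * Q then 1 else 0) + Q * y * (\<Sum>k<K. if y \<le> 2 ^ k then 1 / 2 ^ k else 0)"
    unfolding sum_distrib_left sum.distrib[symmetric] by (intro sum_mono each)
  also have "\<dots> \<le> m * (2 / (2 - 1) * Q) + m * Q * (1 + log 2 a) + Q * y * (2 / (2 - 1) / y)"
    using Q y a m by (intro add_mono mult_left_mono sum_powers_below sum_powers_above count_powers_between) auto
  also have "\<dots> = m * Q * 2 + m * Q * (1 + log 2 a) + 1 * Q * 2" using y by simp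
  also have "\<dots> \<le> m * Q * 2 + m * Q * (1 + log 2 a) + m * Q * 2"
    using m Q by (intro add_left_mono mult_right_mono) auto
  finally show ?thesis by (simp add: algebra_simps)
qed

context prob_space
begin

lemma nn_integral_le_quantile:
  fixes Y :: "'a \<Rightarrow> real" and QY :: "real \<Rightarrow> real"
  assumes [measurable]: "Y \<in> borel_measurable M" and nonneg: "\<And>w. 0 \<le> Y w"
    and [measurable]: "QY \<in> borel_measurable borel"
    and QY: "\<And>s u. 0 \<le> s \<Longrightarrow> 0 < u \<Longrightarrow> u < 1 \<Longrightarrow> u < \<P>(w in M. s < Y w) \<Longrightarrow> s < QY u"
  shows "(\<integral>\<^sup>+w. ennreal (Y w) \<partial>M) \<le> (\<integral>\<^sup>+u \<in> {0<..<1}. ennreal (QY u) \<partial>lborel)"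
proof -
  have "(\<integral>\<^sup>+w. ennreal (Y w * 1) \<partial>M)
    \<le> ennreal 0 * (\<integral>\<^sup>+w. ennreal (Y w) \<partial>M) * (\<integral>\<^sup>+w. ennreal 1 \<partial>M)
      + (\<integral>\<^sup>+u \<in> {0<..<1}. ennreal (of_bool (u < 1)) * ennreal (QY u) * ennreal 1 \<partial>lborel)"
  proof (rule nn_integral_mult_le_quantile)
    show "t < 1" if "0 < u" "u < \<P>(w in M. t < 1)" for t u :: real
      using that by (cases "t < 1") auto
  qed (use assms in auto)
  also have "\<dots> = (\<integral>\<^sup>+u \<in> {0<..<1}. ennreal (QY u) \<partial>lborel)"
    by (simp, intro nn_integral_cong) (auto simp: indicator_def)
  finally show ?thesis by simp
qed

end

text \<open>Here \<open>\<F> m\<close> contains the information of the first \<open>m\<close> variables, \<open>Q\<close> is an upper bound for their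
  common quantile function, and \<open>a\<close> is an inverse of the mixing rate \<open>\<alpha>\<close>, increased by \<open>1\<close> to
  account for lag \<open>0\<close>.\<close>
locale dominated_mixing = prob_space M
  for M :: "'a measure" +
  fixes Z :: "nat \<Rightarrow> 'a \<Rightarrow> real" and \<F> :: "nat \<Rightarrow> 'a measure" and Q a :: "real \<Rightarrow> real"
    and \<alpha> :: "nat \<Rightarrow> real" and \<mu> :: real and D :: "real measure"
  assumes \<mu>: "0 \<le> \<mu>"
    and \<F>: "\<And>m. space (\<F> m) = space M" "\<And>m. sets (\<F> m) \<subseteq> events"
    and adapted: "\<And>i m. 1 \<le> i \<Longrightarrow> i \<le> m \<Longrightarrow> Z i \<in> borel_measurable (\<F> m)"
    and Z_nonneg: "\<And>i w. 0 \<le> Z i w"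
    and D: "\<And>i. 1 \<le> i \<Longrightarrow> distr M borel (Z i) = D"
    and mean: "(\<integral>\<^sup>+w. ennreal (Z 1 w) \<partial>M) \<le> ennreal \<mu>"
    and \<alpha>: "\<And>j. 0 \<le> \<alpha> j"
    and mix: "\<And>m j A t. 1 \<le> m \<Longrightarrow> 1 \<le> j \<Longrightarrow> A \<in> sets (\<F> m) \<Longrightarrow>
      prob (A \<inter> {w \<in> space M. t < Z (m + j) w}) \<le> prob A * \<P>(w in M. t < Z (m + j) w) + \<alpha> j"
    and Q[measurable]: "Q \<in> borel_measurable borel" and Q1: "\<And>u. 1 \<le> Q u"
    and Q_mono: "\<And>u v. 0 < u \<Longrightarrow> u \<le> v \<Longrightarrow> v < 1 \<Longrightarrow> Q v \<le> Q u"
    and tail: "\<And>i t u. 1 \<le> i \<Longrightarrow> 0 \<le> t \<Longrightarrow> 0 < u \<Longrightarrow> u < 1 \<Longrightarrow> u < \<P>(w in M. t < Z i w) \<Longrightarrow> t < Q u"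
    and a[measurable]: "a \<in> borel_measurable borel" and a1: "\<And>u. 1 \<le> a u"
    and a_mono: "\<And>u v. 0 < u \<Longrightarrow> u \<le> v \<Longrightarrow> v < 1 \<Longrightarrow> a v \<le> a u"
    and a_\<alpha>: "\<And>u j. 0 < u \<Longrightarrow> u < 1 \<Longrightarrow> 1 \<le> j \<Longrightarrow> u < \<alpha> j \<Longrightarrow> real j + 1 \<le> a u"
begin

lemma Z_meas [measurable]: "1 \<le> i \<Longrightarrow> Z i \<in> borel_measurable M"
  using measurable_subalgebra_imp[OF adapted[of i i]] \<F> by simp

text \<open>The sum is split into three parts: some variable exceeds \<open>n\<close>; the parts of the variables between
  the levels \<open>T\<close> and \<open>n\<close>, controlled by Markov's inequality; and the variables truncated at \<open>T\<close>,
  controlled by \<open>mixing_deviation_bounded\<close>.  The level \<open>T\<close> and the lag \<open>q\<close> are the largest values of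
  \<open>Q\<close> and \<open>a\<close> on the set \<open>S\<close> where \<open>a * Q \<le> n\<close>.  By monotonicity their product is still at
  most \<open>n\<close>, and \<open>\<alpha> q\<close> lies to the left of \<open>S\<close>.\<close>
lemma mixing_deviation_bound:
  fixes n :: nat and e :: real
  assumes n: "n \<ge> 1" and e: "e > 0"
  shows "emeasure M {w \<in> space M. n * (\<mu> + 2 * e) \<le> (\<Sum>i=1..n. Z i w)}
    \<le> ennreal (1 + 3 / e + 2 / e\<^sup>2) * (\<integral>\<^sup>+u \<in> {0<..<1}. ennreal (rio_kernel n (a u) (Q u)) \<partial>lborel)"
proof -
  have n0: "0 < real n" using n by simp
  define S where "S = {u \<in> {0<..<1}. a u * Q u \<le> n}"
  \<comment> \<open>The inserted elements provide the default values \<open>T = 0\<close> and \<open>q = 1\<close> when \<open>S\<close> is empty.\<close>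
  define T where "T = Sup (insert 0 (Q ` S))"
  define r where "r = Sup (insert 1 (a ` S))"
  define q where "q = nat \<lfloor>r\<rfloor>"
  have Q_le_n: "Q u \<le> n" and a_le_n: "a u \<le> n" if "u \<in> S" for u
  proof -
    have "1 * Q u \<le> a u * Q u" using a1[of u] Q1[of u] by (intro mult_right_mono) auto
    moreover have "a u * 1 \<le> a u * Q u" using a1[of u] Q1[of u] by (intro mult_left_mono) auto
    ultimately show "Q u \<le> n" "a u \<le> n" using that by (auto simp: S_def)
  qed
  have bdd: "bdd_above (insert 0 (Q ` S))" "bdd_above (insert 1 (a ` S))"
    using Q_le_n a_le_n by (auto intro!: bdd_aboveI[of _ "real n"])
  have T_ge: "Q u \<le> T" if "u \<in> S" for u
    unfolding T_def using bdd that by (auto intro: cSup_upper)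
  have T0: "0 \<le> T" unfolding T_def using bdd by (auto intro: cSup_upper)
  have T_le_n: "T \<le> n" unfolding T_def using Q_le_n by (intro cSup_least) auto
  have r1: "1 \<le> r" and r_ge: "\<And>u. u \<in> S \<Longrightarrow> a u \<le> r"
    unfolding r_def using bdd by (auto intro: cSup_upper)
  have q: "1 \<le> q" "real q \<le> r" "r < real q + 1"
    using r1 by (auto simp: q_def le_nat_iff le_floor_iff of_nat_nat)
  have rT: "r * T \<le> n"
  proof -
    have 1: "Q u * a v \<le> n" if "u \<in> S" "v \<in> S" for u v
    proof (cases "u \<le> v")
      case True
      have "Q u * a v \<le> Q u * a u"
        using that True Q1[of u] by (intro mult_left_mono a_mono) (auto simp: S_def)
      then show ?thesis using that by (simp add: S_def mult.commute)
    next
      case False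
      have "Q u * a v \<le> Q v * a v"
        using that False a1[of v] by (intro mult_right_mono Q_mono) (auto simp: S_def)
      then show ?thesis using that by (simp add: S_def mult.commute)
    qed
    have "Q u \<le> n / r" if u: "u \<in> S" for u
    proof -
      have "r \<le> n / Q u"
        unfolding r_def using 1[OF u] Q_le_n[OF u] Q1[of u]
        by (intro cSup_least) (auto simp: le_divide_eq mult.commute)
      then show ?thesis using r1 Q1[of u] by (simp add: le_divide_eq mult.commute)
    qed
    then have "T \<le> n / r" unfolding T_def using r1 by (intro cSup_least) auto
    then show ?thesis using r1 by (simp add: le_divide_eq mult.commute)
  qed
  have T_le_Q: "T \<le> Q u" if u: "0 < u" "u < 1" "u \<notin> S" for u
    unfolding T_def
  proof (rule cSup_least)
    fix x assume "x \<in> insert 0 (Q ` S)"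
    then consider "x = 0" | v where "v \<in> S" "x = Q v" by auto
    then show "x \<le> Q u"
    proof cases
      case 1 then show ?thesis using Q1[of u] by simp
    next
      case 2
      have "u \<le> v"
      proof (rule ccontr)
        assume "\<not> u \<le> v"
        then have "a u * Q u \<le> a v * Q v"
          using u 2(1) Q1[of u] a1[of v] by (intro mult_mono a_mono Q_mono) (auto simp: S_def)
        then show False using u 2(1) by (auto simp: S_def)
      qed
      then show ?thesis using 2 u Q_mono[of u v] by (auto simp: S_def)
    qed
  qed simp
  have far_S: "u \<notin> S" if "0 < u" "u < 1" "u < \<alpha> q" for u
    using a_\<alpha>[of u q] that q r_ge[of u] by fastforce

  define count where "count = (\<lambda>u. 1 + (\<Sum>j=1..<q. of_bool (u < \<alpha> j)) :: real)"
  have count_q: "count u \<le> q" for u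
  proof -
    have "(\<Sum>j=1..<q. of_bool (u < \<alpha> j) :: real) \<le> (\<Sum>j=1..<q. 1)"
      by (intro sum_mono) auto
    then show ?thesis using q(1) by (simp add: count_def of_nat_diff)
  qed
  have count_a: "count u \<le> a u" if u: "0 < u" "u < 1" for u
  proof -
    have "(\<Sum>j=1..<q. of_bool (u < \<alpha> j) :: real) = card ({1..<q} \<inter> {j. u < \<alpha> j})"
      by simp
    also have "\<dots> \<le> card {1..nat \<lfloor>a u - 1\<rfloor>}"
    proof (intro of_nat_mono card_mono)
      show "{1..<q} \<inter> {j. u < \<alpha> j} \<subseteq> {1..nat \<lfloor>a u - 1\<rfloor>}"
      proof
        fix j assume j: "j \<in> {1..<q} \<inter> {j. u < \<alpha> j}"
        then have "int j \<le> \<lfloor>a u - 1\<rfloor>"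
          by (subst le_floor_iff) (use a_\<alpha>[OF u, of j] j in auto)
        then show "j \<in> {1..nat \<lfloor>a u - 1\<rfloor>}" using j by auto
      qed
    qed simp
    also have "\<dots> \<le> a u - 1" using a1[of u] by simp
    finally show ?thesis by (simp add: count_def)
  qed

  define QT where "QT = (\<lambda>u. min (Q u) T)"
  have [measurable]: "QT \<in> borel_measurable borel" unfolding QT_def by measurable
  have [measurable]: "count \<in> borel_measurable borel" unfolding count_def by measurable
  let ?mid = "\<lambda>u. max 0 (min (Q u) n - T)"
  let ?low = "\<lambda>u. count u * (QT u)\<^sup>2 / (n * e) + of_bool (u < \<alpha> q) * QT u"
  let ?C = "1 + 3 / e + 2 / e\<^sup>2"
  define I where "I = (\<lambda>f. \<integral>\<^sup>+u \<in> {0<..<1::real}. ennreal (f u) \<partial>lborel)"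

  define E1 where "E1 = (\<Union>i\<in>{1..n}. {w \<in> space M. n < Z i w})"
  have E1: "emeasure M E1 \<le> I (\<lambda>u. n * of_bool (n < Q u))"
  proof -
    have "emeasure M E1 \<le> (\<Sum>i=1..n. emeasure M {w \<in> space M. n < Z i w})"
      unfolding E1_def by (intro emeasure_subadditive_finite) auto
    also have "\<dots> = (\<Sum>i=1..n. emeasure D {real n<..})"
    proof (intro sum.cong refl)
      fix i assume "i \<in> {1..n}"
      then show "emeasure M {w \<in> space M. n < Z i w} = emeasure D {real n<..}"
        by (subst D[of i, symmetric]) (auto simp: emeasure_distr intro!: arg_cong[where f="emeasure M"])
    qed
    also have "\<dots> = ennreal n * emeasure D {real n<..}"
      by (simp add: ennreal_of_nat_eq_real_of_nat)
    also have "\<dots> = ennreal n * emeasure M {w \<in> space M. n < Z 1 w}"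
      by (subst D[of 1, symmetric]) (auto simp: emeasure_distr intro!: arg_cong[where f="\<lambda>A. ennreal n * emeasure M A"])
    also have "\<dots> = (\<integral>\<^sup>+w. ennreal n * indicator {w \<in> space M. n < Z 1 w} w \<partial>M)"
      by (simp add: nn_integral_cmult_indicator)
    also have "\<dots> = (\<integral>\<^sup>+w. ennreal (n * of_bool (n < Z 1 w)) \<partial>M)"
      by (intro nn_integral_cong) (auto simp: indicator_def)
    also have "\<dots> \<le> I (\<lambda>u. n * of_bool (n < Q u))"
      unfolding I_def
    proof (rule nn_integral_le_quantile)
      fix s u :: real assume su: "0 \<le> s" "0 < u" "u < 1" "u < \<P>(w in M. s < n * of_bool (n < Z 1 w))"
      have "s < n"
      proof (rule ccontr)
        assume "\<not> s < n"
        then have "{w \<in> space M. s < n * of_bool (n < Z 1 w)} = {}" using su by auto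
        then show False using su by (metis measure_empty order_less_asym)
      qed
      moreover have "\<P>(w in M. s < n * of_bool (n < Z 1 w)) \<le> \<P>(w in M. n < Z 1 w)"
        using su by (intro finite_measure_mono) auto
      then have "n < Q u" using tail[of 1 n u] su by simp
      ultimately show "s < n * of_bool (n < Q u)" by simp
    qed auto
    finally show ?thesis .
  qed

  define Y where "Y = (\<lambda>i w. min (Z i w) n - min (Z i w) T)"
  have Y_nonneg: "0 \<le> Y i w" for i w using T_le_n by (simp add: Y_def min_def)
  have Y_meas[measurable]: "Y i \<in> borel_measurable M" if "1 \<le> i" for i
    unfolding Y_def using that by measurable
  define E2 where "E2 = {w \<in> space M. n * e \<le> (\<Sum>i=1..n. Y i w)}"
  have E2: "emeasure M E2 \<le> ennreal (1 / e) * I ?mid"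
  proof -
    have Yi: "(\<integral>\<^sup>+w. ennreal (Y i w) \<partial>M) \<le> I ?mid" if i: "1 \<le> i" for i
      unfolding I_def
    proof (rule nn_integral_le_quantile)
      fix s u :: real assume su: "0 \<le> s" "0 < u" "u < 1" "u < \<P>(w in M. s < Y i w)"
      have "T + s < n"
      proof (rule ccontr)
        assume "\<not> T + s < n"
        then have "{w \<in> space M. s < Y i w} = {}" using su by (auto simp: Y_def min_def)
        then show False using su by (metis measure_empty order_less_asym)
      qed
      moreover have "\<P>(w in M. s < Y i w) \<le> \<P>(w in M. T + s < Z i w)"
        using su i by (intro finite_measure_mono) (auto simp: Y_def min_def split: if_splits)
      then have "T + s < Q u" using tail[of i "T + s" u] su T0 i by simp
      ultimately show "s < ?mid u" by simp
    qed (use i Y_nonneg in auto)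
    have "emeasure M E2 \<le> emeasure M ({w \<in> space M. 1 \<le> ennreal (1 / (n * e)) * ennreal (\<Sum>i=1..n. Y i w)} \<inter> space M)"
    proof (intro emeasure_mono subsetI)
      fix w assume "w \<in> E2"
      then have w: "w \<in> space M" "n * e \<le> (\<Sum>i=1..n. Y i w)" by (auto simp: E2_def)
      then have "1 \<le> 1 / (n * e) * (\<Sum>i=1..n. Y i w)" using n0 e by (simp add: le_divide_eq)
      then have "ennreal 1 \<le> ennreal (1 / (n * e) * (\<Sum>i=1..n. Y i w))" by (rule ennreal_leI)
      then show "w \<in> {w \<in> space M. 1 \<le> ennreal (1 / (n * e)) * ennreal (\<Sum>i=1..n. Y i w)} \<inter> space M"
        using w n0 e Y_nonneg by (subst (asm) ennreal_mult) (auto intro!: sum_nonneg)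
    qed measurable
    also have "\<dots> \<le> ennreal (1 / (n * e)) * (\<integral>\<^sup>+w. ennreal (\<Sum>i=1..n. Y i w) * indicator (space M) w \<partial>M)"
      by (rule order_trans[OF _ nn_integral_Markov_inequality]) (auto intro!: emeasure_mono)
    also have "(\<integral>\<^sup>+w. ennreal (\<Sum>i=1..n. Y i w) * indicator (space M) w \<partial>M) = (\<integral>\<^sup>+w. (\<Sum>i=1..n. ennreal (Y i w)) \<partial>M)"
      using Y_nonneg by (intro nn_integral_cong) (simp add: sum_ennreal)
    also have "\<dots> = (\<Sum>i=1..n. \<integral>\<^sup>+w. ennreal (Y i w) \<partial>M)"
      by (intro nn_integral_sum) auto
    also have "\<dots> \<le> (\<Sum>i=1..n. I ?mid)"
      using Yi by (intro sum_mono) auto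
    also have "(\<Sum>i=1..n. I ?mid) = ennreal n * I ?mid"
      by (simp add: ennreal_of_nat_eq_real_of_nat)
    also have "ennreal (1 / (n * e)) * (ennreal n * I ?mid) = ennreal (1 / e) * I ?mid"
      unfolding mult.assoc[symmetric] using n0 e by (subst ennreal_mult[symmetric]) auto
    finally show ?thesis by (simp add: mult_left_mono)
  qed

  define ZT where "ZT = (\<lambda>i w. min (Z i w) T)"
  define \<mu>T where "\<mu>T = expectation (ZT 1)"
  have ZT_bnd: "0 \<le> ZT i w" "ZT i w \<le> T" for i w using Z_nonneg T0 by (auto simp: ZT_def)
  have ZT_mean: "expectation (ZT i) = \<mu>T" if "1 \<le> i" for i
  proof -
    have "expectation (ZT i) = (\<integral>z. min z T \<partial>D)" if "1 \<le> i" for i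
      unfolding ZT_def D[OF that, symmetric] using that by (subst integral_distr) auto
    then show ?thesis using that by (simp add: \<mu>T_def)
  qed
  have \<mu>T: "\<mu>T \<le> \<mu>"
  proof -
    have "ennreal \<mu>T = (\<integral>\<^sup>+w. ennreal (ZT 1 w) \<partial>M)"
      unfolding \<mu>T_def using ZT_bnd
      by (intro nn_integral_eq_integral[symmetric] integrable_const_bound[of _ T]) (auto simp: ZT_def)
    also have "\<dots> \<le> (\<integral>\<^sup>+w. ennreal (Z 1 w) \<partial>M)"
      by (intro nn_integral_mono ennreal_leI) (simp add: ZT_def)
    also note mean
    finally show ?thesis using \<mu> by simp
  qed
  define E3 where "E3 = {w \<in> space M. n * \<mu>T + n * e \<le> (\<Sum>i=1..n. ZT i w)}"
  have "emeasure M E3 \<le> ennreal (2 * n / (n * e)) * I ?low"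
    unfolding E3_def emeasure_eq_measure count_def I_def
  proof (rule mixing_deviation_bounded[where B=T and \<F>=\<F>])
    show "ZT i \<in> borel_measurable (\<F> m)" if "1 \<le> i" "i \<le> m" for i m
      unfolding ZT_def using adapted[OF that] by measurable
    fix m j :: nat and A and t :: real assume mj: "1 \<le> m" "1 \<le> j" "A \<in> sets (\<F> m)"
    show "prob (A \<inter> {w \<in> space M. t < ZT (m + j) w}) \<le> prob A * \<P>(w in M. t < ZT (m + j) w) + \<alpha> j"
      using mix[OF mj, of t] \<alpha>[of j] by (cases "t < T") (simp_all add: ZT_def)
  next
    fix i :: nat and t u :: real
    assume *: "1 \<le> i" "0 \<le> t" "0 < u" "u < 1" "u < \<P>(w in M. t < ZT i w)"
    then have "t < T" by (cases "t < T") (simp_all add: ZT_def)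
    then show "t < QT u" using tail[of i t u] * by (simp add: ZT_def QT_def)
  qed (use e n0 q ZT_bnd ZT_mean \<F> T0 order_trans[OF zero_le_one Q1] in \<open>auto simp: QT_def\<close>)
  also have "2 * n / (n * e) = 2 / e" using n0 by simp
  finally have E3: "emeasure M E3 \<le> ennreal (2 / e) * I ?low" .

  have sub: "{w \<in> space M. n * (\<mu> + 2 * e) \<le> (\<Sum>i=1..n. Z i w)} \<subseteq> E1 \<union> (E2 \<union> E3)"
  proof
    fix w assume w: "w \<in> {w \<in> space M. n * (\<mu> + 2 * e) \<le> (\<Sum>i=1..n. Z i w)}"
    show "w \<in> E1 \<union> (E2 \<union> E3)"
    proof (rule ccontr)
      assume not: "w \<notin> E1 \<union> (E2 \<union> E3)"
      have "(\<Sum>i=1..n. Z i w) = (\<Sum>i=1..n. Y i w + ZT i w)"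
        using not w by (intro sum.cong) (auto simp: E1_def Y_def ZT_def min_def not_less)
      also have "\<dots> < n * e + (n * \<mu>T + n * e)"
        using not w unfolding sum.distrib by (intro add_strict_mono) (auto simp: E2_def E3_def)
      also have "\<dots> \<le> n * (\<mu> + 2 * e)" using \<mu>T n0 by (simp add: algebra_simps)
      finally show False using w by simp
    qed
  qed
  have [measurable]: "E1 \<in> events" "E2 \<in> events" "E3 \<in> events"
    unfolding E1_def E2_def E3_def ZT_def by (auto intro!: sets.finite_UN borel_measurable_sum measurable_sets)
  have "emeasure M {w \<in> space M. n * (\<mu> + 2 * e) \<le> (\<Sum>i=1..n. Z i w)} \<le> emeasure M E1 + (emeasure M E2 + emeasure M E3)"
    by (rule order_trans[OF emeasure_mono[OF sub] order_trans[OF emeasure_subadditive add_left_mono[OF emeasure_subadditive]]]) auto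
  also have "\<dots> \<le> I (\<lambda>u. n * of_bool (n < Q u)) + (ennreal (1 / e) * I ?mid
      + ennreal (2 / e) * I ?low)"
    by (intro add_mono E1 E2 E3)
  also have "\<dots> = (\<integral>\<^sup>+u \<in> {0<..<1}. ennreal (n * of_bool (n < Q u)) + (ennreal (1 / e) * ennreal (?mid u)
      + ennreal (2 / e) * ennreal (?low u)) \<partial>lborel)"
    unfolding I_def by (simp add: nn_integral_add nn_integral_cmult distrib_right mult.assoc)
  also have "\<dots> \<le> (\<integral>\<^sup>+u. ennreal (?C) * (ennreal (rio_kernel n (a u) (Q u)) * indicator {0<..<1} u) \<partial>lborel)"
  proof (intro nn_integral_mono, goal_cases)
    case (1 u)
    let ?g = "rio_kernel n (a u) (Q u)"
    let ?t = "n * of_bool (n < Q u) + (1 / e * ?mid u + 2 / e * ?low u)"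
    have split: "ennreal (x + (1 / e * y + 2 / e * z)) = ennreal x + (ennreal (1 / e) * ennreal y + ennreal (2 / e) * ennreal z)"
      if "0 \<le> x" "0 \<le> y" "0 \<le> z" for x y z
    proof -
      have "ennreal (x + (a + b)) = ennreal x + (ennreal a + ennreal b)" if "0 \<le> a" "0 \<le> b" for a b
        using that \<open>0 \<le> x\<close> by simp
      moreover have "ennreal (c * y) = ennreal c * ennreal y" "ennreal (c * z) = ennreal c * ennreal z" if "0 \<le> c" for c
        using that \<open>0 \<le> y\<close> \<open>0 \<le> z\<close> by (simp_all add: ennreal_mult)
      ultimately show ?thesis
        using e that by (metis divide_nonneg_nonneg less_imp_le mult_nonneg_nonneg zero_le_numeral zero_le_one)
    qed
    have count0: "0 \<le> count u" by (auto simp: count_def intro!: add_nonneg_nonneg sum_nonneg)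
    have QT0: "0 \<le> QT u" using Q1[of u] T0 by (simp add: QT_def)
    have "?t \<le> (?C) * ?g" if u: "0 < u" "u < 1"
    proof (cases "u \<in> S")
      case True
      have g: "?g = a u * (Q u)\<^sup>2 / n" using True by (simp add: rio_kernel_def S_def)
      have g0: "0 \<le> ?g" unfolding g using a1[of u] n0 by simp
      have "count u * (QT u)\<^sup>2 \<le> a u * (Q u)\<^sup>2"
        using count_a[OF u] QT0 a1[of u] by (intro mult_mono power_mono) (auto simp: QT_def)
      then have "count u * (QT u)\<^sup>2 / (n * e) \<le> ?g / e"
        unfolding g using n0 e by (simp add: divide_right_mono)
      then have "2 / e * (count u * (QT u)\<^sup>2 / (n * e)) \<le> 2 / e * (?g / e)"
        using e by (intro mult_left_mono) auto
      moreover have "2 / e * (?g / e) = 2 / e\<^sup>2 * ?g" by (simp add: power2_eq_square)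
      moreover have "?t = 2 / e * (count u * (QT u)\<^sup>2 / (n * e))"
        using far_S[OF u] True Q_le_n[OF True] T_ge[OF True] by auto
      moreover have "2 / e\<^sup>2 * ?g \<le> (?C) * ?g"
        using e g0 by (intro mult_right_mono) auto
      ultimately show ?thesis by linarith
    next
      case False
      have g: "?g = min (Q u) n" using False u by (simp add: rio_kernel_def S_def not_le)
      have Tg: "T \<le> ?g" unfolding g using T_le_Q[OF u False] T_le_n by simp
      have "n * of_bool (n < Q u) \<le> ?g" unfolding g using Q1[of u] by (auto simp: min_def)
      moreover have "1 / e * ?mid u \<le> 1 / e * ?g"
        unfolding g[symmetric] using e T0 Tg by (intro mult_left_mono) auto
      moreover have "2 / e * ?low u \<le> 2 / e * (?g / e + ?g)"
      proof (intro mult_left_mono add_mono)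
        have "count u * (QT u)\<^sup>2 \<le> r * T\<^sup>2"
          using count_q[of u] q r1 QT0 by (intro mult_mono power_mono) (auto simp: QT_def)
        also have "\<dots> \<le> n * T"
          using rT T0 mult_right_mono[OF rT T0] by (simp add: power2_eq_square mult.assoc)
        also have "\<dots> \<le> n * ?g" using Tg n0 by simp
        finally have "count u * (QT u)\<^sup>2 / (n * e) \<le> n * ?g / (n * e)"
          using n0 e by (intro divide_right_mono) auto
        then show "count u * (QT u)\<^sup>2 / (n * e) \<le> ?g / e" using n0 by simp
        show "of_bool (u < \<alpha> q) * QT u \<le> ?g"
          using Tg T0 by (auto simp: QT_def)
      qed (use e in simp)
      moreover have "?g + (1 / e * ?g + 2 / e * (?g / e + ?g)) = (?C) * ?g"
        using e by (simp add: power2_eq_square field_simps)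
      ultimately show ?thesis by linarith
    qed
    then have "ennreal ?t \<le> ennreal ((?C) * ?g)" if "0 < u" "u < 1"
      using that by (intro ennreal_leI) auto
    moreover have "ennreal ((?C) * ?g) = ennreal (?C) * ennreal ?g"
      using e a1[of u] Q1[of u] n0 by (intro ennreal_mult) (auto simp: rio_kernel_def)
    moreover have "ennreal ?t = ennreal (n * of_bool (n < Q u)) + (ennreal (1 / e) * ennreal (?mid u)
      + ennreal (2 / e) * ennreal (?low u))"
      using e n0 count0 QT0 by (intro split) auto
    ultimately show ?case
      by (cases "u \<in> {0<..<1}") auto
  qed
  also have "\<dots> = ennreal (?C) * (\<integral>\<^sup>+u \<in> {0<..<1}. ennreal (rio_kernel n (a u) (Q u)) \<partial>lborel)"
    unfolding rio_kernel_def by (intro nn_integral_cmult) measurable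
  finally show ?thesis .
qed

end

section \<open>A one-sided strong law under mixing\<close>

text \<open>Monotone sequences need to be controlled only along the indices \<open>m * 2 ^ k\<close>: with \<open>m\<close> between
  \<open>J\<close> and \<open>2 * J\<close>, consecutive indices have ratio at most \<open>1 + 1 / J\<close>.  Unlike a geometric sequence
  with ratio close to \<open>1\<close>, these indices are integers and give sums over \<open>k\<close> of the same kind for
  every fixed \<open>m\<close>.\<close>
lemma eventually_le_if_blocks:
  fixes T :: "nat \<Rightarrow> real" and \<mu> d :: real
  assumes mono: "\<And>m n. m \<le> n \<Longrightarrow> T m \<le> T n" and \<mu>: "0 \<le> \<mu>"
    and blocks: "\<And>j m. m \<ge> 1 \<Longrightarrow>
      \<forall>\<^sub>F k in sequentially. T (m * 2 ^ k) < real (m * 2 ^ k) * (\<mu> + 2 * (1 / real (Suc j)))"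
    and d: "d > 0"
  shows "\<forall>\<^sub>F n in sequentially. T n \<le> n * (\<mu> + d)"
proof -
  obtain j where j: "1 / real (Suc j) < d / 4"
    using nat_approx_posE[of "d / 4"] d by auto
  define e where "e = 1 / real (Suc j)"
  have e: "0 < e" "2 * e < d / 2" using j by (auto simp: e_def)
  obtain J where J: "2 * (\<mu> + 2 * e) / d < real J"
    using reals_Archimedean2 by blast
  moreover have "0 < 2 * (\<mu> + 2 * e) / d" using \<mu> e d by simp
  ultimately have J1: "J \<ge> 1" by (cases J) auto
  have "\<forall>\<^sub>F k in sequentially. \<forall>m\<in>{1..2 * J}. T (m * 2 ^ k) < real (m * 2 ^ k) * (\<mu> + 2 * e)"
    unfolding e_def by (intro eventually_ball_finite ballI blocks) auto
  then obtain K where K: "\<And>k m. k \<ge> K \<Longrightarrow> m \<in> {1..2 * J} \<Longrightarrow> T (m * 2 ^ k) < real (m * 2 ^ k) * (\<mu> + 2 * e)"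
    unfolding eventually_sequentially by blast
  have "T n \<le> n * (\<mu> + d)" if n: "n \<ge> J * 2 ^ K" for n
  proof -
    have ge: "2 ^ K \<le> n div J"
      using n J1 by (simp add: less_eq_div_iff_mult_less_eq mult.commute)
    then have "1 \<le> n div J" by (meson le_trans one_le_numeral one_le_power)
    then obtain k where k: "2 ^ k \<le> n div J" "n div J < 2 ^ (k + 1)"
      using ex_power_ivl1[of 2 "n div J"] by auto
    have "(2::nat) ^ K < 2 ^ (k + 1)" using ge k by linarith
    then have "K < k + 1" by (rule power_less_imp_less_exp[rotated]) simp
    define m where "m = n div 2 ^ k"
    have "J * 2 ^ k \<le> n" using k(1) J1 by (simp add: less_eq_div_iff_mult_less_eq mult.commute)
    then have m: "J \<le> m" unfolding m_def by (simp add: less_eq_div_iff_mult_less_eq)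
    have "n < J * 2 ^ (k + 1)" using k(2) J1 by (simp add: div_less_iff_less_mult mult.commute)
    then have m2: "m < 2 * J" unfolding m_def by (simp add: div_less_iff_less_mult mult_ac)
    have nm: "m * 2 ^ k \<le> n" "n < (m + 1) * 2 ^ k"
      unfolding m_def by (simp_all add: dividend_less_times_div less_imp_le mult.commute)
    have "T n \<le> T ((m + 1) * 2 ^ k)" using nm by (intro mono) simp
    also have "\<dots> \<le> real ((m + 1) * 2 ^ k) * (\<mu> + 2 * e)"
      using K[of k "m + 1"] \<open>K < k + 1\<close> m2 by (intro less_imp_le) auto
    also have "real ((m + 1) * 2 ^ k) = real (m * 2 ^ k) * (1 + 1 / m)"
      using m J1 by (simp add: field_simps)
    also have "\<dots> \<le> n * (1 + 1 / J)"
    proof (intro mult_mono)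
      show "real (m * 2 ^ k) \<le> n" using nm(1) by (rule of_nat_mono)
      show "1 + 1 / real m \<le> 1 + 1 / real J" using m J1 by (simp add: frac_le)
    qed auto
    finally have "T n \<le> n * (1 + 1 / J) * (\<mu> + 2 * e)"
      using \<mu> e by (simp add: mult_right_mono)
    also have "\<dots> = n * ((\<mu> + 2 * e) + (\<mu> + 2 * e) / J)" by (simp add: field_simps)
    also have "\<dots> \<le> n * (\<mu> + d)"
    proof (intro mult_left_mono)
      have "(\<mu> + 2 * e) / J \<le> d / 2"
        using J J1 d by (simp add: field_simps)
      then show "(\<mu> + 2 * e) + (\<mu> + 2 * e) / J \<le> \<mu> + d" using e by linarith
    qed simp
    finally show ?thesis .
  qed
  then show ?thesis by (auto simp: eventually_sequentially)
qed

context dominated_mixing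
begin

text \<open>The probabilities in \<open>mixing_deviation_bound\<close> are summable along \<open>n = m * 2 ^ k\<close> by
  \<open>sum_rio_kernel_le\<close>, and the partial sums are nondecreasing.  A two-sided law is obtained for bounded
  functions by passing to the complement.\<close>
lemma mixing_strong_law_upper:
  assumes fin: "(\<integral>\<^sup>+u \<in> {0<..<1}. ennreal (Q u * (5 + log 2 (a u))) \<partial>lborel) < \<infinity>"
  shows "AE w in M. \<forall>d>0. \<forall>\<^sub>F n in sequentially. (\<Sum>i=1..n. Z i w) \<le> n * (\<mu> + d)"
proof -
  let ?T = "\<lambda>n w. \<Sum>i=1..n. Z i w"
  have block: "AE w in M. \<forall>\<^sub>F k in sequentially. ?T (m * 2 ^ k) w < real (m * 2 ^ k) * (\<mu> + 2 * e)"
    if m: "m \<ge> 1" and e: "e > 0" for m :: nat and e :: real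
  proof -
    define E where "E = (\<lambda>k. {w \<in> space M. real (m * 2 ^ k) * (\<mu> + 2 * e) \<le> ?T (m * 2 ^ k) w})"
    have [measurable]: "E k \<in> events" for k unfolding E_def by measurable
    define g where "g = (\<lambda>k u. ennreal (rio_kernel (m * 2 ^ k) (a u) (Q u)))"
    have [measurable]: "g k \<in> borel_measurable borel" for k
      unfolding g_def rio_kernel_def by measurable
    have g0: "0 \<le> rio_kernel (m * 2 ^ k) (a u) (Q u)" for k u
      using a1[of u] Q1[of u] m by (auto simp: rio_kernel_def)
    let ?C = "ennreal (1 + 3 / e + 2 / e\<^sup>2)"
    have E: "(\<integral>\<^sup>+w. indicator (E k) w \<partial>M) \<le> ?C * (\<integral>\<^sup>+u. g k u * indicator {0<..<1} u \<partial>lborel)" for k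
    proof -
      have "emeasure M (E k) \<le> ?C * (\<integral>\<^sup>+u. g k u * indicator {0<..<1} u \<partial>lborel)"
        unfolding E_def g_def using m
        by (intro order_trans[OF mixing_deviation_bound[OF _ e]]) auto
      then show ?thesis by simp
    qed
    have "(\<Sum>k. \<integral>\<^sup>+w. indicator (E k) w \<partial>M) \<le> (\<Sum>k. ?C * (\<integral>\<^sup>+u. g k u * indicator {0<..<1} u \<partial>lborel))"
      by (intro suminf_le E) auto
    also have "\<dots> = ?C * (\<integral>\<^sup>+u. (\<Sum>k. g k u * indicator {0<..<1} u) \<partial>lborel)"
      by (subst nn_integral_suminf) auto
    also have "(\<integral>\<^sup>+u. (\<Sum>k. g k u * indicator {0<..<1} u) \<partial>lborel)
        \<le> (\<integral>\<^sup>+u. ennreal m * (ennreal (Q u * (5 + log 2 (a u))) * indicator {0<..<1} u) \<partial>lborel)"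
    proof (intro nn_integral_mono)
      fix u :: real
      have "(\<Sum>k. g k u) \<le> ennreal (m * (Q u * (5 + log 2 (a u))))"
        unfolding g_def
      proof (intro suminf_ennreal_le g0)
        show "(\<Sum>k<K. rio_kernel (m * 2 ^ k) (a u) (Q u)) \<le> m * (Q u * (5 + log 2 (a u)))" for K
          using sum_rio_kernel_le[of "Q u" "a u" "real m" K] Q1[of u] a1[of u] m by simp
      qed
      then show "(\<Sum>k. g k u * indicator {0<..<1} u) \<le> ennreal m * (ennreal (Q u * (5 + log 2 (a u))) * indicator {0<..<1} u)"
        using Q1[of u] a1[of u] by (auto simp: indicator_def ennreal_mult)
    qed
    also have "\<dots> = ennreal m * (\<integral>\<^sup>+u \<in> {0<..<1}. ennreal (Q u * (5 + log 2 (a u))) \<partial>lborel)"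
      by (intro nn_integral_cmult) measurable
    finally have "(\<Sum>k. \<integral>\<^sup>+w. indicator (E k) w \<partial>M) \<le> ?C * (ennreal m * (\<integral>\<^sup>+u \<in> {0<..<1}. ennreal (Q u * (5 + log 2 (a u))) \<partial>lborel))"
      by (simp add: mult_left_mono)
    also have "\<dots> < \<infinity>"
      using fin by (simp add: ennreal_mult_less_top)
    finally have "AE w in M. (\<lambda>k. indicator (E k) w :: ennreal) \<longlonglongrightarrow> 0"
      by (intro AE_tendsto_0_if_summable_integrals) auto
    then show ?thesis
      using AE_space
    proof eventually_elim
      case (elim w)
      have "\<forall>\<^sub>F k in sequentially. (indicator (E k) w :: ennreal) < 1"
        by (rule order_tendstoD(2)[OF elim(1)]) simp
      then show ?case
      proof eventually_elim
        fix k assume "(indicator (E k) w :: ennreal) < 1"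
        then have "w \<notin> E k" by (cases "w \<in> E k") auto
        then show "?T (m * 2 ^ k) w < real (m * 2 ^ k) * (\<mu> + 2 * e)"
          using elim(2) by (auto simp: E_def)
      qed
    qed
  qed
  have "AE w in M. \<forall>j m. m \<ge> 1 \<longrightarrow>
    (\<forall>\<^sub>F k in sequentially. ?T (m * 2 ^ k) w < real (m * 2 ^ k) * (\<mu> + 2 * (1 / real (Suc j))))"
    unfolding AE_all_countable by (intro allI AE_impI block) auto
  then show ?thesis
  proof eventually_elim
    case (elim w)
    show ?case
    proof (intro allI impI eventually_le_if_blocks[of "\<lambda>n. ?T n w"] \<mu>)
      show "?T n w \<le> ?T n' w" if "n \<le> n'" for n n'
        using that Z_nonneg by (intro sum_mono2) auto
    qed (use elim in auto)
  qed
qed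

end

section \<open>The weighted empirical process of a mixing sequence\<close>

lemma interval_measure_cdf:
  assumes "real_distribution D"
  shows "interval_measure (cdf D) = D"
proof (rule cdf_unique)
  interpret real_distribution D by fact
  show "real_distribution (interval_measure (cdf D))"
    by (intro real_distribution_interval_measure cdf_nondecreasing cdf_is_right_cont cdf_lim_at_bot cdf_lim_at_top_prob)
  show "cdf (interval_measure (cdf D)) = cdf D"
    by (intro cdf_interval_measure cdf_nondecreasing cdf_is_right_cont cdf_lim_at_bot)
qed fact

lemma right_inverse_upper:
  assumes "bdd_above {x. 0 \<le> x \<and> h x > y}" "0 \<le> x" "h x > y"
  shows "x \<le> right_inverse h y"
  using assms by (auto simp: right_inverse_def intro!: cSup_upper)

lemma right_inverse_nonneg:
  assumes "bdd_above {x. 0 \<le> x \<and> h x > y}"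
  shows "0 \<le> right_inverse h y"
proof (cases "{x. 0 \<le> x \<and> h x > y} = {}")
  case False
  then obtain x where "0 \<le> x" "h x > y" by blast
  then show ?thesis using right_inverse_upper[OF assms, of x] by simp
qed (simp add: right_inverse_def)

lemma right_inverse_antimono:
  assumes "bdd_above {x. 0 \<le> x \<and> h x > y}" "y \<le> z"
  shows "right_inverse h z \<le> right_inverse h y"
proof (cases "{x. 0 \<le> x \<and> h x > z} = {}")
  case True
  then show ?thesis using right_inverse_nonneg[OF assms(1)] by (simp add: right_inverse_def)
next
  case False
  moreover have "{x. 0 \<le> x \<and> h x > z} \<subseteq> {x. 0 \<le> x \<and> h x > y}" using assms(2) by auto
  ultimately show ?thesis
    unfolding right_inverse_def using cSup_subset_mono[OF False assms(1)] by auto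
qed

lemma less_right_inverse_imp:
  assumes "t < right_inverse h y" "0 \<le> t" "\<And>s t. s \<le> t \<Longrightarrow> h t \<le> h s"
  shows "y < h t"
proof -
  have ne: "{x. 0 \<le> x \<and> h x > y} \<noteq> {}" using assms(1,2) by (auto simp: right_inverse_def split: if_splits)
  then have "t < Sup {x. 0 \<le> x \<and> h x > y}" using assms(1) by (auto simp: right_inverse_def split: if_splits)
  then obtain x where "t < x" "y < h x" using less_cSupD[OF ne] by blast
  then show ?thesis using assms(3)[of t x] by simp
qed

lemma borel_measurable_antimono_on_unit:
  fixes f :: "real \<Rightarrow> real"
  assumes "\<And>u v. 0 < u \<Longrightarrow> u \<le> v \<Longrightarrow> v < 1 \<Longrightarrow> f v \<le> f u"
  shows "(\<lambda>u. if u \<in> {0<..<1} then f u else c) \<in> borel_measurable borel"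
proof -
  have "(\<lambda>u. - f u) \<in> borel_measurable (restrict_space borel {0<..<1})"
    by (intro borel_measurable_mono_on_fnc) (auto simp: mono_on_def intro: assms)
  then have "f \<in> borel_measurable (restrict_space borel {0<..<1})"
    by simp
  then show ?thesis
    by (subst (asm) measurable_restrict_space_iff[where c=c]) auto
qed

context prob_space
begin

lemma mixing_coeff_upper:
  assumes "k \<ge> 1" "A \<in> sigma_gen_by M X {1..k}" "B \<in> sigma_gen_by M X {k + n..}"
  shows "\<bar>prob (A \<inter> B) - prob A * prob B\<bar> \<le> mixing_coeff M X n"
proof -
  define f where "f = (\<lambda>(A, B). \<bar>prob (A \<inter> B) - prob A * prob B\<bar>)"
  define G where "G = (\<lambda>k. sigma_gen_by M X {1..k} \<times> sigma_gen_by M X {k + n..})"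
  have f1: "f x \<le> 1" for x
  proof -
    have "\<bar>p - q * r\<bar> \<le> 1" if "0 \<le> p" "p \<le> 1" "0 \<le> q" "q \<le> 1" "0 \<le> r" "r \<le> 1" for p q r :: real
    proof -
      have "0 \<le> q * r" "q * r \<le> 1" using that by (auto intro: mult_le_one)
      then show ?thesis using that by linarith
    qed
    then show ?thesis by (auto simp: f_def split: prod.split)
  qed
  have ne: "G k \<noteq> {}" for k unfolding G_def sigma_gen_by_def by (auto intro: sigma_sets.Empty)
  have bdd: "bdd_above (f ` G k)" for k using f1 by (auto intro!: bdd_aboveI[of _ 1])
  have sup1: "(SUP x\<in>G k. f x) \<le> 1" for k using ne f1 by (intro cSUP_least) auto
  have "f (A, B) \<le> (SUP x\<in>G k. f x)"
    using bdd assms by (intro cSUP_upper) (auto simp: G_def)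
  also have "\<dots> \<le> (SUP k\<in>{1..}. SUP x\<in>G k. f x)"
    using assms sup1 by (intro cSUP_upper bdd_aboveI[of _ 1]) auto
  finally show ?thesis by (simp add: mixing_coeff_def f_def G_def)
qed

lemma mixing_coeff_nonneg: "0 \<le> mixing_coeff M X n"
  using mixing_coeff_upper[of 1 "{}" X "{}" n] by (simp add: sigma_gen_by_def sigma_sets.Empty)

text \<open>The strong law is applied to \<open>\<phi>\<close>, to \<open>W x\<close> and to \<open>1 - W x\<close>, always with the quantile function
  of \<open>\<phi>(X 1)\<close>.  The first application dominates the integrand by a constant depending on the sample
  point, the other two give its pointwise limit.\<close>
lemma mixing_weighted_empirical_limit:
  fixes X :: "nat \<Rightarrow> 'a \<Rightarrow> real" and W :: "real \<Rightarrow> real \<Rightarrow> real" and \<phi> :: "real \<Rightarrow> real"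
    and D \<nu> :: "real measure"
  assumes X: "\<And>i. i \<ge> 1 \<Longrightarrow> X i \<in> borel_measurable M"
    and D: "\<And>i. i \<ge> 1 \<Longrightarrow> distr M borel (X i) = D"
    and \<nu>: "finite_measure \<nu>" and sets_\<nu>[measurable_cong]: "sets \<nu> = sets borel"
    and W[measurable]: "case_prod W \<in> borel_measurable (borel \<Otimes>\<^sub>M borel)"
    and W01: "\<And>x y. W x y \<in> {0, 1}"
    and \<phi>[measurable]: "\<phi> \<in> borel_measurable borel" and \<phi>1: "\<And>x. 1 \<le> \<phi> x"
    and dom: "\<And>x y. W x y * \<phi> x \<le> \<phi> y"
    and mixing: "alpha_mixing M X"
    and mom: "(\<integral>\<^sup>+x. ennreal (\<phi> x) \<partial>D) < \<infinity>"
    and log: "(\<integral>\<^sup>+s \<in> {0<..<1}. ennreal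
               (ln (1 + right_inverse (\<lambda>t. mixing_coeff M X (nat \<lfloor>t\<rfloor>)) (s / 2)) *
                right_inverse (\<lambda>x. 1 - cdf (distr M borel (\<lambda>w. \<phi> (X 1 w))) x) s)
               \<partial>lborel) < \<infinity>"
  shows "AE w in M. (\<lambda>n.
    \<integral>\<^sup>+x. ennreal (\<phi> x * \<bar>(\<Sum>i=1..n. W x (X i w)) / n - (\<integral>y. W x y \<partial>D)\<bar>) \<partial>\<nu>) \<longlonglongrightarrow> 0"
proof -
  interpret \<nu>: finite_measure \<nu> by fact
  note X[measurable]
  interpret D: prob_space D
    using prob_space_distr[of "X 1" borel] D[of 1] X by simp
  have sets_D[measurable_cong]: "sets D = sets borel"
    using D[of 1, symmetric] by simp
  interpret pair_sigma_finite \<nu> M ..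
  have W_nonneg: "0 \<le> W x y" and W_le: "W x y \<le> 1" for x y
    using W01[of x y] by auto
  have \<phi>_int: "integrable D \<phi>"
    using mom \<phi>1 by (intro integrableI_nonneg) (auto intro: order_trans[OF zero_le_one])

  define h where "h = (\<lambda>x. 1 - cdf (distr M borel (\<lambda>w. \<phi> (X 1 w))) x)"
  interpret E: real_distribution "distr M borel (\<lambda>w. \<phi> (X 1 w))"
    by (rule real_distribution_distr) simp
  have h_eq: "h t = \<P>(w in M. t < \<phi> (X i w))" if i: "i \<ge> 1" for t i
  proof -
    have "h t = 1 - \<P>(w in M. \<phi> (X 1 w) \<le> t)"
      unfolding h_def cdf_def by (subst measure_distr) (auto intro!: arg_cong[where f=prob])
    also have "\<dots> = \<P>(w in M. \<not> \<phi> (X 1 w) \<le> t)"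
      by (subst prob_neg) auto
    also have "\<dots> = measure (distr M borel (X 1)) {x. t < \<phi> x}"
      by (subst measure_distr) (auto intro!: arg_cong[where f=prob])
    also have "\<dots> = measure (distr M borel (X i)) {x. t < \<phi> x}" using D[of 1] D[OF i] by simp
    also have "\<dots> = \<P>(w in M. t < \<phi> (X i w))"
      using i by (subst measure_distr) (auto intro!: arg_cong[where f=prob])
    finally show ?thesis .
  qed
  have h_mono: "h t \<le> h s" if "s \<le> t" for s t
    unfolding h_def using E.cdf_nondecreasing[OF that] by simp
  have h_1: "h t = 1" if "t < 1" for t
  proof -
    have "{w \<in> space M. t < \<phi> (X 1 w)} = space M" using that \<phi>1 by (auto intro: less_le_trans)
    then show ?thesis using h_eq[of 1 t] by (simp add: prob_space)
  qed
  have h_bdd: "bdd_above {x. 0 \<le> x \<and> h x > u}" if "0 < u" for u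
  proof -
    have "(h \<longlongrightarrow> 1 - 1) at_top"
      unfolding h_def by (intro tendsto_diff tendsto_const E.cdf_lim_at_top_prob)
    then have "\<forall>\<^sub>F x in at_top. h x < u" using that by (auto dest: order_tendstoD(2))
    then obtain b where "\<And>x. x \<ge> b \<Longrightarrow> h x < u" by (auto simp: eventually_at_top_linorder)
    then show ?thesis by (intro bdd_aboveI[of _ b]) (metis (mono_tags, lifting) less_asym linorder_le_cases mem_Collect_eq)
  qed
  \<comment> \<open>The values of \<open>Q\<close> and of \<open>a\<close> outside the open unit interval make \<open>1\<close> a lower bound for both
    functions on the whole line.\<close>
  define Q where "Q = (\<lambda>u. if u \<in> {0<..<1} then right_inverse h u else 1)"
  have Q_meas[measurable]: "Q \<in> borel_measurable borel"
    unfolding Q_def using h_bdd by (intro borel_measurable_antimono_on_unit right_inverse_antimono) auto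
  have Q_mono: "Q v \<le> Q u" if "0 < u" "u \<le> v" "v < 1" for u v
    using that h_bdd by (auto simp: Q_def intro: right_inverse_antimono)
  have Q1: "1 \<le> Q u" for u
  proof (cases "u \<in> {0<..<1}")
    case True
    have "t \<le> Q u" if "t < 1" for t
    proof (cases "0 \<le> t")
      case t: True
      show ?thesis using True t that h_1[OF that] h_bdd[of u] by (auto simp: Q_def intro: right_inverse_upper)
    next
      case False
      have "0 \<le> Q u" using True h_bdd[of u] by (auto simp: Q_def intro: right_inverse_nonneg)
      then show ?thesis using False by simp
    qed
    then show ?thesis by (rule dense_le)
  qed (auto simp: Q_def)
  have tail: "t < Q u" if "0 \<le> t" "0 < u" "u < 1" "u < h t" for t u
  proof -
    have "(h \<longlongrightarrow> h t) (at_right t)"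
      unfolding h_def using E.cdf_is_right_cont[of t] by (intro tendsto_diff tendsto_const) (simp add: continuous_within)
    then have "\<forall>\<^sub>F x in at_right t. u < h x" using that(4) by (rule order_tendstoD(1))
    then obtain b where b: "b > t" "\<And>x. t < x \<Longrightarrow> x < b \<Longrightarrow> u < h x"
      by (auto simp: eventually_at_right_field)
    define x where "x = (t + b) / 2"
    have x: "t < x" "x < b" using b(1) by (auto simp: x_def)
    have "x \<le> right_inverse h u"
      using b(2)[OF x] x that by (intro right_inverse_upper h_bdd) auto
    then show ?thesis using x that by (simp add: Q_def)
  qed
  have Q_int: "(\<integral>\<^sup>+u \<in> {0<..<1}. ennreal (Q u) \<partial>lborel) < \<infinity>"
  proof -
    have "(\<integral>\<^sup>+u \<in> {0<..<1}. ennreal (Q u) \<partial>lborel)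
        = (\<integral>\<^sup>+u. (\<integral>\<^sup>+s. ennreal (of_bool (0 \<le> s \<and> s < Q u)) * indicator {0<..<1} u \<partial>lborel) \<partial>lborel)"
      by (simp add: nn_integral_multc nn_integral_layer)
    also have "\<dots> = (\<integral>\<^sup>+s. (\<integral>\<^sup>+u. ennreal (of_bool (0 \<le> s \<and> s < Q u)) * indicator {0<..<1} u \<partial>lborel) \<partial>lborel)"
      by (intro lborel_pair.Fubini') measurable
    also have "\<dots> \<le> (\<integral>\<^sup>+s. (\<integral>\<^sup>+w. ennreal (of_bool (0 \<le> s \<and> s < \<phi> (X 1 w))) \<partial>M) \<partial>lborel)"
    proof (intro nn_integral_mono)
      fix s :: real
      show "(\<integral>\<^sup>+u. ennreal (of_bool (0 \<le> s \<and> s < Q u)) * indicator {0<..<1} u \<partial>lborel)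
        \<le> (\<integral>\<^sup>+w. ennreal (of_bool (0 \<le> s \<and> s < \<phi> (X 1 w))) \<partial>M)"
      proof (cases "0 \<le> s")
        case True
        have "(\<integral>\<^sup>+u. ennreal (of_bool (0 \<le> s \<and> s < Q u)) * indicator {0<..<1} u \<partial>lborel)
          \<le> (\<integral>\<^sup>+u. indicator {0..h s} u \<partial>lborel)"
        proof (intro nn_integral_mono)
          fix u
          show "ennreal (of_bool (0 \<le> s \<and> s < Q u)) * indicator {0<..<1} u \<le> indicator {0..h s} u"
            using less_right_inverse_imp[of s h u] True h_mono by (auto simp: indicator_def Q_def)
        qed
        also have "\<dots> = ennreal (\<P>(w in M. s < \<phi> (X 1 w)))"
          using h_eq[of 1 s] by simp
        also have "\<dots> = (\<integral>\<^sup>+w. indicator {w \<in> space M. s < \<phi> (X 1 w)} w \<partial>M)"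
          by (simp add: emeasure_eq_measure)
        also have "\<dots> = (\<integral>\<^sup>+w. ennreal (of_bool (0 \<le> s \<and> s < \<phi> (X 1 w))) \<partial>M)"
          using True by (intro nn_integral_cong) (auto simp: indicator_def)
        finally show ?thesis .
      qed simp
    qed
    also have "\<dots> = (\<integral>\<^sup>+w. (\<integral>\<^sup>+s. ennreal (of_bool (0 \<le> s \<and> s < \<phi> (X 1 w))) \<partial>lborel) \<partial>M)"
    proof -
      interpret Ml: pair_sigma_finite M lborel ..
      show ?thesis by (intro Ml.Fubini') measurable
    qed
    also have "\<dots> = (\<integral>\<^sup>+w. ennreal (\<phi> (X 1 w)) \<partial>M)" by (simp add: nn_integral_layer)
    also have "\<dots> = (\<integral>\<^sup>+x. ennreal (\<phi> x) \<partial>D)"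
      by (subst D[of 1, symmetric]) (auto simp: nn_integral_distr)
    finally show ?thesis using mom by (rule le_less_trans)
  qed

  define \<alpha> where "\<alpha> = mixing_coeff M X"
  define \<alpha>' where "\<alpha>' = (\<lambda>t::real. \<alpha> (nat \<lfloor>t\<rfloor>))"
  have alpha_nonneg: "0 \<le> \<alpha> j" for j unfolding \<alpha>_def by (rule mixing_coeff_nonneg)
  have alpha_bdd: "bdd_above {x. 0 \<le> x \<and> \<alpha>' x > u}" if "0 < u" for u
  proof -
    have "\<forall>\<^sub>F n in sequentially. \<alpha> n < u"
      using mixing that unfolding alpha_mixing_def \<alpha>_def by (auto dest: order_tendstoD(2))
    then obtain b where b: "\<And>n. n \<ge> b \<Longrightarrow> \<alpha> n < u" by (auto simp: eventually_sequentially)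
    have "x \<le> b" if "0 \<le> x" "\<alpha>' x > u" for x
    proof (rule ccontr)
      assume "\<not> x \<le> b"
      then have "b \<le> nat \<lfloor>x\<rfloor>" by (simp add: le_nat_iff le_floor_iff)
      then show False using b that by (fastforce simp: \<alpha>'_def)
    qed
    then show ?thesis by (intro bdd_aboveI[of _ "real b"]) auto
  qed
  define a where "a = (\<lambda>u. if u \<in> {0<..<1} then 1 + right_inverse \<alpha>' (u / 2) else 1)"
  have a_meas[measurable]: "a \<in> borel_measurable borel"
    unfolding a_def
    by (intro borel_measurable_antimono_on_unit add_left_mono right_inverse_antimono alpha_bdd) auto
  have a_mono: "a v \<le> a u" if "0 < u" "u \<le> v" "v < 1" for u v
    using that right_inverse_antimono[OF alpha_bdd, of "u / 2" "v / 2"] by (simp add: a_def)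
  have a1: "1 \<le> a u" for u
    using right_inverse_nonneg[OF alpha_bdd, of "u / 2"] by (simp add: a_def)
  have a_\<alpha>: "real j + 1 \<le> a u" if "0 < u" "u < 1" "1 \<le> j" "u < \<alpha> j" for u j
  proof -
    have "real j \<le> right_inverse \<alpha>' (u / 2)"
      using that by (intro right_inverse_upper alpha_bdd) (auto simp: \<alpha>'_def)
    then show ?thesis using that by (simp add: a_def)
  qed
  have fin: "(\<integral>\<^sup>+u \<in> {0<..<1}. ennreal (Q u * (5 + log 2 (a u))) \<partial>lborel) < \<infinity>"
  proof -
    have "(\<integral>\<^sup>+u \<in> {0<..<1}. ennreal (Q u * (5 + log 2 (a u))) \<partial>lborel)
      = (\<integral>\<^sup>+u. ennreal 5 * (ennreal (Q u) * indicator {0<..<1} u)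
          + ennreal (1 / ln 2) * (ennreal (ln (a u) * Q u) * indicator {0<..<1} u) \<partial>lborel)"
    proof (intro nn_integral_cong)
      fix u
      have nonneg: "0 \<le> 5 * Q u" "0 \<le> 1 / ln 2 * (ln (a u) * Q u)" "0 \<le> Q u" "0 \<le> ln (a u) * Q u"
        using Q1[of u] a1[of u] by auto
      have "Q u * (5 + log 2 (a u)) = 5 * Q u + 1 / ln 2 * (ln (a u) * Q u)"
        by (simp add: log_def algebra_simps)
      also have "ennreal \<dots> = ennreal (5 * Q u) + ennreal (1 / ln 2 * (ln (a u) * Q u))"
        by (rule ennreal_plus[OF nonneg(1,2)])
      also have "ennreal (5 * Q u) = ennreal 5 * ennreal (Q u)"
        by (rule ennreal_mult[OF _ nonneg(3)]) simp
      also have "ennreal (1 / ln 2 * (ln (a u) * Q u)) = ennreal (1 / ln 2) * ennreal (ln (a u) * Q u)"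
        by (rule ennreal_mult[OF _ nonneg(4)]) simp
      finally have "ennreal (Q u * (5 + log 2 (a u))) = ennreal 5 * ennreal (Q u) + ennreal (1 / ln 2) * ennreal (ln (a u) * Q u)" .
      then show "ennreal (Q u * (5 + log 2 (a u))) * indicator {0<..<1} u = ennreal 5 * (ennreal (Q u) * indicator {0<..<1} u)
          + ennreal (1 / ln 2) * (ennreal (ln (a u) * Q u) * indicator {0<..<1} u)"
        by (cases "u \<in> {0<..<1}") auto
    qed
    also have "\<dots> = ennreal 5 * (\<integral>\<^sup>+u \<in> {0<..<1}. ennreal (Q u) \<partial>lborel)
        + ennreal (1 / ln 2) * (\<integral>\<^sup>+u \<in> {0<..<1}. ennreal (ln (a u) * Q u) \<partial>lborel)"
      by (subst nn_integral_add, measurable, subst nn_integral_cmult, measurable, subst nn_integral_cmult, measurable)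
    also have "(\<integral>\<^sup>+u \<in> {0<..<1}. ennreal (ln (a u) * Q u) \<partial>lborel) < \<infinity>"
    proof -
      have "(\<integral>\<^sup>+u \<in> {0<..<1}. ennreal (ln (a u) * Q u) \<partial>lborel)
        = (\<integral>\<^sup>+s \<in> {0<..<1}. ennreal (ln (1 + right_inverse \<alpha>' (s / 2)) * right_inverse h s) \<partial>lborel)"
        by (intro nn_integral_cong) (auto simp: a_def Q_def indicator_def)
      then show ?thesis using log unfolding \<alpha>'_def \<alpha>_def h_def by simp
    qed
    ultimately show ?thesis using Q_int by (simp add: ennreal_mult_less_top)
  qed

  define \<F> where "\<F> = (\<lambda>m. sigma (space M) {X i -` S \<inter> space M | i S. i \<in> {1..m} \<and> S \<in> sets borel})"
  have sets_\<F>: "sets (\<F> m) = sigma_gen_by M X {1..m}" for m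
    unfolding \<F>_def sigma_gen_by_def by (intro sets_measure_of) auto
  have space_\<F>: "space (\<F> m) = space M" for m
    unfolding \<F>_def by (simp add: space_measure_of_conv)
  have \<F>_sub: "sets (\<F> m) \<subseteq> events" for m
    unfolding sets_\<F> sigma_gen_by_def
    by (intro sets.sigma_sets_subset) (auto intro: measurable_sets[OF X])
  have X_\<F>: "X i \<in> borel_measurable (\<F> m)" if "1 \<le> i" "i \<le> m" for i m
  proof (rule measurableI)
    show "X i -` S \<inter> space (\<F> m) \<in> sets (\<F> m)" if "S \<in> sets borel" for S
      unfolding sets_\<F> space_\<F> sigma_gen_by_def using that \<open>1 \<le> i\<close> \<open>i \<le> m\<close>
      by (intro sigma_sets.Basic) auto
  qed simp

  have law: "AE w in M. \<forall>d>0. \<forall>\<^sub>F n in sequentially. (\<Sum>i=1..n. \<psi> (X i w)) \<le> n * ((\<integral>y. \<psi> y \<partial>D) + d)"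
    if \<psi>[measurable]: "\<psi> \<in> borel_measurable borel" and \<psi>0: "\<And>x. 0 \<le> \<psi> x" and \<psi>_le: "\<And>x. \<psi> x \<le> \<phi> x" for \<psi>
  proof (rule dominated_mixing.mixing_strong_law_upper[of M _ \<F> Q a \<alpha> _ "distr D borel \<psi>"], unfold_locales)
    have int: "integrable D \<psi>"
      by (rule Bochner_Integration.integrable_bound[OF \<phi>_int])
        (use \<psi>0 order_trans[OF \<psi>_le abs_ge_self] in auto)
    show "0 \<le> (\<integral>y. \<psi> y \<partial>D)" using \<psi>0 by simp
    show "(\<lambda>w. \<psi> (X i w)) \<in> borel_measurable (\<F> m)" if "1 \<le> i" "i \<le> m" for i m
      by (rule measurable_compose[OF X_\<F>[OF that] \<psi>])
    show "distr M borel (\<lambda>w. \<psi> (X i w)) = distr D borel \<psi>" if "1 \<le> i" for i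
      unfolding D[OF that, symmetric] using that by (subst distr_distr) (auto simp: comp_def)
    have "(\<integral>\<^sup>+w. ennreal (\<psi> (X 1 w)) \<partial>M) = (\<integral>\<^sup>+y. ennreal (\<psi> y) \<partial>D)"
      by (subst D[of 1, symmetric]) (auto simp: nn_integral_distr)
    also have "\<dots> = ennreal (\<integral>y. \<psi> y \<partial>D)"
      using int \<psi>0 by (intro nn_integral_eq_integral) auto
    finally show "(\<integral>\<^sup>+w. ennreal (\<psi> (X 1 w)) \<partial>M) \<le> ennreal (\<integral>y. \<psi> y \<partial>D)" by simp
  next
    fix m j :: nat and A and t :: real assume mj: "1 \<le> m" "1 \<le> j" "A \<in> sets (\<F> m)"
    have "X (m + j) -` {x. t < \<psi> x} \<inter> space M \<in> sigma_gen_by M X {m + j..}"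
      unfolding sigma_gen_by_def
      by (intro sigma_sets.Basic CollectI exI[of _ "m + j"] exI[of _ "{x. t < \<psi> x}"] conjI refl) auto
    also have "X (m + j) -` {x. t < \<psi> x} \<inter> space M = {w \<in> space M. t < \<psi> (X (m + j) w)}" by auto
    finally have "{w \<in> space M. t < \<psi> (X (m + j) w)} \<in> sigma_gen_by M X {m + j..}" .
    then have "\<bar>prob (A \<inter> {w \<in> space M. t < \<psi> (X (m + j) w)}) - prob A * \<P>(w in M. t < \<psi> (X (m + j) w))\<bar> \<le> \<alpha> j"
      unfolding \<alpha>_def using mj by (intro mixing_coeff_upper) (auto simp: sets_\<F>)
    then show "prob (A \<inter> {w \<in> space M. t < \<psi> (X (m + j) w)}) \<le> prob A * \<P>(w in M. t < \<psi> (X (m + j) w)) + \<alpha> j"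
      by linarith
  next
    fix i :: nat and t u :: real
    assume *: "1 \<le> i" "0 \<le> t" "0 < u" "u < 1" "u < \<P>(w in M. t < \<psi> (X i w))"
    have "\<P>(w in M. t < \<psi> (X i w)) \<le> h t"
      unfolding h_eq[OF *(1)] using *(1) \<psi>_le by (intro finite_measure_mono) (auto intro: less_le_trans)
    then show "t < Q u" using * by (intro tail) auto
  qed (use space_\<F> \<F>_sub \<psi>0 alpha_nonneg Q1 Q_mono a1 a_mono a_\<alpha> fin in auto)

  define p where "p = (\<lambda>x. \<integral>y. W x y \<partial>D)"
  have p_meas[measurable]: "p \<in> borel_measurable borel"
    unfolding p_def by measurable
  have W_int: "integrable D (W x)" for x
    by (rule D.integrable_const_bound[of _ 1]) (auto simp: W_nonneg W_le)
  \<comment> \<open>Convergence is stated through the upper limit, a measurable function of \<open>(x, w)\<close>, so that the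
    quantifiers "for all \<open>x\<close>" and "almost surely" can be interchanged by Fubini's theorem.\<close>
  define G where "G = (\<lambda>n x w. ennreal \<bar>(\<Sum>i=1..n. W x (X i w)) / n - p x\<bar>)"
  have G_meas[measurable]: "(\<lambda>(x, w). G n x w) \<in> borel_measurable (\<nu> \<Otimes>\<^sub>M M)" for n
    unfolding G_def by measurable
  have "AE w in M. limsup (\<lambda>n. G n x w) = 0" for x
  proof -
    have upper: "AE w in M. \<forall>d>0. \<forall>\<^sub>F n in sequentially. (\<Sum>i=1..n. W x (X i w)) \<le> n * (p x + d)"
      unfolding p_def using W_nonneg order_trans[OF W_le \<phi>1] by (intro law) auto
    have lower: "AE w in M. \<forall>d>0. \<forall>\<^sub>F n in sequentially. (\<Sum>i=1..n. 1 - W x (X i w)) \<le> n * ((\<integral>y. 1 - W x y \<partial>D) + d)"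
    proof (rule law)
      show "1 - W x y \<le> \<phi> y" for y using W_nonneg[of x y] \<phi>1[of y] by linarith
    qed (auto simp: W_le)
    have compl: "(\<integral>y. 1 - W x y \<partial>D) = 1 - p x"
      unfolding p_def using W_int D.prob_space by simp
    show ?thesis
      using upper lower unfolding compl
    proof eventually_elim
      case (elim w)
      have "\<forall>\<^sub>F n in sequentially. \<bar>(\<Sum>i=1..n. W x (X i w)) / n - p x\<bar> < e" if e: "e > 0" for e
      proof -
        have "\<forall>\<^sub>F n in sequentially. (\<Sum>i=1..n. W x (X i w)) \<le> n * (p x + e / 2)"
          "\<forall>\<^sub>F n in sequentially. (\<Sum>i=1..n. 1 - W x (X i w)) \<le> n * (1 - p x + e / 2)"
          using elim e by auto
        then show ?thesis
          using eventually_gt_at_top[of 0]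
        proof eventually_elim
          case (elim n)
          have "(\<Sum>i=1..n. W x (X i w)) / n \<le> p x + e / 2"
            using elim by (simp add: divide_le_eq mult.commute)
          moreover have "p x - e / 2 \<le> (\<Sum>i=1..n. W x (X i w)) / n"
            using elim by (simp add: le_divide_eq sum_subtractf algebra_simps)
          ultimately show ?case using e by (simp add: abs_less_iff)
        qed
      qed
      then have "(\<lambda>n. \<bar>(\<Sum>i=1..n. W x (X i w)) / n - p x\<bar>) \<longlonglongrightarrow> 0"
        by (intro order_tendstoI) (auto intro: always_eventually less_le_trans)
      then have "(\<lambda>n. G n x w) \<longlonglongrightarrow> ennreal 0"
        unfolding G_def by (rule tendsto_ennrealI)
      then show ?case by (simp add: lim_imp_Limsup)
    qed
  qed
  then have "AE x in \<nu>. AE w in M. limsup (\<lambda>n. G n x w) = 0" by simp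
  then have conv: "AE w in M. AE x in \<nu>. limsup (\<lambda>n. G n x w) = 0"
  proof (subst (asm) AE_commute)
    have "(\<lambda>z. limsup (\<lambda>n. G n (fst z) (snd z))) \<in> borel_measurable (\<nu> \<Otimes>\<^sub>M M)"
      using G_meas by (intro borel_measurable_limsup) (simp add: split_beta')
    from measurable_sets[OF this, of "{0}"]
    show "{z \<in> space (\<nu> \<Otimes>\<^sub>M M). limsup (\<lambda>n. G n (fst z) (snd z)) = 0} \<in> sets (\<nu> \<Otimes>\<^sub>M M)"
      by (simp add: vimage_def Int_def conj_commute)
  qed
  have bound: "AE w in M. \<forall>d>0. \<forall>\<^sub>F n in sequentially. (\<Sum>i=1..n. \<phi> (X i w)) \<le> n * ((\<integral>y. \<phi> y \<partial>D) + d)"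
    using \<phi>1 by (intro law) (auto intro: order_trans[OF zero_le_one])
  show ?thesis
    using conv bound
  proof eventually_elim
    case (elim w)
    define m where "m = (\<integral>y. \<phi> y \<partial>D)"
    have "\<forall>\<^sub>F n in sequentially. (\<Sum>i=1..n. \<phi> (X i w)) \<le> n * (m + 1) \<and> 0 < n"
      using elim(2) eventually_gt_at_top[of "0::nat"] unfolding m_def by (auto intro: eventually_conj)
    then obtain n0 where n0: "\<And>n. n \<ge> n0 \<Longrightarrow> (\<Sum>i=1..n. \<phi> (X i w)) \<le> n * (m + 1) \<and> 0 < n"
      by (auto simp: eventually_sequentially)
    define f where "f = (\<lambda>n x. ennreal (\<phi> x * \<bar>(\<Sum>i=1..n. W x (X i w)) / n - p x\<bar>))"
    have [measurable]: "f n \<in> borel_measurable \<nu>" for n unfolding f_def by measurable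
    have pm: "\<phi> x * p x \<le> m" for x
    proof -
      have "\<phi> x * p x = (\<integral>y. \<phi> x * W x y \<partial>D)" unfolding p_def using W_int by simp
      also have "\<dots> \<le> m"
        unfolding m_def using dom W_int \<phi>_int by (intro integral_mono) (auto simp: mult.commute)
      finally show ?thesis .
    qed
    have "(\<lambda>n. \<integral>\<^sup>+x. f (n + n0) x \<partial>\<nu>) \<longlonglongrightarrow> (\<integral>\<^sup>+x. 0 \<partial>\<nu>)"
    proof (rule nn_integral_dominated_convergence[where w="\<lambda>_. ennreal (2 * m + 1)"])
      show "AE x in \<nu>. f (n + n0) x \<le> ennreal (2 * m + 1)" for n
      proof (intro AE_I2)
        fix x
        define k where "k = n + n0"
        let ?avg = "(\<Sum>i=1..k. W x (X i w)) / k"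
        have k: "(\<Sum>i=1..k. \<phi> (X i w)) \<le> k * (m + 1)" "0 < k" using n0[of k] by (auto simp: k_def)
        have "\<phi> x * (\<Sum>i=1..k. W x (X i w)) \<le> (\<Sum>i=1..k. \<phi> (X i w))"
          unfolding sum_distrib_left using dom by (intro sum_mono) (simp add: mult.commute)
        then have "\<phi> x * (?avg) \<le> m + 1"
          using k by (simp add: divide_le_eq mult.commute)
        moreover have "\<bar>?avg - p x\<bar> \<le> ?avg + p x"
          using W_nonneg unfolding p_def by (intro order_trans[OF abs_triangle_ineq4]) (simp add: sum_nonneg)
        then have "\<phi> x * \<bar>?avg - p x\<bar> \<le> \<phi> x * (?avg + p x)"
          using \<phi>1[of x] by (intro mult_left_mono) auto
        ultimately have "\<phi> x * \<bar>?avg - p x\<bar> \<le> 2 * m + 1"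
          using pm[of x] unfolding distrib_left by linarith
        then show "f (n + n0) x \<le> ennreal (2 * m + 1)" unfolding f_def k_def by (rule ennreal_leI)
      qed
      show "(\<integral>\<^sup>+x. ennreal (2 * m + 1) \<partial>\<nu>) < \<infinity>"
        using \<nu>.emeasure_finite by (simp add: ennreal_mult_eq_top_iff less_top[symmetric])
      show "AE x in \<nu>. (\<lambda>n. f (n + n0) x) \<longlonglongrightarrow> 0"
        using elim(1)
      proof eventually_elim
        case (elim x)
        then have "(\<lambda>n. G n x w) \<longlonglongrightarrow> 0" by (rule tendsto_0_if_Limsup_eq_0_ennreal)
        then have "(\<lambda>n. ennreal (\<phi> x) * G n x w) \<longlonglongrightarrow> ennreal (\<phi> x) * 0"
          by (intro ennreal_tendsto_cmult) auto
        moreover have "ennreal (\<phi> x) * G n x w = f n x" for n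
          unfolding G_def f_def using \<phi>1[of x] by (simp add: ennreal_mult)
        ultimately have "(\<lambda>n. f n x) \<longlonglongrightarrow> 0" by simp
        then show ?case by (rule LIMSEQ_ignore_initial_segment)
      qed
    qed auto
    then have "(\<lambda>n. \<integral>\<^sup>+x. f n x \<partial>\<nu>) \<longlonglongrightarrow> 0"
      by (simp add: LIMSEQ_offset[of "\<lambda>n. \<integral>\<^sup>+x. f n x \<partial>\<nu>" n0])
    then show ?case unfolding f_def p_def .
  qed
qed

end

section \<open>The risk functional at empirical distribution functions\<close>

text \<open>On each half-line one of the two factors of the density stays bounded, and the other one combines
  with the weight to the exponent \<open>\<gamma> - \<beta>\<close>.\<close>
lemma finite_measure_weight:
  fixes F :: "real \<Rightarrow> real" and \<beta> \<gamma> C :: real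
  assumes mono: "\<And>x y. x \<le> y \<Longrightarrow> F x \<le> F y" and F01: "\<And>x. 0 < F x" "\<And>x. F x < 1"
    and \<beta>: "0 \<le> \<beta>" and C: "0 \<le> C"
    and fin: "(\<integral>\<^sup>+x \<in> {..0}. ennreal (F x powr (\<gamma> - \<beta>)) \<partial>lborel) +
         (\<integral>\<^sup>+x \<in> {0..}. ennreal ((1 - F x) powr (\<gamma> - \<beta>)) \<partial>lborel) < \<infinity>"
  shows "finite_measure (density lborel
    (\<lambda>x. ennreal (C * F x powr (-\<beta>) * (1 - F x) powr (-\<beta>) / phi_weight \<gamma> F x)))" (is "finite_measure ?\<nu>")
proof (rule finite_measureI)
  have [measurable]: "F \<in> borel_measurable borel"
    using mono by (intro borel_measurable_mono monoI)
  define c d where "c = C * (1 - F 0) powr (-\<beta>)" and "d = C * F 0 powr (-\<beta>)"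
  have cd: "0 \<le> c" "0 \<le> d" using C by (auto simp: c_def d_def)
  let ?dens = "\<lambda>x. C * F x powr (-\<beta>) * (1 - F x) powr (-\<beta>) / phi_weight \<gamma> F x"
  have density_le: "?dens x
    \<le> (if x < 0 then c * F x powr (\<gamma> - \<beta>) else d * (1 - F x) powr (\<gamma> - \<beta>))" for x
  proof (cases "x < 0")
    case True
    have eq: "F x powr (-\<beta>) / F x powr (-\<gamma>) = F x powr (\<gamma> - \<beta>)"
      by (simp add: powr_diff[symmetric])
    have le: "C * (1 - F x) powr (-\<beta>) \<le> c"
      unfolding c_def using F01 mono[of x 0] True C \<beta> by (intro mult_left_mono powr_mono2') auto
    have "C * F x powr (-\<beta>) * (1 - F x) powr (-\<beta>) / F x powr (-\<gamma>) = C * (1 - F x) powr (-\<beta>) * (F x powr (-\<beta>) / F x powr (-\<gamma>))"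
      by (simp add: mult_ac)
    also have "\<dots> \<le> c * F x powr (\<gamma> - \<beta>)"
      unfolding eq using le by (intro mult_right_mono) auto
    finally show ?thesis using True by (simp add: phi_weight_def)
  next
    case False
    have eq: "(1 - F x) powr (-\<beta>) / (1 - F x) powr (-\<gamma>) = (1 - F x) powr (\<gamma> - \<beta>)"
      by (simp add: powr_diff[symmetric])
    have le: "C * F x powr (-\<beta>) \<le> d"
      unfolding d_def using F01 mono[of 0 x] False C \<beta> by (intro mult_left_mono powr_mono2') auto
    have "C * F x powr (-\<beta>) * (1 - F x) powr (-\<beta>) / (1 - F x) powr (-\<gamma>) = C * F x powr (-\<beta>) * ((1 - F x) powr (-\<beta>) / (1 - F x) powr (-\<gamma>))"
      by (simp add: mult_ac)
    also have "\<dots> \<le> d * (1 - F x) powr (\<gamma> - \<beta>)"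
      unfolding eq using le by (intro mult_right_mono) auto
    finally show ?thesis using False by (simp add: phi_weight_def)
  qed
  have pt: "ennreal (?dens x)
      \<le> ennreal c * (ennreal (F x powr (\<gamma> - \<beta>)) * indicator {..0} x)
        + ennreal d * (ennreal ((1 - F x) powr (\<gamma> - \<beta>)) * indicator {0..} x)" for x
  proof -
    have "ennreal (?dens x)
      \<le> (if x < 0 then ennreal c * ennreal (F x powr (\<gamma> - \<beta>)) else ennreal d * ennreal ((1 - F x) powr (\<gamma> - \<beta>)))"
      using density_le[of x] cd by (auto simp: ennreal_mult[symmetric] intro!: ennreal_leI split: if_splits)
    also have "\<dots> \<le> ennreal c * (ennreal (F x powr (\<gamma> - \<beta>)) * indicator {..0} x)
        + ennreal d * (ennreal ((1 - F x) powr (\<gamma> - \<beta>)) * indicator {0..} x)"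
      by (auto simp: indicator_def)
    finally show ?thesis .
  qed
  have "emeasure ?\<nu> (space ?\<nu>) = (\<integral>\<^sup>+x. ennreal (?dens x) \<partial>lborel)"
    unfolding phi_weight_def by (subst emeasure_density) auto
  also have "\<dots> \<le> (\<integral>\<^sup>+x. ennreal c * (ennreal (F x powr (\<gamma> - \<beta>)) * indicator {..0} x)
        + ennreal d * (ennreal ((1 - F x) powr (\<gamma> - \<beta>)) * indicator {0..} x) \<partial>lborel)"
    by (intro nn_integral_mono pt)
  also have "\<dots> = ennreal c * (\<integral>\<^sup>+x \<in> {..0}. ennreal (F x powr (\<gamma> - \<beta>)) \<partial>lborel)
        + ennreal d * (\<integral>\<^sup>+x \<in> {0..}. ennreal ((1 - F x) powr (\<gamma> - \<beta>)) \<partial>lborel)"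
    by (subst nn_integral_add, measurable, subst nn_integral_cmult, measurable, subst nn_integral_cmult, measurable)
  also have "\<dots> < \<infinity>" using fin by (auto simp: ennreal_mult_less_top)
  finally show "emeasure ?\<nu> (space ?\<nu>) \<noteq> \<infinity>" by simp
qed

theorem mainTheorem7:
  fixes M :: "'a measure" and p :: ennreal and \<rho> :: "('a \<Rightarrow> real) \<Rightarrow> real"
    and R :: "(real \<Rightarrow> real) \<Rightarrow> real" and KK :: "(real \<Rightarrow> real) set"
    and \<beta>' \<gamma> C' :: real and L F :: "real \<Rightarrow> real" and X :: "nat \<Rightarrow> 'a \<Rightarrow> real"
  defines "R \<equiv> risk_functional M p \<rho>"
  assumes "prob_space M" and "atomless M" and "1 \<le> p"
    and "law_invariant M p \<rho>" and "coherent_risk_measure M p \<rho>"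
    and "\<forall>K \<in> KK. unit_interval_df K \<and> continuous_on UNIV K \<and> convex_on {0..1} K"
    and "L_representation KK (dist_funs M p) R"
    and "0 \<le> \<beta>'" and "\<beta>' < \<gamma>" and "\<gamma> \<le> 1" and "0 < C'"
    and "\<forall>x \<in> {0<..<1}. 0 < L x"
    and "\<forall>x \<in> {0<..<1}. L x \<le> C' * x powr (-\<beta>') * (1 - x) powr (-\<beta>')"
    and "\<forall>K \<in> KK. \<forall>x \<in> {0<..<1}. \<forall>y \<in> {0..1}. \<bar>K y - K x\<bar> \<le> L x * \<bar>y - x\<bar>"
    and "F \<in> dist_funs M p" and "\<forall>x. F x \<in> {0<..<1}"
    and "(\<integral>\<^sup>+x \<in> {..0}. ennreal (F x powr (\<gamma> - \<beta>')) \<partial>lborel) +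
         (\<integral>\<^sup>+x \<in> {0..}. ennreal ((1 - F x) powr (\<gamma> - \<beta>')) \<partial>lborel) < \<infinity>"
    and "\<forall>i \<ge> 1. X i \<in> borel_measurable M \<and> cdf (distr M borel (X i)) = F"
  shows "(\<forall>Fs :: nat \<Rightarrow> real \<Rightarrow> real.
            (\<forall>n. Fs n \<in> empirical_dfs M X) \<longrightarrow>
            (\<lambda>n. weighted_sup_norm (phi_weight \<gamma> F) (\<lambda>x. Fs n x - F x)) \<longlonglongrightarrow> 0 \<longrightarrow>
            (\<lambda>n. \<bar>R (Fs n) - R F\<bar>)
              \<in> O(\<lambda>n. enn2real (weighted_sup_norm (phi_weight \<gamma> F) (\<lambda>x. Fs n x - F x)))) \<and>
         (\<forall>r \<in> {0..<1/2}.
            prob_space.indep_vars M (\<lambda>_. borel) X {1..} \<longrightarrow>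
            (\<integral>\<^sup>+x. ennreal (phi_weight \<gamma> F x powr (1 / (1 - r))) \<partial>interval_measure F) < \<infinity> \<longrightarrow>
            (AE \<omega> in M. (\<lambda>n. real n powr r * \<bar>R (empirical_df X n \<omega>) - R F\<bar>) \<longlonglongrightarrow> 0)) \<and>
         (alpha_mixing M X \<longrightarrow>
            (\<integral>\<^sup>+x. ennreal (phi_weight \<gamma> F x) \<partial>interval_measure F) < \<infinity> \<longrightarrow>
            (\<integral>\<^sup>+s \<in> {0<..<1}. ennreal
               (ln (1 + right_inverse (\<lambda>t. mixing_coeff M X (nat \<lfloor>t\<rfloor>)) (s / 2)) *
                right_inverse (\<lambda>x. 1 - cdf (distr M borel (\<lambda>\<omega>. phi_weight \<gamma> F (X 1 \<omega>))) x) s)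
               \<partial>lborel) < \<infinity> \<longrightarrow>
            (AE \<omega> in M. (\<lambda>n. \<bar>R (empirical_df X n \<omega>) - R F\<bar>) \<longlonglongrightarrow> 0))"
proof -
  note KK = assms(7) and rep = assms(8)
  interpret prob_space M by fact
  have \<beta>\<gamma>: "0 \<le> \<beta>'" "\<beta>' < \<gamma>" "0 < C'" "0 \<le> \<gamma>" using assms by auto
  have X[measurable]: "X i \<in> borel_measurable M" and cdf_X: "cdf (distr M borel (X i)) = F" if "i \<ge> 1" for i
    using assms(19) that by auto
  define D where "D = distr M borel (X 1)"
  interpret D: real_distribution D
    unfolding D_def by (rule real_distribution_distr) simp
  have cdf_D: "cdf D = F" using cdf_X[of 1] by (simp add: D_def)
  have D: "distr M borel (X i) = D" if "i \<ge> 1" for i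
    by (rule cdf_unique) (use that cdf_X cdf_D D.real_distribution_axioms in \<open>auto intro: real_distribution_distr\<close>)
  have F_mono: "F x \<le> F y" if "x \<le> y" for x y
    using D.cdf_nondecreasing[OF that] by (simp add: cdf_D)
  have F01: "0 < F x" "F x < 1" for x using assms(17) by auto
  have F_meas[measurable]: "F \<in> borel_measurable borel"
    using F_mono by (intro borel_measurable_mono monoI)
  define \<phi> where "\<phi> = phi_weight \<gamma> F"
  have \<phi>_meas[measurable]: "\<phi> \<in> borel_measurable borel"
    unfolding \<phi>_def phi_weight_def by measurable
  have \<phi>1: "1 \<le> \<phi> x" for x
  proof -
    have "1 \<le> y powr (-\<gamma>)" if "0 < y" "y < 1" for y
      using powr_mono2'[of "-\<gamma>" y 1] that \<beta>\<gamma> by simp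
    then show ?thesis using F01[of x] by (simp add: \<phi>_def phi_weight_def)
  qed
  have \<phi>_pos: "0 < \<phi> x" for x using \<phi>1[of x] by linarith
  define W where "W = (\<lambda>x y :: real. if x < 0 then of_bool (y \<le> x) else of_bool (x < y) :: real)"
  have W_meas: "case_prod W \<in> borel_measurable (borel \<Otimes>\<^sub>M borel)"
    unfolding W_def by measurable
  have W01: "W x y \<in> {0, 1}" for x y by (simp add: W_def)
  have dom: "W x y * \<phi> x \<le> \<phi> y" for x y
    using F_mono[of y x] F_mono[of x y] F01[of x] F01[of y] \<beta>\<gamma> \<phi>_pos[of y]
    by (auto simp: W_def \<phi>_def phi_weight_def intro!: powr_mono2')
  have W_mean: "(\<integral>y. W x y \<partial>D) = (if x < 0 then F x else 1 - F x)" for x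
  proof -
    have "W x = (if x < 0 then indicator {..x} else indicator {x<..})"
      by (auto simp: W_def fun_eq_iff indicator_def)
    moreover have "measure D {x<..} = 1 - measure D {..x}"
      using D.prob_compl[of "{..x}"] by (simp add: Compl_eq_Diff_UNIV[symmetric])
    moreover have "measure D {..x} = F x"
      by (simp add: cdf_D[symmetric] cdf_def)
    ultimately show ?thesis by simp
  qed
  define l where "l = (\<lambda>x. C' * F x powr (-\<beta>') * (1 - F x) powr (-\<beta>'))"
  have l_meas[measurable]: "l \<in> borel_measurable borel" unfolding l_def by measurable
  have l_nonneg: "0 \<le> l x" for x using \<beta>\<gamma> by (simp add: l_def)
  define \<nu> where "\<nu> = density lborel (\<lambda>x. ennreal (l x / \<phi> x))"
  have fin_\<nu>: "finite_measure \<nu>"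
    unfolding \<nu>_def l_def \<phi>_def using F_mono F01 \<beta>\<gamma> assms(18) by (intro finite_measure_weight) auto
  interpret \<nu>: finite_measure \<nu> by (rule fin_\<nu>)
  have sets_\<nu>[measurable_cong]: "sets \<nu> = sets borel" by (simp add: \<nu>_def)

  have emp: "empirical_df X n \<omega> x - F x = (if x < 0 then 1 else -1) * ((\<Sum>i=1..n. W x (X i \<omega>)) / n - (\<integral>y. W x y \<partial>D))"
    if n: "n \<ge> 1" for n \<omega> x
  proof (cases "x < 0")
    case True
    then show ?thesis unfolding W_mean by (simp add: empirical_df_def W_def indicator_def of_bool_def)
  next
    case False
    have "(\<Sum>i=1..n. indicator {X i \<omega>..} x) + (\<Sum>i=1..n. W x (X i \<omega>)) = (\<Sum>i=1..n. 1::real)"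
      unfolding sum.distrib[symmetric] using False by (intro sum.cong) (auto simp: W_def indicator_def)
    then have "(\<Sum>i=1..n. indicator {X i \<omega>..} x) = real n - (\<Sum>i=1..n. W x (X i \<omega>))" by simp
    then show ?thesis
      unfolding W_mean using False n by (simp add: empirical_df_def diff_divide_distrib)
  qed
  define \<Delta> where "\<Delta> = (\<lambda>n \<omega>. \<integral>\<^sup>+x. ennreal (\<phi> x * \<bar>(\<Sum>i=1..n. W x (X i \<omega>)) / n - (\<integral>y. W x y \<partial>D)\<bar>) \<partial>\<nu>)"
  have \<Delta>_eq: "\<Delta> n \<omega> = (\<integral>\<^sup>+x. ennreal (\<phi> x * \<bar>empirical_df X n \<omega> x - F x\<bar>) \<partial>\<nu>)" if "n \<ge> 1" for n \<omega>
    unfolding \<Delta>_def emp[OF that] by (intro nn_integral_cong) (simp add: abs_mult)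
  have emp_dist: "empirical_df X n \<omega> \<in> dist_funs M p" if "n \<ge> 1" for n \<omega>
    using assms(2,3) that by (rule empirical_df_in_dist_funs)
  have key: "ennreal \<bar>R (empirical_df X n \<omega>) - R F\<bar> \<le> \<Delta> n \<omega>" if n: "n \<ge> 1" for n \<omega>
  proof -
    let ?H = "empirical_df X n \<omega>"
    obtain \<mu> where \<mu>: "real_distribution \<mu>" "cdf \<mu> = ?H"
      using dist_funs_imp_cdf[OF assms(2) emp_dist[OF n]] by blast
    interpret \<mu>: real_distribution \<mu> by fact
    have H01: "?H x \<in> {0..1}" for x
      using \<mu>.cdf_nonneg[of x] \<mu>.cdf_bounded_prob[of x] by (simp add: \<mu>(2))
    have H_meas[measurable]: "?H \<in> borel_measurable borel"
      unfolding \<mu>(2)[symmetric] by (intro borel_measurable_mono monoI \<mu>.cdf_nondecreasing)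
    have "ennreal \<bar>R ?H - R F\<bar> \<le> (\<integral>\<^sup>+x. ennreal (l x * \<bar>?H x - F x\<bar>) \<partial>lborel)"
    proof (rule risk_diff_le[OF rep])
      show "\<forall>K\<in>KK. unit_interval_df K \<and> continuous_on UNIV K" using KK by blast
      show "\<exists>\<mu>. real_distribution \<mu> \<and> cdf \<mu> = H" if "H \<in> dist_funs M p" for H
        using dist_funs_imp_cdf[OF assms(2) that] .
      fix K x assume "K \<in> KK"
      then have "\<bar>K (?H x) - K (F x)\<bar> \<le> L (F x) * \<bar>?H x - F x\<bar>"
        using assms(15,17) H01 by blast
      also have "\<dots> \<le> l x * \<bar>?H x - F x\<bar>"
        unfolding l_def using assms(14,17) by (intro mult_right_mono) auto
      finally show "\<bar>K (?H x) - K (F x)\<bar> \<le> l x * \<bar>?H x - F x\<bar>" .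
    qed (use emp_dist[OF n] assms(16) in auto)
    also have "\<dots> = (\<integral>\<^sup>+x. ennreal (l x / \<phi> x) * ennreal (\<phi> x * \<bar>?H x - F x\<bar>) \<partial>lborel)"
    proof (intro nn_integral_cong)
      fix x
      have "l x * \<bar>?H x - F x\<bar> = l x / \<phi> x * (\<phi> x * \<bar>?H x - F x\<bar>)"
        using \<phi>_pos[of x] by simp
      then show "ennreal (l x * \<bar>?H x - F x\<bar>) = ennreal (l x / \<phi> x) * ennreal (\<phi> x * \<bar>?H x - F x\<bar>)"
        using l_nonneg[of x] \<phi>_pos[of x] by (metis abs_ge_zero divide_nonneg_pos ennreal_mult less_imp_le mult_nonneg_nonneg)
    qed
    also have "\<dots> = \<Delta> n \<omega>"
      unfolding \<Delta>_eq[OF n] \<nu>_def by (subst nn_integral_density) auto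
    finally show ?thesis .
  qed
  have interval_F: "interval_measure F = D"
    using interval_measure_cdf[OF D.real_distribution_axioms] by (simp add: cdf_D)

  have part1: "(\<lambda>n. \<bar>R (Fs n) - R F\<bar>) \<in> O(\<lambda>n. enn2real (weighted_sup_norm \<phi> (\<lambda>x. Fs n x - F x)))"
    if Fs: "\<And>n. Fs n \<in> empirical_dfs M X"
      and lim: "(\<lambda>n. weighted_sup_norm \<phi> (\<lambda>x. Fs n x - F x)) \<longlonglongrightarrow> 0" for Fs :: "nat \<Rightarrow> real \<Rightarrow> real"
  proof (rule bigoI)
    let ?s = "\<lambda>n. weighted_sup_norm \<phi> (\<lambda>x. Fs n x - F x)"
    have "\<forall>\<^sub>F n in sequentially. ?s n < 1"
      using order_tendstoD(2)[OF lim, of 1] by simp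
    then show "\<forall>\<^sub>F n in sequentially. norm \<bar>R (Fs n) - R F\<bar> \<le> measure \<nu> (space \<nu>) * norm (enn2real (?s n))"
    proof eventually_elim
      case (elim n)
      obtain m \<omega> where m: "m \<ge> 1" "Fs n = empirical_df X m \<omega>"
        using Fs[of n] by (auto simp: empirical_dfs_def)
      have s: "ennreal (enn2real (?s n)) = ?s n"
        using elim by (intro ennreal_enn2real) (auto intro: less_trans)
      have "ennreal \<bar>R (Fs n) - R F\<bar> \<le> (\<integral>\<^sup>+x. ennreal (\<phi> x * \<bar>Fs n x - F x\<bar>) \<partial>\<nu>)"
        using key[OF m(1), of \<omega>] unfolding \<Delta>_eq[OF m(1)] m(2) .
      also have "\<dots> \<le> (\<integral>\<^sup>+x. ?s n \<partial>\<nu>)"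
      proof (intro nn_integral_mono)
        show "ennreal (\<phi> x * \<bar>Fs n x - F x\<bar>) \<le> ?s n" for x
          unfolding weighted_sup_norm_def by (rule SUP_upper2[of x]) (simp_all add: mult.commute)
      qed
      also have "\<dots> = ennreal (measure \<nu> (space \<nu>) * enn2real (?s n))"
        by (simp add: ennreal_mult s \<nu>.emeasure_eq_measure mult.commute)
      finally show ?case by (simp add: ennreal_le_iff)
    qed
  qed
  have part2: "AE \<omega> in M. (\<lambda>n. real n powr r * \<bar>R (empirical_df X n \<omega>) - R F\<bar>) \<longlonglongrightarrow> 0"
    if r: "r \<in> {0..<1/2}" and indep: "indep_vars (\<lambda>_. borel) X {1..}"
      and mom: "(\<integral>\<^sup>+x. ennreal (\<phi> x powr (1 / (1 - r))) \<partial>interval_measure F) < \<infinity>" for r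
  proof -
    have "AE \<omega> in M. (\<lambda>n. ennreal (real n powr r) * \<Delta> n \<omega>) \<longlonglongrightarrow> 0"
      unfolding \<Delta>_def
      by (rule iid_weighted_empirical_rate[OF indep D fin_\<nu> sets_\<nu> W_meas W01 \<phi>_meas \<phi>_pos dom])
        (use r mom in \<open>auto simp: interval_F\<close>)
    then show ?thesis
    proof eventually_elim
      case (elim \<omega>)
      have "(\<lambda>n. ennreal (real n powr r * \<bar>R (empirical_df X n \<omega>) - R F\<bar>)) \<longlonglongrightarrow> 0"
      proof (rule tendsto_sandwich[OF _ _ tendsto_const elim])
        show "\<forall>\<^sub>F n in sequentially. ennreal (real n powr r * \<bar>R (empirical_df X n \<omega>) - R F\<bar>) \<le> ennreal (real n powr r) * \<Delta> n \<omega>"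
          using eventually_ge_at_top[of 1]
          by eventually_elim (auto simp: ennreal_mult intro!: mult_left_mono key)
      qed simp
      then show ?case
        using tendsto_ennreal_iff[of "\<lambda>n. real n powr r * \<bar>R (empirical_df X n \<omega>) - R F\<bar>" sequentially 0] by simp
    qed
  qed
  have part3: "AE \<omega> in M. (\<lambda>n. \<bar>R (empirical_df X n \<omega>) - R F\<bar>) \<longlonglongrightarrow> 0"
    if "alpha_mixing M X" and "(\<integral>\<^sup>+x. ennreal (\<phi> x) \<partial>interval_measure F) < \<infinity>"
      and "(\<integral>\<^sup>+s \<in> {0<..<1}. ennreal
               (ln (1 + right_inverse (\<lambda>t. mixing_coeff M X (nat \<lfloor>t\<rfloor>)) (s / 2)) *
                right_inverse (\<lambda>x. 1 - cdf (distr M borel (\<lambda>\<omega>. \<phi> (X 1 \<omega>))) x) s)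
               \<partial>lborel) < \<infinity>"
  proof -
    have "AE \<omega> in M. (\<lambda>n. \<Delta> n \<omega>) \<longlonglongrightarrow> 0"
      unfolding \<Delta>_def
      by (rule mixing_weighted_empirical_limit[OF X D fin_\<nu> sets_\<nu> W_meas W01 \<phi>_meas \<phi>1 dom])
        (use that in \<open>auto simp: interval_F\<close>)
    then show ?thesis
    proof eventually_elim
      case (elim \<omega>)
      have "(\<lambda>n. ennreal \<bar>R (empirical_df X n \<omega>) - R F\<bar>) \<longlonglongrightarrow> 0"
      proof (rule tendsto_sandwich[OF _ _ tendsto_const elim])
        show "\<forall>\<^sub>F n in sequentially. ennreal \<bar>R (empirical_df X n \<omega>) - R F\<bar> \<le> \<Delta> n \<omega>"
          using eventually_ge_at_top[of 1] by eventually_elim (rule key)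
      qed simp
      then show ?case
        using tendsto_ennreal_iff[of "\<lambda>n. \<bar>R (empirical_df X n \<omega>) - R F\<bar>" sequentially 0] by simp
    qed
  qed
  show ?thesis
    using part1 part2 part3 unfolding \<phi>_def by blast
qed

end
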